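(* Let $\mathcal{M}$ be a factor of type ${\rm II}_1$ with faithful normal finite trace $\tau$, $\tau(I)=1$, let $\alpha:[0,1]\to[0,\infty)$ be a monotone increasing continuous function with $\alpha(0)=0$, and let $\varphi_\alpha:\mathcal{M}^+\to[0,\infty]$ be the non-linear trace of the Choquet type associated with $\alpha$. Set $\alpha(s)=\alpha(1)$ for $s>1$. Then the following are equivalent: \begin{enumerate} \item[(1)] There exists a positive number $\beta$ such that $\varphi_\alpha(|a+b|)\le\beta\,(\varphi_\alpha(|a|)+\varphi_\alpha(|b|))$ for any $a,b\in\mathcal{M}$. \item[(2)] The ratio $\dfrac{\alpha(2s)}{\alpha(s)}$ is bounded over $s\in[0,1]$, i.e. there is a constant $C<\infty$ such that $\alpha(2s)\le C\,\alpha(s)$ for all $s\in[0,1]$. \item[(3)] $\mathcal{M}\ni a\mapsto|||a|||_{\alpha,p}=\varphi_\alpha(|a|^p)^{1/p}$ is a quasi-norm for any $p>0$. \item[(4)] $\mathcal{M}\ni a\mapsto|||a|||_{\alpha,p}=\varphi_\alpha(|a|^p)^{1/p}$ is a quasi-norm for some $p>0$. \end{enumerate}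
   Context: "Monotone increasing" means non-decreasing. For $a\in\mathcal{M}^+$, $e_{(s,\infty)}(a)$ denotes the spectral projection of $a$ for $(s,\infty)$, and the non-linear trace of the Choquet type associated with $\alpha$ is $$\varphi_\alpha(a)=\int_0^\infty\alpha(\tau(e_{(s,\infty)}(a)))\,ds .$$ $|a|=(a^*a)^{1/2}$. Quasi-norm: a function $\varphi$ on a complex vector space $X$ is a quasi-norm if there is a constant $c>1$ such that for all $x,y\in X$ and $\gamma\in\mathbb{C}$: $\varphi(x)\ge0$, $\varphi(\gamma x)=|\gamma|\varphi(x)$, and $\varphi(x+y)\le c(\varphi(x)+\varphi(y))$. *)

theory Defs
  imports "HOL-Analysis.Analysis"
begin

(* The norm and the topology are those of real_inner; positivity and definiteness of cinner
   follow from cinner_commute and inner_eq_Re_cinner. *)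
class complex_hilbert = real_inner + complete_space +
  fixes scaleC :: "complex \<Rightarrow> 'a \<Rightarrow> 'a" (infixr \<open>*\<^sub>C\<close> 75)
    and cinner :: "'a \<Rightarrow> 'a \<Rightarrow> complex"
  assumes scaleC_add_right: "c *\<^sub>C (x + y) = c *\<^sub>C x + c *\<^sub>C y"
    and scaleC_add_left: "(c + d) *\<^sub>C x = c *\<^sub>C x + d *\<^sub>C x"
    and scaleC_scaleC: "c *\<^sub>C (d *\<^sub>C x) = (c * d) *\<^sub>C x"
    and scaleC_of_real: "complex_of_real r *\<^sub>C x = r *\<^sub>R x"
    and cinner_commute: "cinner x y = cnj (cinner y x)"
    and cinner_add_right: "cinner x (y + z) = cinner x y + cinner x z"
    and cinner_scaleC_right: "cinner x (c *\<^sub>C y) = c * cinner x y"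
    and inner_eq_Re_cinner: "x \<bullet> y = Re (cinner x y)"
begin

lemma cinner_scaleC_left: "cinner (c *\<^sub>C x) y = cnj c * cinner x y"
  by (metis cinner_commute cinner_scaleC_right complex_cnj_mult)

lemma cinner_self: "cinner x x = complex_of_real (x \<bullet> x)"
proof -
  have "cinner x x = cnj (cinner x x)" by (rule cinner_commute)
  then have "Im (cinner x x) = 0" by (metis cnj.sel(2) neg_equal_zero)
  then show ?thesis by (simp add: complex_eq_iff inner_eq_Re_cinner)
qed

lemma norm_scaleC: "norm (c *\<^sub>C x) = cmod c * norm x"
proof -
  have "cinner (c *\<^sub>C x) (c *\<^sub>C x) = complex_of_real ((cmod c)\<^sup>2) * cinner x x"
    unfolding cinner_scaleC_left cinner_scaleC_right complex_norm_square
    by (simp add: mult_ac)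
  then have "(c *\<^sub>C x) \<bullet> (c *\<^sub>C x) = (cmod c)\<^sup>2 * (x \<bullet> x)"
    by (simp only: cinner_self of_real_mult[symmetric] of_real_eq_iff)
  then show ?thesis by (simp add: norm_eq_sqrt_inner real_sqrt_mult)
qed

end

lemma bounded_linear_scaleC: "bounded_linear (\<lambda>x::'h::complex_hilbert. c *\<^sub>C x)"
proof (rule bounded_linear_intro[where K = "cmod c"])
  show "c *\<^sub>C (r *\<^sub>R x) = r *\<^sub>R (c *\<^sub>C x)" for r and x :: 'h
    by (metis scaleC_of_real scaleC_scaleC mult.commute)
qed (simp_all add: scaleC_add_right norm_scaleC)

(* Operators are elements of the real Banach space of bounded real-linear maps; B(H) is the
   subset of the complex-linear ones. *)
type_synonym 'h op = "'h \<Rightarrow>\<^sub>L 'h"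

definition BH :: "'h::complex_hilbert op set" where
  "BH = {A. \<forall>c x. blinfun_apply A (c *\<^sub>C x) = c *\<^sub>C blinfun_apply A x}"

lift_definition op_scaleC :: "complex \<Rightarrow> 'h::complex_hilbert op \<Rightarrow> 'h op" is
  "\<lambda>c A x. c *\<^sub>C A x"
  by (rule bounded_linear_compose[OF bounded_linear_scaleC])

definition adj :: "'h::complex_hilbert op \<Rightarrow> 'h op" where
  "adj A = (THE B. \<forall>x y. cinner (blinfun_apply B x) y = cinner x (blinfun_apply A y))"

definition selfadjoint_op :: "'h::complex_hilbert op \<Rightarrow> bool" where
  "selfadjoint_op A \<longleftrightarrow> A \<in> BH \<and> adj A = A"

definition positive_op :: "'h::complex_hilbert op \<Rightarrow> bool" where
  "positive_op A \<longleftrightarrow> A \<in> BH \<and> (\<forall>x. cinner x (blinfun_apply A x) \<in> \<real>\<^sub>\<ge>\<^sub>0)"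

definition op_le :: "'h::complex_hilbert op \<Rightarrow> 'h op \<Rightarrow> bool" where
  "op_le A B \<longleftrightarrow> positive_op (B - A)"

definition projection_op :: "'h::complex_hilbert op \<Rightarrow> bool" where
  "projection_op P \<longleftrightarrow> P \<in> BH \<and> adj P = P \<and> P o\<^sub>L P = P"


definition commutant :: "'h::complex_hilbert op set \<Rightarrow> 'h op set" where
  "commutant S = {T \<in> BH. \<forall>A\<in>S. T o\<^sub>L A = A o\<^sub>L T}"

definition von_neumann_algebra :: "'h::complex_hilbert op set \<Rightarrow> bool" where
  "von_neumann_algebra M \<longleftrightarrow>
     M \<subseteq> BH \<and> (\<forall>A\<in>M. adj A \<in> M) \<and> commutant (commutant M) = M"

definition factor :: "'h::complex_hilbert op set \<Rightarrow> bool" where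
  "factor M \<longleftrightarrow> von_neumann_algebra M \<and> (id_blinfun :: 'h op) \<noteq> 0 \<and>
     M \<inter> commutant M = range (\<lambda>c. op_scaleC c id_blinfun)"

(* Murray-von Neumann equivalence relative to M. *)
definition proj_equiv :: "'h::complex_hilbert op set \<Rightarrow> 'h op \<Rightarrow> 'h op \<Rightarrow> bool" where
  "proj_equiv M P Q \<longleftrightarrow> (\<exists>V\<in>M. adj V o\<^sub>L V = P \<and> V o\<^sub>L adj V = Q)"

definition finite_proj :: "'h::complex_hilbert op set \<Rightarrow> 'h op \<Rightarrow> bool" where
  "finite_proj M P \<longleftrightarrow> P \<in> M \<and> projection_op P \<and>
     (\<forall>Q\<in>M. projection_op Q \<and> op_le Q P \<and> proj_equiv M P Q \<longrightarrow> Q = P)"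

definition abelian_proj :: "'h::complex_hilbert op set \<Rightarrow> 'h op \<Rightarrow> bool" where
  "abelian_proj M P \<longleftrightarrow> P \<in> M \<and> projection_op P \<and>
     (\<forall>A\<in>M. \<forall>B\<in>M.
        (P o\<^sub>L A o\<^sub>L P) o\<^sub>L (P o\<^sub>L B o\<^sub>L P) = (P o\<^sub>L B o\<^sub>L P) o\<^sub>L (P o\<^sub>L A o\<^sub>L P))"

(* Type II: no nonzero abelian projection, and every nonzero central projection dominates a
   nonzero finite one; the latter is automatic once the identity is finite. *)
definition factor_type_II1 :: "'h::complex_hilbert op set \<Rightarrow> bool" where
  "factor_type_II1 M \<longleftrightarrow> factor M \<and> finite_proj M id_blinfun \<and>
     (\<forall>P. abelian_proj M P \<longrightarrow> P = 0)"


definition directed_ops :: "'h::complex_hilbert op set \<Rightarrow> bool" where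
  "directed_ops D \<longleftrightarrow> D \<noteq> {} \<and> (\<forall>A\<in>D. \<forall>B\<in>D. \<exists>C\<in>D. op_le A C \<and> op_le B C)"

definition is_lub_in :: "'h::complex_hilbert op set \<Rightarrow> 'h op set \<Rightarrow> 'h op \<Rightarrow> bool" where
  "is_lub_in M D S \<longleftrightarrow> S \<in> M \<and> selfadjoint_op S \<and> (\<forall>A\<in>D. op_le A S) \<and>
     (\<forall>B\<in>M. selfadjoint_op B \<and> (\<forall>A\<in>D. op_le A B) \<longrightarrow> op_le S B)"

definition positive_functional_on ::
    "'h::complex_hilbert op set \<Rightarrow> ('h op \<Rightarrow> complex) \<Rightarrow> bool" where
  "positive_functional_on M \<tau> \<longleftrightarrow>
     (\<forall>A\<in>M. \<forall>B\<in>M. \<tau> (A + B) = \<tau> A + \<tau> B) \<and>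
     (\<forall>A\<in>M. \<forall>c. \<tau> (op_scaleC c A) = c * \<tau> A) \<and>
     (\<forall>A\<in>M. positive_op A \<longrightarrow> \<tau> A \<in> \<real>\<^sub>\<ge>\<^sub>0)"

(* A finite trace, given as a functional on all of M.  Re only turns the value of the trace at a
   positive operator, which is a nonnegative real, into an element of type real. *)
definition faithful_normal_finite_trace ::
    "'h::complex_hilbert op set \<Rightarrow> ('h op \<Rightarrow> complex) \<Rightarrow> bool" where
  "faithful_normal_finite_trace M \<tau> \<longleftrightarrow>
     positive_functional_on M \<tau> \<and>
     (\<forall>A\<in>M. \<forall>B\<in>M. \<tau> (A o\<^sub>L B) = \<tau> (B o\<^sub>L A)) \<and>
     (\<forall>A\<in>M. positive_op A \<and> \<tau> A = 0 \<longrightarrow> A = 0) \<and>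
     (\<forall>D S. D \<subseteq> {A \<in> M. positive_op A} \<and> directed_ops D \<and> is_lub_in M D S \<longrightarrow>
        Re (\<tau> S) = (SUP A\<in>D. Re (\<tau> A)))"


(* Only the values on Borel sets matter.  Convergence is in the strong operator topology;
   disjoint sets are sent to orthogonal projections as a consequence. *)
definition projection_valued_measure :: "(real set \<Rightarrow> 'h::complex_hilbert op) \<Rightarrow> bool" where
  "projection_valued_measure E \<longleftrightarrow>
     (\<forall>B\<in>sets borel. projection_op (E B)) \<and> E UNIV = id_blinfun \<and>
     (\<forall>F :: nat \<Rightarrow> real set. range F \<subseteq> sets borel \<and> disjoint_family F \<longrightarrow>
        (\<forall>x. (\<lambda>n. blinfun_apply (E (F n)) x) sums blinfun_apply (E (\<Union>n. F n)) x))"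

definition scalar_measure ::
    "(real set \<Rightarrow> 'h::complex_hilbert op) \<Rightarrow> 'h \<Rightarrow> real measure" where
  "scalar_measure E x =
     measure_of UNIV (sets borel) (\<lambda>B. ennreal (Re (cinner x (blinfun_apply (E B) x))))"

(* A = \<integral> t dE(t), tested on the vector states, which determine a complex-linear operator. *)
definition is_spectral_measure_of ::
    "(real set \<Rightarrow> 'h::complex_hilbert op) \<Rightarrow> 'h op \<Rightarrow> bool" where
  "is_spectral_measure_of E A \<longleftrightarrow>
     projection_valued_measure E \<and> (\<exists>K. E {-K..K} = id_blinfun) \<and>
     (\<forall>x. cinner x (blinfun_apply A x) = complex_of_real (\<integral>t. t \<partial>scalar_measure E x))"

(* Meant for self-adjoint A, where the restriction to Borel sets is unique by the spectral
   theorem; the choice only concerns non-Borel sets. *)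
definition spectral_measure :: "'h::complex_hilbert op \<Rightarrow> real set \<Rightarrow> 'h op" where
  "spectral_measure A = (SOME E. is_spectral_measure_of E A)"

definition fun_calculus :: "(real \<Rightarrow> real) \<Rightarrow> 'h::complex_hilbert op \<Rightarrow> 'h op" where
  "fun_calculus f A = (THE T. T \<in> BH \<and>
     (\<forall>x. cinner x (blinfun_apply T x) =
        complex_of_real (\<integral>t. f t \<partial>scalar_measure (spectral_measure A) x)))"

definition op_powr :: "'h::complex_hilbert op \<Rightarrow> real \<Rightarrow> 'h op" where
  "op_powr A p = fun_calculus (\<lambda>t. t powr p) A"

definition op_abs :: "'h::complex_hilbert op \<Rightarrow> 'h op" where
  "op_abs A = (THE B. positive_op B \<and> B o\<^sub>L B = adj A o\<^sub>L A)"


definition choquet_trace ::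
    "('h::complex_hilbert op \<Rightarrow> complex) \<Rightarrow> (real \<Rightarrow> real) \<Rightarrow> 'h op \<Rightarrow> ennreal" where
  "choquet_trace \<tau> \<alpha> A =
     (\<integral>\<^sup>+ s\<in>{0..}. ennreal (\<alpha> (Re (\<tau> (spectral_measure A {s<..})))) \<partial>lborel)"

(* Meant for r > 0. *)
definition ennreal_powr :: "ennreal \<Rightarrow> real \<Rightarrow> ennreal" where
  "ennreal_powr x r = (if x = \<infinity> then \<infinity> else ennreal (enn2real x powr r))"

definition choquet_norm ::
    "('h::complex_hilbert op \<Rightarrow> complex) \<Rightarrow> (real \<Rightarrow> real) \<Rightarrow> real \<Rightarrow> 'h op \<Rightarrow> ennreal" where
  "choquet_norm \<tau> \<alpha> p A = ennreal_powr (choquet_trace \<tau> \<alpha> (op_powr (op_abs A) p)) (1 / p)"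

(* X is a complex vector space with scalar multiplication smul.  Nonnegativity of \<phi> is built
   into the type; a quasi-norm takes finite values. *)
definition quasi_norm_on ::
    "'v::plus set \<Rightarrow> (complex \<Rightarrow> 'v \<Rightarrow> 'v) \<Rightarrow> ('v \<Rightarrow> ennreal) \<Rightarrow> bool" where
  "quasi_norm_on X smul \<phi> \<longleftrightarrow>
     (\<exists>c::real. c > 1 \<and>
        (\<forall>x\<in>X. \<phi> x < \<infinity>) \<and>
        (\<forall>x\<in>X. \<forall>\<gamma>. \<phi> (smul \<gamma> x) = ennreal (cmod \<gamma>) * \<phi> x) \<and>
        (\<forall>x\<in>X. \<forall>y\<in>X. \<phi> (x + y) \<le> ennreal c * (\<phi> x + \<phi> y)))"

end

theory Submission
  imports Defs
begin

text \<open>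
  Write \<open>d\<^sub>a(s) = \<tau>(e\<^bsub>(s,\<infinity>)\<^esub>(\<bar>a\<bar>))\<close>. On the common range of \<open>e\<^bsub>[0,s]\<^esub>(\<bar>a\<bar>)\<close> and
  \<open>e\<^bsub>[0,t]\<^esub>(\<bar>b\<bar>)\<close> one has \<open>\<parallel>(a + b)x\<parallel> \<le> (s + t)\<parallel>x\<parallel>\<close>, so this range meets that of
  \<open>e\<^bsub>(s+t,\<infinity>)\<^esub>(\<bar>a + b\<bar>)\<close> only in \<open>0\<close>; as \<open>\<tau>(E) + \<tau>(F) \<le> 1 + \<tau>(E \<and> F)\<close>, this gives
  \<open>d\<^bsub>a+b\<^esub>(s + t) \<le> d\<^sub>a(s) + d\<^sub>b(t)\<close>. Since \<open>d\<close> of \<open>\<bar>a\<bar>\<^sup>p\<close> at \<open>s\<close> is \<open>d\<^sub>a(s\<^bsup>1/p\<^esup>)\<close>, the doubling condition (2) and a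
  substitution in the Choquet integral yield (1) and (3). Conversely a factor of type II_1 contains
  orthogonal projections \<open>P\<close>, \<open>Q\<close> of any common trace \<open>s \<le> 1/2\<close>, and (1) or (4) for \<open>P\<close>, \<open>Q\<close> is (2) at \<open>s\<close>.

  For a positive operator \<open>A\<close> the range of \<open>e\<^bsub>[0,l]\<^esub>(A)\<close> is \<open>{x. \<parallel>A\<^sup>n x\<parallel> = O(l\<^sup>n)}\<close>. This description
  makes the spectral projections visibly elements of the algebra and determines every spectral
  measure of \<open>A\<close>.
\<close>

section \<open>Orthogonal projections and bounded forms on real Hilbert spaces\<close>

text \<open>The spectral measure, the powers and the modulus are defined by choice or by
  description, so nothing is known about them until existence and uniqueness are proved. For the
  spectral measure the growth description serves both ends: it yields the scalar measures of a
  positive operator before any functional calculus is available. Adjoints, roots and spectral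
  subspaces involve only the real inner product; complex linearity is recovered as commutation with
  the scalar operators, just as membership in the algebra is recovered as commutation with its
  commutant. The inequality for the trace of a meet is usually drawn from the equivalence of the two
  supports of T = (1 - F)E. Only equality of their traces is needed, and it follows from cyclicity
  and normality without a polar decomposition. Orthogonal projections of equal trace come from the
  absence of abelian projections: it excludes minimal projections, so that nonzero projections of
  arbitrarily small trace exist, and a maximality argument then reaches every prescribed
  value.\<close>

lemma parallelogram_law:
  fixes x y :: "'a::real_inner"
  shows "(norm (x + y))\<^sup>2 + (norm (x - y))\<^sup>2 = 2 * (norm x)\<^sup>2 + 2 * (norm y)\<^sup>2"
  by (simp add: power2_norm_eq_inner algebra_simps inner_commute)

text \<open>The midpoint of two terms of a minimizing sequence stays in \<open>S\<close>, so the
  parallelogram law makes the sequence Cauchy.\<close>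

lemma closed_subspace_nearest:
  fixes S :: "'a::{real_inner,complete_space} set"
  assumes "closed S" "subspace S"
  obtains y where "y \<in> S" "\<And>z. z \<in> S \<Longrightarrow> (norm (x - y)) \<le> norm (x - z)"
proof -
  define d where "d = (INF y\<in>S. (norm (x - y))\<^sup>2)"
  have S0: "S \<noteq> {}" using assms subspace_0 by blast
  have bdd: "bdd_below ((\<lambda>y. (norm (x - y))\<^sup>2) ` S)" by (rule bdd_belowI[of _ 0]) auto
  have dle: "d \<le> (norm (x - y))\<^sup>2" if "y \<in> S" for y
    unfolding d_def by (rule cINF_lower[OF bdd that])
  have "\<exists>y\<in>S. (norm (x - y))\<^sup>2 < d + 1 / real (Suc n)" for n
    using cINF_less_iff[OF S0 bdd, of "d + 1 / real (Suc n)"] unfolding d_def by simp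
  then obtain y where y: "\<And>n. y n \<in> S" "\<And>n. (norm (x - y n))\<^sup>2 < d + 1 / real (Suc n)" by metis
  have diff: "(norm (y n - y m))\<^sup>2 \<le> 2 / real (Suc n) + 2 / real (Suc m)" for n m
  proof -
    have "(1/2) *\<^sub>R (y n + y m) \<in> S"
      using assms(2) y(1) by (intro subspace_scale subspace_add)
    then have "4 * d \<le> (norm (2 *\<^sub>R (x - (1/2) *\<^sub>R (y n + y m))))\<^sup>2"
      using dle[of "(1/2) *\<^sub>R (y n + y m)"] by (simp add: power_mult_distrib)
    also have "2 *\<^sub>R (x - (1/2) *\<^sub>R (y n + y m)) = (x - y n) + (x - y m)"
      by (simp add: algebra_simps scaleR_2)
    finally have "4 * d \<le> (norm ((x - y n) + (x - y m)))\<^sup>2" .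
    moreover have "(norm ((x - y n) - (x - y m)))\<^sup>2 = (norm (y n - y m))\<^sup>2"
      by (simp add: norm_minus_commute)
    ultimately show ?thesis
      using parallelogram_law[of "x - y n" "x - y m"] y(2)[of n] y(2)[of m] by (simp only: divide_inverse)
  qed
  have "Cauchy y"
  proof (rule CauchyI')
    fix e :: real assume e: "0 < e"
    obtain N where N: "4 / real (Suc N) < e\<^sup>2"
      using reals_Archimedean[of "e\<^sup>2 / 4"] e by (auto simp: field_simps)
    have "dist (y m) (y n) < e" if mn: "m \<ge> N" "n > m" for m n
    proof -
      have "2 / real (Suc k) \<le> 2 / real (Suc N)" if "k \<ge> N" for k
        using that by (intro divide_left_mono) auto
      from this[of m] this[of n] have "(norm (y m - y n))\<^sup>2 \<le> 4 / real (Suc N)"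
        using diff[of m n] mn by (simp)
      then have "(norm (y m - y n))\<^sup>2 < e\<^sup>2" using N by simp
      then show ?thesis using e by (simp add: dist_norm power_less_imp_less_base)
    qed
    then show "\<exists>M. \<forall>m\<ge>M. \<forall>n>m. dist (y m) (y n) < e" by blast
  qed
  then obtain z where z: "y \<longlonglongrightarrow> z" using Cauchy_convergent_iff convergent_def by blast
  have zS: "z \<in> S" using closed_sequentially[OF assms(1)] y(1) z by blast
  have "(\<lambda>n. (norm (x - y n))\<^sup>2) \<longlonglongrightarrow> (norm (x - z))\<^sup>2" by (intro tendsto_intros z)
  moreover have "(\<lambda>n. d + 1 / real (Suc n)) \<longlonglongrightarrow> d + 0"
    by (intro tendsto_intros LIMSEQ_inverse_real_of_nat[unfolded inverse_eq_divide])
  ultimately have "(norm (x - z))\<^sup>2 \<le> d + 0"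
    by (rule LIMSEQ_le) (use y(2) less_imp_le in blast)
  then have "norm (x - z) \<le> norm (x - u)" if "u \<in> S" for u
    using dle[OF that] by (simp add: power2_le_imp_le)
  with zS show thesis using that by blast
qed

lemma closed_subspace_orth_decomp:
  fixes S :: "'a::{real_inner,complete_space} set"
  assumes "closed S" "subspace S"
  shows "\<exists>!y. y \<in> S \<and> (\<forall>z\<in>S. (x - y) \<bullet> z = 0)"
proof -
  obtain y where y: "y \<in> S" "\<And>z. z \<in> S \<Longrightarrow> (norm (x - y)) \<le> norm (x - z)"
    using closed_subspace_nearest[OF assms] by metis
  have orth: "(x - y) \<bullet> z = 0" if "z \<in> S" for z
  proof (cases "z = 0")
    case False
    \<comment> \<open>This is the value of \<open>t\<close> at which
      \<open>norm (x - y - t *\<^sub>R z)\<close> is smallest.\<close>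
    define t where "t = ((x - y) \<bullet> z) / (z \<bullet> z)"
    have zz: "z \<bullet> z > 0" using False by simp
    have "y + t *\<^sub>R z \<in> S" using y(1) that assms(2) by (intro subspace_add subspace_scale)
    then have "(norm (x - y))\<^sup>2 \<le> (norm (x - (y + t *\<^sub>R z)))\<^sup>2"
      using y(2) by (simp add: power_mono)
    also have "x - (y + t *\<^sub>R z) = (x - y) - t *\<^sub>R z" by simp
    also have "(norm ((x - y) - t *\<^sub>R z))\<^sup>2 = (norm (x-y))\<^sup>2 - 2 * t * ((x - y) \<bullet> z) + t\<^sup>2 * (z \<bullet> z)"
      unfolding power2_norm_eq_inner inner_diff_left[of "x - y"] inner_diff_right[of _ "x - y"]
      by (simp add: inner_commute algebra_simps power2_eq_square)
    finally have "2 * t * ((x - y) \<bullet> z) \<le> t\<^sup>2 * (z \<bullet> z)" by simp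
    then have "((x - y) \<bullet> z)\<^sup>2 \<le> 0"
      using zz unfolding t_def by (simp add: field_simps power2_eq_square)
    then show ?thesis by simp
  qed simp
  show ?thesis
  proof (rule ex1I[of _ y])
    fix v assume v: "v \<in> S \<and> (\<forall>z\<in>S. (x - v) \<bullet> z = 0)"
    have "v - y \<in> S" using v y(1) assms(2) subspace_diff by blast
    then have "(x - y) \<bullet> (v - y) = 0" "(x - v) \<bullet> (v - y) = 0" using v orth by auto
    then have "(v - y) \<bullet> (v - y) = 0" by (simp add: inner_diff_left)
    then show "v = y" by simp
  qed (use y orth in auto)
qed

definition orth_proj :: "'a::{real_inner,complete_space} set \<Rightarrow> 'a \<Rightarrow>\<^sub>L 'a" where
  "orth_proj S = Blinfun (\<lambda>x. THE y. y \<in> S \<and> (\<forall>z\<in>S. (x - y) \<bullet> z = 0))"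

context
  fixes S :: "'a::{real_inner,complete_space} set"
  assumes S: "closed S" "subspace S"
begin

lemma orth_proj_apply:
  "orth_proj S x = (THE y. y \<in> S \<and> (\<forall>z\<in>S. (x - y) \<bullet> z = 0))"
proof -
  define f where "f x = (THE y. y \<in> S \<and> (\<forall>z\<in>S. (x - y) \<bullet> z = 0))" for x
  have f: "f x \<in> S \<and> (\<forall>z\<in>S. (x - f x) \<bullet> z = 0)" for x
    unfolding f_def by (rule theI'[OF closed_subspace_orth_decomp[OF S]])
  have uniq: "f x = y" if "y \<in> S" "\<And>z. z \<in> S \<Longrightarrow> (x - y) \<bullet> z = 0" for x y
    using closed_subspace_orth_decomp[OF S, of x] f[of x] that by blast
  have "bounded_linear f"
  proof (rule bounded_linear_intro[where K = 1])
    show "f (x + y) = f x + f y" for x y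
      using f[of x] f[of y] S(2)
      by (intro uniq subspace_add) (auto simp: inner_diff_left inner_add_left)
    show "f (r *\<^sub>R x) = r *\<^sub>R f x" for r x
      using f[of x] S(2)
      by (intro uniq subspace_scale) (auto simp: inner_diff_left)
    show "norm (f x) \<le> norm x * 1" for x
    proof -
      have "(x - f x) \<bullet> f x = 0" using f by blast
      then have "(norm (f x))\<^sup>2 + (norm (x - f x))\<^sup>2 = (norm x)\<^sup>2"
        by (simp add: power2_norm_eq_inner algebra_simps inner_commute)
      then have "(norm (f x))\<^sup>2 \<le> (norm x)\<^sup>2" by (metis le_add_same_cancel1 zero_le_power2)
      then show ?thesis by simp
    qed
  qed
  then show ?thesis
    unfolding orth_proj_def f_def by (simp add: bounded_linear_Blinfun_apply)
qed

lemma orth_proj_mem: "orth_proj S x \<in> S"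
  and orth_proj_orth: "z \<in> S \<Longrightarrow> (x - orth_proj S x) \<bullet> z = 0"
  using theI'[OF closed_subspace_orth_decomp[OF S], of x] unfolding orth_proj_apply by auto

lemma orth_proj_eqI: "y \<in> S \<Longrightarrow> (\<And>z. z \<in> S \<Longrightarrow> (x - y) \<bullet> z = 0) \<Longrightarrow> orth_proj S x = y"
  using closed_subspace_orth_decomp[OF S, of x] orth_proj_mem[of x] orth_proj_orth[of _ x] by blast

lemma orth_proj_fixed_iff: "orth_proj S x = x \<longleftrightarrow> x \<in> S"
  using orth_proj_eqI[of x x] orth_proj_mem[of x] by auto

lemma orth_proj_idem: "orth_proj S (orth_proj S x) = orth_proj S x"
  using orth_proj_fixed_iff orth_proj_mem by blast

lemma orth_proj_sym: "orth_proj S x \<bullet> y = x \<bullet> orth_proj S y"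
  using orth_proj_orth[OF orth_proj_mem[of y], of x] orth_proj_orth[OF orth_proj_mem[of x], of y]
  by (simp add: inner_diff_left inner_diff_right inner_commute)

lemma orth_proj_eq_0_iff: "orth_proj S x = 0 \<longleftrightarrow> (\<forall>z\<in>S. x \<bullet> z = 0)"
  using orth_proj_orth[of _ x] orth_proj_eqI[of 0 x] subspace_0[OF S(2)] by auto

end

lemma riesz_representation_inner:
  fixes f :: "'a::{real_inner,complete_space} \<Rightarrow> real"
  assumes "bounded_linear f"
  obtains y where "\<And>x. f x = y \<bullet> x"
proof (cases "\<forall>x. f x = 0")
  case True then show ?thesis using that[of 0] by simp
next
  case False
  then obtain u where u: "f u \<noteq> 0" by blast
  interpret f: bounded_linear f by fact
  let ?S = "{x. f x = 0}"
  have S: "closed ?S" "subspace ?S"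
    by (auto intro!: closed_Collect_eq f.continuous_on continuous_intros simp: subspace_def f.zero f.add f.scaleR)
  define v where "v = u - orth_proj ?S u"
  have v: "v \<bullet> z = 0" if "f z = 0" for z unfolding v_def using orth_proj_orth[OF S] that by blast
  have fv: "f v = f u" using orth_proj_mem[OF S, of u] by (simp add: v_def f.diff)
  have vv: "v \<bullet> v \<noteq> 0" using fv u f.zero by auto
  have "f x = ((f v / (v \<bullet> v)) *\<^sub>R v) \<bullet> x" for x
  proof -
    have "v \<bullet> (x - (f x / f v) *\<^sub>R v) = 0" using u fv by (intro v) (simp add: f.diff f.scaleR)
    then have "v \<bullet> x = f x / f v * (v \<bullet> v)" by (simp add: inner_diff_right)
    then show ?thesis using vv u fv by simp
  qed
  then show ?thesis by (rule that)
qed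

lemma bounded_bilinear_form_represented:
  fixes B :: "'a::real_normed_vector \<Rightarrow> 'b::{real_inner,complete_space} \<Rightarrow> real"
  assumes "bounded_bilinear B"
  shows "\<exists>T :: 'a \<Rightarrow>\<^sub>L 'b. \<forall>x y. B x y = T x \<bullet> y"
proof -
  interpret B: bounded_bilinear B by fact
  have "\<exists>v. \<forall>y. B x y = v \<bullet> y" for x
    using riesz_representation_inner[OF B.bounded_linear_right[of x]] by metis
  then obtain t where t: "\<And>x y. B x y = t x \<bullet> y" by metis
  have eqI: "u = v" if "\<And>y. u \<bullet> y = v \<bullet> y" for u v :: 'b
    using that[of "u - v"] by (metis inner_diff_left inner_eq_zero_iff right_minus_eq)
  obtain K where K: "K \<ge> 0" "\<And>x y. norm (B x y) \<le> norm x * norm y * K" using B.nonneg_bounded by blast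
  have "bounded_linear t"
  proof (rule bounded_linear_intro[where K = K])
    show "t (x + y) = t x + t y" for x y
      by (rule eqI) (simp add: t[symmetric] B.add_left inner_add_left)
    show "t (r *\<^sub>R x) = r *\<^sub>R t x" for r x
      by (rule eqI) (simp add: t[symmetric] B.scaleR_left)
    show "norm (t x) \<le> norm x * K" for x
    proof (cases "t x = 0")
      case False
      have "norm (t x) * norm (t x) \<le> (norm x * K) * norm (t x)"
        using K(2)[of x "t x"] by (simp add: t power2_norm_eq_inner[symmetric] power2_eq_square mult_ac)
      then show ?thesis using False by (simp add: mult_le_cancel_right)
    qed (simp add: K)
  qed
  then have "B x y = Blinfun t x \<bullet> y" for x y by (simp add: t bounded_linear_Blinfun_apply)
  then show ?thesis by blast
qed

lemma real_adjoint_exists: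
  fixes A' :: "'b::{real_inner,complete_space} \<Rightarrow>\<^sub>L 'a::real_inner"
  shows "\<exists>B::'a \<Rightarrow>\<^sub>L 'b. \<forall>x y. x \<bullet> A' y = B x \<bullet> y"
  using bounded_bilinear_form_represented[OF
      bounded_bilinear.comp[OF bounded_bilinear_inner bounded_linear_ident blinfun.bounded_linear_right, of A']]
  by simp

text \<open>Additivity gives homogeneity for integers. Splitting \<open>n * r\<close> into integer
  and fractional part shows that \<open>n * (f (r *\<^sub>R x) - r * f x)\<close> stays bounded in
  \<open>n\<close>, so the difference is 0. The shape of the bound is the one that polarization
  supplies, with \<open>c\<close> the squared norm of the fixed second argument.\<close>

lemma additive_bounded_scaleR:
  fixes f :: "'a::real_normed_vector \<Rightarrow> real"
  assumes add: "\<And>x y. f (x + y) = f x + f y"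
    and bd: "\<And>x. \<bar>f x\<bar> \<le> K * ((norm x)\<^sup>2 + c)"
  shows "f (r *\<^sub>R x) = r * f x"
proof -
  have f0: "f 0 = 0" using add[of 0 0] by simp
  have fm: "f (- x) = - f x" for x using add[of x "-x"] f0 by simp
  have fn: "f (real n *\<^sub>R x) = real n * f x" for n x
    by (induction n) (simp_all add: f0 add algebra_simps)
  have fi: "f (of_int k *\<^sub>R x) = of_int k * f x" for k x
    by (cases k rule: int_cases2) (simp_all add: fn fm)
  have lim: "\<bar>n * (f (r *\<^sub>R x) - r * f x)\<bar> \<le> \<bar>K\<bar> * ((norm x)\<^sup>2 + \<bar>c\<bar>) + \<bar>f x\<bar>" (is "_ \<le> ?B") if n: "n = real m" for n m
  proof -
    define t where "t = frac (n * r)"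
    have t: "0 \<le> t" "t < 1" by (simp_all add: t_def frac_lt_1)
    have nr: "n * r = of_int \<lfloor>n * r\<rfloor> + t" by (simp add: t_def frac_def)
    have "n * f (r *\<^sub>R x) = f ((n * r) *\<^sub>R x)" using fn[of m "r *\<^sub>R x"] n by simp
    also have "\<dots> = of_int \<lfloor>n * r\<rfloor> * f x + f (t *\<^sub>R x)"
      by (subst nr) (simp only: scaleR_add_left add fi)
    also have "\<dots> = n * r * f x - t * f x + f (t *\<^sub>R x)"
    proof -
      have "of_int \<lfloor>n * r\<rfloor> = n * r - t" using nr by linarith
      then show ?thesis by (simp only: left_diff_distrib)
    qed
    finally have "n * (f (r *\<^sub>R x) - r * f x) = f (t *\<^sub>R x) - t * f x" by (simp add: algebra_simps)
    moreover have "\<bar>f (t *\<^sub>R x)\<bar> \<le> \<bar>K\<bar> * ((norm x)\<^sup>2 + \<bar>c\<bar>)"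
    proof -
      have "(norm (t *\<^sub>R x))\<^sup>2 \<le> (norm x)\<^sup>2"
        using t by (intro power_mono) (auto simp: mult_left_le_one_le)
      then have "\<bar>K\<bar> * \<bar>(norm (t *\<^sub>R x))\<^sup>2 + c\<bar> \<le> \<bar>K\<bar> * ((norm x)\<^sup>2 + \<bar>c\<bar>)"
        by (intro mult_left_mono abs_ge_zero) (smt (verit) zero_le_power2)
      then have "K * ((norm (t *\<^sub>R x))\<^sup>2 + c) \<le> \<bar>K\<bar> * ((norm x)\<^sup>2 + \<bar>c\<bar>)"
        by (metis abs_ge_self abs_mult order_trans)
      then show ?thesis using bd[of "t *\<^sub>R x"] by linarith
    qed
    moreover have "\<bar>t * f x\<bar> \<le> \<bar>f x\<bar>" using t by (simp add: abs_mult mult_left_le_one_le)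
    ultimately show ?thesis by linarith
  qed
  show ?thesis
  proof (rule ccontr)
    assume "f (r *\<^sub>R x) \<noteq> r * f x"
    then have "\<bar>f (r *\<^sub>R x) - r * f x\<bar> > 0" by simp
    then obtain m where "real m * \<bar>f (r *\<^sub>R x) - r * f x\<bar> > ?B"
      using reals_Archimedean3 by blast
    then show False using lim[of "real m" m] by (simp add: abs_mult)
  qed
qed

text \<open>Jordan and von Neumann: the parallelogram law makes the polarization of \<open>Q\<close> additive.\<close>
lemma quadratic_form_represented:
  fixes Q :: "'a::{real_inner,complete_space} \<Rightarrow> real"
  assumes par: "\<And>x y. Q (x + y) + Q (x - y) = 2 * Q x + 2 * Q y"
    and bd: "\<And>x. \<bar>Q x\<bar> \<le> K * (norm x)\<^sup>2"
  obtains T :: "'a \<Rightarrow>\<^sub>L 'a" where "\<And>x y. T x \<bullet> y = x \<bullet> T y" "\<And>x. x \<bullet> T x = Q x"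
proof -
  define B where "B x y = (Q (x + y) - Q (x - y)) / 4" for x y
  have Q0: "Q 0 = 0" using par[of 0 0] by simp
  have Qm: "Q (- x) = Q x" for x using par[of 0 x] Q0 by simp
  have Q2: "Q (x + x) = 4 * Q x" for x using par[of x x] Q0 by simp
  have Bs: "B x y = B y x" for x y using Qm[of "x - y"] by (simp add: B_def add.commute)
  have B0: "B 0 y = 0" for y by (simp add: B_def Qm)
  have half: "B (u + v) y + B (u - v) y = 2 * B u y" for u v y
  proof -
    have "u + y + v = u + v + y" "u + y - v = u - v + y" "u - y + v = u + v - y" "u - y - v = u - v - y"
      by (simp_all add: algebra_simps)
    then show ?thesis using par[of "u + y" v] par[of "u - y" v] by (simp add: B_def field_simps)
  qed
  have add1: "B (u + w) y = B u y + B w y" for u w y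
  proof -
    \<comment> \<open>The identity \<open>half\<close> at half sum and half difference, compared
      with the same identity at two equal vectors, is additivity.\<close>
    let ?a = "(1/2) *\<^sub>R (u + w)" and ?b = "(1/2) *\<^sub>R (u - w)"
    have e: "?a + ?b = u" "?a - ?b = w" "?a + ?a = u + w"
      by (simp_all only: scaleR_add_right[symmetric] scaleR_diff_right[symmetric])
         (simp_all flip: scaleR_2)
    show ?thesis using half[of ?a ?b y] half[of ?a ?a y] B0[of y] by (simp add: e)
  qed
  have Bbd: "\<bar>B x y\<bar> \<le> (K/2) * ((norm x)\<^sup>2 + (norm y)\<^sup>2)" for x y
  proof -
    have "\<bar>Q (x + y) - Q (x - y)\<bar> \<le> K * ((norm (x + y))\<^sup>2 + (norm (x - y))\<^sup>2)"
      using bd[of "x + y"] bd[of "x - y"] by (simp add: algebra_simps)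
    then show ?thesis unfolding B_def parallelogram_law by (simp add: algebra_simps)
  qed
  have scale1: "B (r *\<^sub>R x) y = r * B x y" for r x y
    by (rule additive_bounded_scaleR[where f = "\<lambda>x. B x y", OF add1 Bbd])
  have add2: "B y (u + w) = B y u + B y w" for u w y
    by (simp only: Bs[of y] add1)
  have scale2: "B y (r *\<^sub>R x) = r * B y x" for r x y
    by (simp only: Bs[of y] scale1)
  have "bounded_bilinear B"
  proof
    show "B (a + a') b = B a b + B a' b" "B a (b + b') = B a b + B a b'" for a a' b b'
      by (simp_all add: add1 add2)
    show "B (r *\<^sub>R a) b = r *\<^sub>R B a b" "B a (r *\<^sub>R b) = r *\<^sub>R B a b" for r a b
      by (simp_all add: scale1 scale2)
    have "norm (B a b) \<le> norm a * norm b * K" for a b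
    proof (cases "a = 0 \<or> b = 0")
      case True
      then show ?thesis
      proof
        assume "b = 0" then show ?thesis using B0[of a] Bs[of a b] by simp
      qed (simp add: B0)
    next
      case False
      \<comment> \<open>At unit vectors the bound by a sum of squares becomes a constant, and
        homogeneity turns it into a product bound.\<close>
      have "B a b = norm a * norm b * B (a /\<^sub>R norm a) (b /\<^sub>R norm b)"
        using False by (simp add: scale1 scale2 inverse_eq_divide)
      moreover have "\<bar>B (a /\<^sub>R norm a) (b /\<^sub>R norm b)\<bar> \<le> K"
        using Bbd[of "a /\<^sub>R norm a" "b /\<^sub>R norm b"] False by simp
      ultimately show ?thesis by (simp only: abs_mult real_norm_def abs_norm_cancel) (intro mult_left_mono; simp)
    qed
    then show "\<exists>K. \<forall>a b. norm (B a b) \<le> norm a * norm b * K" by blast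
  qed
  obtain T where T: "\<And>x y. B x y = blinfun_apply T x \<bullet> y"
    using bounded_bilinear_form_represented[OF \<open>bounded_bilinear B\<close>] by blast
  show thesis
  proof (rule that[of T])
    show "T x \<bullet> y = x \<bullet> T y" for x y using T[of x y] T[of y x] Bs[of x y] by (simp add: inner_commute)
    show "x \<bullet> T x = Q x" for x using T[of x x] Q2[of x] Q0 by (simp add: B_def inner_commute)
  qed
qed

section \<open>Positive square roots and spectral subspaces\<close>

text \<open>Invariance of \<open>S\<close> under \<open>T'\<close> means that \<open>T\<close>
  preserves the orthogonal complement, so \<open>T\<close> respects the decomposition.\<close>

lemma orth_proj_commute:
  fixes T T' :: "'a::{real_inner,complete_space} \<Rightarrow>\<^sub>L 'a"
  assumes S: "closed S" "subspace S"
    and adj: "\<And>x y. T x \<bullet> y = x \<bullet> T' y"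
    and inv: "\<And>x. x \<in> S \<Longrightarrow> blinfun_apply T x \<in> S" "\<And>x. x \<in> S \<Longrightarrow> blinfun_apply T' x \<in> S"
  shows "orth_proj S (T x) = T (orth_proj S x)"
proof (rule orth_proj_eqI[OF S])
  show "T (orth_proj S x) \<in> S" using inv orth_proj_mem[OF S] by blast
  fix z assume "z \<in> S"
  then have "(x - orth_proj S x) \<bullet> T' z = 0" using inv orth_proj_orth[OF S] by blast
  then show "(T x - T (orth_proj S x)) \<bullet> z = 0" by (simp add: adj flip: blinfun.diff_right)
qed

lemma blinfun_eq_iff: "A = B \<longleftrightarrow> (\<forall>x. blinfun_apply A x = blinfun_apply B x)"
  by (auto intro: blinfun_eqI)

\<comment> \<open>The instance of completeness for this type needs the sort \<open>banach\<close>, which a variable of sort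
  \<open>{real_inner, complete_space}\<close> does not have.\<close>
lemma Cauchy_blinfun_convergent:
  fixes W :: "nat \<Rightarrow> 'a::real_normed_vector \<Rightarrow>\<^sub>L 'b::{real_normed_vector,complete_space}"
  assumes "Cauchy W"
  obtains V where "W \<longlonglongrightarrow> V"
proof -
  have "Cauchy (\<lambda>n. W n x)" for x
    by (rule bounded_linear.Cauchy[OF blinfun.bounded_linear_left assms])
  then have "\<exists>y. (\<lambda>n. W n x) \<longlonglongrightarrow> y" for x
    using Cauchy_convergent unfolding convergent_def by blast
  then obtain v where v: "\<And>x. (\<lambda>n. W n x) \<longlonglongrightarrow> v x" by metis
  obtain K where K: "\<And>n. norm (W n) \<le> K" using Cauchy_Bseq[OF assms] by (meson BseqE)
  have "bounded_linear v"
  proof (rule bounded_linear_intro[where K = K])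
    show "v (x + y) = v x + v y" for x y
      using LIMSEQ_unique[OF v[of "x + y"]] tendsto_add[OF v[of x] v[of y]] by (simp add: blinfun.add_right)
    show "v (r *\<^sub>R x) = r *\<^sub>R v x" for r x
      using LIMSEQ_unique[OF v[of "r *\<^sub>R x"]] tendsto_scaleR[OF tendsto_const v[of x]] by (simp add: blinfun.scaleR_right)
    have "norm (W n x) \<le> norm x * K" for n x
      using norm_blinfun[of "W n" x] mult_right_mono[OF K[of n], of "norm x"] by (simp add: mult.commute)
    then show "norm (v x) \<le> norm x * K" for x
      using LIMSEQ_le_const2[OF tendsto_norm[OF v[of x]]] by blast
  qed
  then have vV: "blinfun_apply (Blinfun v) = v" by (rule bounded_linear_Blinfun_apply)
  have "W \<longlonglongrightarrow> Blinfun v"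
  proof (rule LIMSEQ_I)
    fix e :: real assume e: "0 < e"
    then obtain N where N: "\<And>m n. m \<ge> N \<Longrightarrow> n \<ge> N \<Longrightarrow> norm (W m - W n) < e / 2"
      using CauchyD[OF assms, of "e / 2"] by auto
    have "norm (W n - Blinfun v) \<le> e / 2" if n: "n \<ge> N" for n
    proof (rule norm_blinfun_bound)
      fix x
      have "norm (W n x - W m x) \<le> e / 2 * norm x" if "m \<ge> N" for m
        using norm_blinfun[of "W n - W m" x] mult_right_mono[OF less_imp_le[OF N[OF n that]], of "norm x"]
        by (simp add: blinfun.diff_left)
      then show "norm ((W n - Blinfun v) x) \<le> e / 2 * norm x"
        unfolding blinfun.diff_left vV
        by (intro LIMSEQ_le_const2[OF tendsto_norm[OF tendsto_diff[OF tendsto_const v]]]) blast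
    qed (use e in simp)
    then show "\<exists>N. \<forall>n\<ge>N. norm (W n - Blinfun v) < e" using e by (intro exI[of _ N]) (smt (verit) field_sum_of_halves)
  qed
  then show thesis by (rule that)
qed

section \<open>Symmetric and positive operators, square roots\<close>

definition sym_op :: "('a::real_inner \<Rightarrow>\<^sub>L 'a) \<Rightarrow> bool" where
  "sym_op A \<longleftrightarrow> (\<forall>x y. A x \<bullet> y = x \<bullet> A y)"

text \<open>Symmetry is part of the definition because on a real space it does not follow from a
  nonnegative form. For complex-linear operators it does, which is the content of
  \<open>positive_op_iff\<close>.\<close>

definition psd :: "('a::real_inner \<Rightarrow>\<^sub>L 'a) \<Rightarrow> bool" where
  "psd A \<longleftrightarrow> sym_op A \<and> (\<forall>x. 0 \<le> x \<bullet> A x)"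

lemma sym_opD: fixes A :: "'a::real_inner \<Rightarrow>\<^sub>L 'a" shows "sym_op A \<Longrightarrow> A x \<bullet> y = x \<bullet> A y"
  by (simp add: sym_op_def)

lemma psd_sym: "psd A \<Longrightarrow> sym_op A"
  and psd_nonneg: "psd A \<Longrightarrow> 0 \<le> x \<bullet> A x"
  by (simp_all add: psd_def)

lemma sym_op_arith:
  assumes "sym_op A" "sym_op B"
  shows "sym_op (A + B)" "sym_op (A - B)"
  using assms by (simp_all add: sym_op_def blinfun.bilinear_simps inner_simps)

lemma sym_op_scaleR: "sym_op A \<Longrightarrow> sym_op (r *\<^sub>R A)"
  by (simp add: sym_op_def blinfun.bilinear_simps)

lemma sym_op_id [simp]: "sym_op id_blinfun" and sym_op_0 [simp]: "sym_op 0"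
  by (simp_all add: sym_op_def)

lemma sym_op_compose_commute: "sym_op A \<Longrightarrow> sym_op B \<Longrightarrow> A o\<^sub>L B = B o\<^sub>L A \<Longrightarrow> sym_op (A o\<^sub>L B)"
  unfolding sym_op_def by (metis blinfun_apply_blinfun_compose)

lemma sym_op_square_psd: "sym_op A \<Longrightarrow> psd (A o\<^sub>L A)"
  by (simp add: psd_def sym_op_def) (metis inner_ge_zero)

text \<open>By polarization and the parallelogram law the bound on the form passes to
  \<open>x \<bullet> A y\<close> for unit vectors, and then \<open>x\<close> may be taken in the
  direction of \<open>A y\<close>.\<close>

lemma sym_op_norm_le:
  assumes A: "sym_op A" and c: "0 \<le> c" and bd: "\<And>x. \<bar>x \<bullet> blinfun_apply A x\<bar> \<le> c * (norm x)\<^sup>2"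
  shows "norm A \<le> c"
proof (rule norm_blinfun_bound[OF c])
  fix x
  have unit: "\<bar>x \<bullet> A y\<bar> \<le> c" if "norm x = 1" "norm y = 1" for x y
  proof -
    have "4 * (x \<bullet> A y) = (x + y) \<bullet> A (x + y) - (x - y) \<bullet> A (x - y)"
      using sym_opD[OF A, of x y] by (simp add: blinfun.bilinear_simps inner_simps inner_commute)
    then have "\<bar>4 * (x \<bullet> A y)\<bar> \<le> c * ((norm (x + y))\<^sup>2 + (norm (x - y))\<^sup>2)"
      using bd[of "x + y"] bd[of "x - y"] by (simp add: algebra_simps)
    then show ?thesis unfolding parallelogram_law using that by simp
  qed
  show "norm (A x) \<le> c * norm x"
  proof (cases "x = 0 \<or> A x = 0")
    case False
    let ?u = "A x /\<^sub>R norm (A x)" and ?v = "x /\<^sub>R norm x"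
    have "\<bar>?u \<bullet> A ?v\<bar> \<le> c" using False by (intro unit) auto
    moreover have "?u \<bullet> A ?v = norm (A x) / norm x"
      using False by (simp add: blinfun.scaleR_right dot_square_norm power2_eq_square inverse_eq_divide)
    ultimately have "norm (A x) / norm x \<le> c" by simp
    then show ?thesis using False by (simp add: field_simps)
  qed (use c in auto)
qed

text \<open>The approximants are polynomials in \<open>A\<close>, hence the commutation clause. That
  clause later makes roots complex-linear and places them in the algebra.\<close>

lemma psd_sqrt_exists_contraction:
  fixes A :: "'a::{real_inner,complete_space} \<Rightarrow>\<^sub>L 'a"
  assumes A: "psd A" "\<And>x. x \<bullet> A x \<le> (norm x)\<^sup>2"
  shows "\<exists>B. psd B \<and> B o\<^sub>L B = A \<and> (\<forall>T. T o\<^sub>L A = A o\<^sub>L T \<longrightarrow> T o\<^sub>L B = B o\<^sub>L T)"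
proof -
  define R where "R = id_blinfun - A"
  have Rs: "sym_op R" using A(1) unfolding R_def psd_def by (intro sym_op_arith) auto
  have nR: "norm R \<le> 1"
    using psd_nonneg[OF A(1)] A(2)
    by (intro sym_op_norm_le[OF Rs]) (auto simp: R_def blinfun.bilinear_simps inner_simps dot_square_norm)
  \<comment> \<open>If \<open>W\<close> solves \<open>W = (R + W\<^sup>2) / 2\<close>, then \<open>(1 - W)\<^sup>2 = 1 - R = A\<close>. The scalar iteration for
      \<open>R = 1\<close> dominates the increments of the operator iteration.\<close>
  define W where "W = rec_nat (0::'a \<Rightarrow>\<^sub>L 'a) (\<lambda>_ V. (1/2) *\<^sub>R (R + (V o\<^sub>L V)))"
  define w where "w = rec_nat (0::real) (\<lambda>_ v. (1/2) * (1 + v * v))"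
  have W0: "W 0 = 0" and WS: "W (Suc n) = (1/2) *\<^sub>R (R + (W n o\<^sub>L W n))" for n by (simp_all add: W_def)
  have w0: "w 0 = 0" and wS: "w (Suc n) = (1/2) * (1 + w n * w n)" for n by (simp_all add: w_def)
  have w01: "0 \<le> w n \<and> w n \<le> 1" for n
  proof (induction n)
    case (Suc n)
    then have "w n * w n \<le> 1" by (simp add: mult_le_one)
    then show ?case by (simp add: wS)
  qed (simp add: w0)
  have w_inc: "w n \<le> w (Suc n)" for n
  proof -
    have "0 \<le> (1 - w n) * (1 - w n)" by (rule zero_le_square)
    then show ?thesis by (simp add: wS algebra_simps)
  qed
  then have "incseq w" by (rule incseq_SucI)
  then have "convergent w" using w01 by (meson incseq_convergent convergent_def)
  then have Cw: "Cauchy w" using Cauchy_convergent_iff by blast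
  have Ws: "sym_op (W n)" for n
    by (induction n) (auto simp: W0 WS intro!: sym_op_arith sym_op_scaleR Rs sym_op_compose_commute)
  have comm: "T o\<^sub>L W n = W n o\<^sub>L T" if T: "T o\<^sub>L A = A o\<^sub>L T" for T n
  proof (induction n)
    case (Suc n)
    have T': "T (A x) = A (T x)" for x using T by (metis blinfun_apply_blinfun_compose)
    have S: "T (W n x) = W n (T x)" for x using Suc by (metis blinfun_apply_blinfun_compose)
    show ?case by (rule blinfun_eqI) (simp add: WS R_def blinfun.bilinear_simps S T')
  qed (simp add: W0)
  have commA: "A o\<^sub>L W n = W n o\<^sub>L A" for n by (rule comm) simp
  have commW: "W m o\<^sub>L W n = W n o\<^sub>L W m" for n m by (rule comm) (simp add: commA)
  have nW: "norm (W n) \<le> w n" for n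
  proof (induction n)
    case (Suc n)
    have "norm (W (Suc n)) \<le> (1/2) * (norm R + norm (W n o\<^sub>L W n))"
      by (simp add: WS norm_triangle_ineq)
    also have "norm (W n o\<^sub>L W n) \<le> w n * w n"
      using norm_blinfun_compose[of "W n" "W n"] Suc w01[of n] by (meson mult_mono norm_ge_zero order_trans)
    finally show ?case using nR by (simp add: wS)
  qed (simp add: W0 w0)
  have step: "norm (W (Suc n) - W n) \<le> w (Suc n) - w n" for n
  proof (induction n)
    case 0 show ?case using nR by (simp add: W0 WS w0 wS)
  next
    case (Suc n)
    \<comment> \<open>A difference of squares factors because the approximants commute with each
      other.\<close>
    have "W (Suc (Suc n)) - W (Suc n) = (1/2) *\<^sub>R ((W (Suc n) + W n) o\<^sub>L (W (Suc n) - W n))"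
    proof (rule blinfun_eqI)
      fix x
      have "W (Suc n) (W n x) = W n (W (Suc n) x)" using commW by (metis blinfun_apply_blinfun_compose)
      then show "(W (Suc (Suc n)) - W (Suc n)) x = ((1/2) *\<^sub>R ((W (Suc n) + W n) o\<^sub>L (W (Suc n) - W n))) x"
        by (subst WS, subst (2) WS) (simp add: blinfun.bilinear_simps algebra_simps)
    qed
    then have "norm (W (Suc (Suc n)) - W (Suc n)) \<le> (1/2) * (norm (W (Suc n) + W n) * norm (W (Suc n) - W n))"
      using norm_blinfun_compose[of "W (Suc n) + W n" "W (Suc n) - W n"] by simp
    also have "norm (W (Suc n) + W n) * norm (W (Suc n) - W n) \<le> (w (Suc n) + w n) * (w (Suc n) - w n)"
      using norm_triangle_ineq[of "W (Suc n)" "W n"] nW[of n] nW[of "Suc n"] w01[of n] w01[of "Suc n"]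
      by (intro mult_mono Suc) auto
    also have "(1/2) * ((w (Suc n) + w n) * (w (Suc n) - w n)) = w (Suc (Suc n)) - w (Suc n)"
      by (subst wS, subst (2) wS) (simp add: algebra_simps)
    finally show ?case by simp
  qed
  have steps: "norm (W (m + k) - W m) \<le> w (m + k) - w m" for m k
  proof (induction k)
    case (Suc k)
    have "norm (W (m + Suc k) - W m) \<le> norm (W (Suc (m + k)) - W (m + k)) + norm (W (m + k) - W m)"
      using norm_triangle_ineq[of "W (Suc (m + k)) - W (m + k)" "W (m + k) - W m"] by simp
    then show ?case using step[of "m + k"] Suc by simp
  qed simp
  have "Cauchy W"
  proof (rule CauchyI')
    fix e :: real assume "0 < e"
    then obtain N where N: "\<And>m n. m \<ge> N \<Longrightarrow> n \<ge> N \<Longrightarrow> dist (w m) (w n) < e"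
      using metric_CauchyD[OF Cw] by blast
    have "dist (W m) (W n) < e" if "m \<ge> N" "n > m" for m n
      using steps[of m "n - m"] N[of m n] that by (simp add: dist_norm norm_minus_commute)
    then show "\<exists>M. \<forall>m\<ge>M. \<forall>n>m. dist (W m) (W n) < e" by blast
  qed
  then obtain V where V: "W \<longlonglongrightarrow> V" using Cauchy_blinfun_convergent by blast
  note tl = bounded_bilinear.tendsto[OF bounded_bilinear_blinfun_compose]
  have "(\<lambda>n. W (Suc n)) \<longlonglongrightarrow> (1/2) *\<^sub>R (R + (V o\<^sub>L V))"
    unfolding WS by (intro tendsto_intros tl V)
  then have Veq: "V = (1/2) *\<^sub>R (R + (V o\<^sub>L V))" by (rule LIMSEQ_unique[OF LIMSEQ_Suc[OF V]])
  have tla: "(\<lambda>n. W n x) \<longlonglongrightarrow> V x" for x by (intro tendsto_intros V)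
  have Vs: "sym_op V" unfolding sym_op_def
  proof (intro allI)
    fix x y
    have "(\<lambda>n. W n x \<bullet> y) \<longlonglongrightarrow> V x \<bullet> y" "(\<lambda>n. x \<bullet> W n y) \<longlonglongrightarrow> x \<bullet> V y" by (intro tendsto_intros tla)+
    then show "V x \<bullet> y = x \<bullet> V y" unfolding sym_opD[OF Ws] by (rule LIMSEQ_unique)
  qed
  have nV: "norm V \<le> 1"
    using LIMSEQ_le_const2[OF tendsto_norm[OF V]] nW w01 by (meson order_trans)
  have commV: "T o\<^sub>L V = V o\<^sub>L T" if T: "T o\<^sub>L A = A o\<^sub>L T" for T
  proof -
    have "(\<lambda>n. T o\<^sub>L W n) \<longlonglongrightarrow> (T o\<^sub>L V)" "(\<lambda>n. W n o\<^sub>L T) \<longlonglongrightarrow> (V o\<^sub>L T)" by (intro tl tendsto_intros V)+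
    then show ?thesis unfolding comm[OF T] by (rule LIMSEQ_unique)
  qed
  let ?B = "id_blinfun - V"
  have "psd ?B" unfolding psd_def
  proof (intro conjI allI)
    show "sym_op ?B" by (intro sym_op_arith Vs sym_op_id)
    fix x
    have "x \<bullet> V x \<le> norm x * norm (V x)" by (rule norm_cauchy_schwarz)
    also have "norm (V x) \<le> 1 * norm x" using norm_blinfun[of V x] nV by (meson mult_right_mono norm_ge_zero order_trans)
    finally have "x \<bullet> V x \<le> x \<bullet> x" by (simp add: mult_left_mono dot_square_norm power2_eq_square)
    then show "0 \<le> x \<bullet> ?B x" by (simp add: blinfun.bilinear_simps inner_simps)
  qed
  moreover have "?B o\<^sub>L ?B = A"
  proof (rule blinfun_eqI)
    fix x
    have "V x = (1/2) *\<^sub>R (R x + V (V x))"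
      using arg_cong[OF Veq, of "\<lambda>T. blinfun_apply T x"] by (simp add: blinfun.bilinear_simps)
    then have "V x + V x = x - A x + V (V x)"
      by (metis R_def blinfun.diff_left id_blinfun.rep_eq scaleR_2 scaleR_half_double scaleR_right_distrib id_apply)
    then show "(?B o\<^sub>L ?B) x = A x" by (simp add: blinfun.bilinear_simps algebra_simps)
  qed
  moreover have "T o\<^sub>L ?B = ?B o\<^sub>L T" if "T o\<^sub>L A = A o\<^sub>L T" for T
    using commV[OF that] by (simp add: blinfun_eq_iff blinfun.bilinear_simps)
  ultimately show ?thesis by blast
qed

lemma psd_sqrt_exists:
  fixes A :: "'a::{real_inner,complete_space} \<Rightarrow>\<^sub>L 'a"
  assumes A: "psd A"
  obtains B where "psd B" "B o\<^sub>L B = A" "\<And>T. T o\<^sub>L A = A o\<^sub>L T \<Longrightarrow> T o\<^sub>L B = B o\<^sub>L T"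
proof (cases "A = 0")
  case True
  show ?thesis by (rule that[of 0]) (simp_all add: True psd_def)
next
  case False
  define c where "c = norm A"
  have c: "c > 0" using False by (simp add: c_def)
  define A1 where "A1 = (1/c) *\<^sub>R A"
  have "psd A1" using A c by (simp add: A1_def psd_def sym_op_def blinfun.bilinear_simps)
  moreover have "x \<bullet> A1 x \<le> (norm x)\<^sup>2" for x
  proof -
    have "x \<bullet> A x \<le> norm x * norm (A x)" by (rule norm_cauchy_schwarz)
    also have "\<dots> \<le> norm x * (c * norm x)" using norm_blinfun[of A x] by (simp add: c_def mult_left_mono)
    finally show ?thesis using c by (simp add: A1_def blinfun.bilinear_simps field_simps power2_eq_square)
  qed
  ultimately obtain B where B: "psd B" "B o\<^sub>L B = A1" "\<And>T. T o\<^sub>L A1 = A1 o\<^sub>L T \<Longrightarrow> T o\<^sub>L B = B o\<^sub>L T"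
    using psd_sqrt_exists_contraction[of A1] by blast
  have A: "A = c *\<^sub>R A1" using c by (simp add: A1_def)
  show ?thesis
  proof (rule that[of "sqrt c *\<^sub>R B"])
    show "psd (sqrt c *\<^sub>R B)" using B(1) c by (simp add: psd_def sym_op_def blinfun.bilinear_simps)
    have "(sqrt c *\<^sub>R B) o\<^sub>L (sqrt c *\<^sub>R B) = c *\<^sub>R (B o\<^sub>L B)"
      using c by (intro blinfun_eqI) (simp add: blinfun.bilinear_simps)
    then show "(sqrt c *\<^sub>R B) o\<^sub>L (sqrt c *\<^sub>R B) = A" unfolding A B(2) .
    fix T assume "T o\<^sub>L A = A o\<^sub>L T"
    then have "T o\<^sub>L A1 = A1 o\<^sub>L T" using c by (simp add: A1_def blinfun_eq_iff blinfun.bilinear_simps)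
    from B(3)[OF this] show "T o\<^sub>L (sqrt c *\<^sub>R B) = (sqrt c *\<^sub>R B) o\<^sub>L T"
      by (simp add: blinfun_eq_iff blinfun.bilinear_simps)
  qed
qed

lemma psd_inner_eq_0:
  fixes A :: "'a::{real_inner,complete_space} \<Rightarrow>\<^sub>L 'a"
  assumes "psd A" "x \<bullet> A x = 0"
  shows "A x = 0"
proof -
  obtain B where B: "psd B" "B o\<^sub>L B = A" using psd_sqrt_exists[OF assms(1)] by metis
  have "B x \<bullet> B x = x \<bullet> A x" using psd_sym[OF B(1)] B(2) by (auto simp: sym_op_def)
  then have "B x = 0" using assms(2) by simp
  then show ?thesis using B(2) by auto
qed

text \<open>Every root commutes with its square and therefore with the constructed root
  \<open>D\<close>, so that (B' + D)(B' - D) = 0. Both forms are nonnegative, so both vanish at the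
  vector (B' - D)x.\<close>

lemma psd_sqrt_unique:
  fixes B C :: "'a::{real_inner,complete_space} \<Rightarrow>\<^sub>L 'a"
  assumes B: "psd B" and C: "psd C" and eq: "B o\<^sub>L B = C o\<^sub>L C"
  shows "B = C"
proof -
  obtain D where D: "psd D" "D o\<^sub>L D = B o\<^sub>L B"
    "\<And>T. T o\<^sub>L (B o\<^sub>L B) = (B o\<^sub>L B) o\<^sub>L T \<Longrightarrow> T o\<^sub>L D = D o\<^sub>L T"
    using psd_sqrt_exists[OF sym_op_square_psd[OF psd_sym[OF B]]] by metis
  have "B' = D" if B': "psd B'" "B' o\<^sub>L B' = B o\<^sub>L B" for B'
  proof (rule blinfun_eqI)
    fix x
    have "B' o\<^sub>L D = D o\<^sub>L B'" by (rule D(3)) (simp add: that(2)[symmetric] blinfun_eq_iff)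
    then have com: "B' (D x) = D (B' x)" for x by (metis blinfun_apply_blinfun_compose)
    have sq: "B' (B' x) = D (D x)" for x using D(2) that(2) by (metis blinfun_apply_blinfun_compose)
    let ?y = "B' x - D x"
    have "B' ?y + D ?y = 0" by (simp add: blinfun.bilinear_simps com sq)
    then have "?y \<bullet> B' ?y + ?y \<bullet> D ?y = 0" by (metis inner_add_right inner_zero_right)
    then have "?y \<bullet> B' ?y = 0" "?y \<bullet> D ?y = 0"
      using psd_nonneg[OF B'(1), of ?y] psd_nonneg[OF D(1), of ?y] by auto
    then have z: "B' ?y = 0" "D ?y = 0" using psd_inner_eq_0 B'(1) D(1) by blast+
    have "?y \<bullet> ?y = x \<bullet> (B' ?y - D ?y)"
      unfolding inner_diff_right[of x] inner_diff_left[of "B' x"]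
        sym_opD[OF psd_sym[OF B'(1)]] sym_opD[OF psd_sym[OF D(1)]] ..
    then show "B' x = D x" using z by simp
  qed
  then show ?thesis using B C eq by metis
qed

section \<open>Spectral subspaces through the growth of iterates\<close>

text \<open>The constant may depend on the vector, which makes linearity and invariance immediate
  and leaves closedness to be proved. For \<open>l = 0\<close> the convention
  \<open>0 ^ 0 = 1\<close> yields the kernel of \<open>A\<close>.\<close>

definition spec_space :: "('a::real_normed_vector \<Rightarrow>\<^sub>L 'a) \<Rightarrow> real \<Rightarrow> 'a set" where
  "spec_space A l = {x. \<exists>C. \<forall>n. norm ((blinfun_apply A ^^ n) x) \<le> C * l ^ n}"

lemma spec_space_apply: fixes A :: "'a::real_normed_vector \<Rightarrow>\<^sub>L 'a" shows "x \<in> spec_space A l \<Longrightarrow> A x \<in> spec_space A l"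
proof -
  assume "x \<in> spec_space A l"
  then obtain C where C: "norm ((blinfun_apply A ^^ n) x) \<le> C * l ^ n" for n by (auto simp: spec_space_def)
  have "norm ((blinfun_apply A ^^ n) (A x)) \<le> (C * l) * l ^ n" for n
    using C[of "Suc n"] by (simp add: funpow_swap1 mult_ac)
  then show ?thesis by (auto simp: spec_space_def)
qed

text \<open>Turns commutation with \<open>A\<close> into invariance: the commutant of an algebra
  containing \<open>A\<close> preserves the subspace, which is what puts its projection into the
  algebra.\<close>

lemma spec_space_commute:
  fixes A T :: "'a::real_normed_vector \<Rightarrow>\<^sub>L 'a"
  assumes T: "T o\<^sub>L A = A o\<^sub>L T" and x: "x \<in> spec_space A l"
  shows "T x \<in> spec_space A l"
proof -
  obtain C where C: "norm ((blinfun_apply A ^^ n) x) \<le> C * l ^ n" for n using x by (auto simp: spec_space_def)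
  have "(blinfun_apply A ^^ n) (T x) = T ((blinfun_apply A ^^ n) x)" for n
    by (induction n) (simp_all, metis T blinfun_apply_blinfun_compose)
  then have "norm ((blinfun_apply A ^^ n) (T x)) \<le> (norm T * C) * l ^ n" for n
    using norm_blinfun[of T "(blinfun_apply A ^^ n) x"] mult_left_mono[OF C[of n], of "norm T"] by (simp add: mult.assoc)
  then show ?thesis by (auto simp: spec_space_def)
qed

lemma funpow_blinfun_linear:
  fixes A :: "'a::real_normed_vector \<Rightarrow>\<^sub>L 'a"
  shows "bounded_linear (blinfun_apply A ^^ n)"
proof (induction n)
  case 0 then show ?case by (simp add: id_def bounded_linear_ident)
next
  case (Suc n)
  then show ?case using bounded_linear_compose[OF blinfun.bounded_linear_right[of A]] by (simp add: o_def)
qed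

lemma subspace_spec_space: "subspace (spec_space A l)"
proof (rule subspaceI)
  show "0 \<in> spec_space A l"
    by (auto simp: spec_space_def linear_0[OF bounded_linear.linear[OF funpow_blinfun_linear]] intro!: exI[of _ 0])
  fix x assume "x \<in> spec_space A l"
  then obtain C where C: "norm ((blinfun_apply A ^^ n) x) \<le> C * l ^ n" for n by (auto simp: spec_space_def)
  { fix y assume "y \<in> spec_space A l"
    then obtain D where D: "norm ((blinfun_apply A ^^ n) y) \<le> D * l ^ n" for n by (auto simp: spec_space_def)
    have "norm ((blinfun_apply A ^^ n) (x + y)) \<le> (C + D) * l ^ n" for n
      unfolding linear_add[OF bounded_linear.linear[OF funpow_blinfun_linear]]
      using norm_triangle_le[OF add_mono[OF C[of n] D[of n]]] by (simp add: algebra_simps)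
    then show "x + y \<in> spec_space A l" by (auto simp: spec_space_def) }
  fix r :: real
  have "norm ((blinfun_apply A ^^ n) (r *\<^sub>R x)) \<le> (\<bar>r\<bar> * C) * l ^ n" for n
    using mult_left_mono[OF C[of n], of "\<bar>r\<bar>"]
    by (simp add: linear_scale[OF bounded_linear.linear[OF funpow_blinfun_linear]] mult.assoc)
  then show "r *\<^sub>R x \<in> spec_space A l" by (auto simp: spec_space_def)
qed

lemma sym_op_norm_square_le:
  fixes A :: "'a::real_inner \<Rightarrow>\<^sub>L 'a"
  assumes "sym_op A"
  shows "(norm (A x))\<^sup>2 \<le> norm x * norm (A (A x))"
  using norm_cauchy_schwarz[of x "A (A x)"] sym_opD[OF assms, of x "A x"] by (simp add: dot_square_norm)

text \<open>The norms of the iterates are log-convex, so their first ratio is a lower bound for their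
  growth rate.\<close>
lemma spec_space_norm_le:
  fixes A :: "'a::real_inner \<Rightarrow>\<^sub>L 'a"
  assumes A: "sym_op A" and l: "0 \<le> l" and x: "x \<in> spec_space A l"
  shows "norm (A x) \<le> l * norm x"
proof (rule ccontr)
  define a where "a n = norm ((blinfun_apply A ^^ n) x)" for n
  obtain C where C: "a n \<le> C * l ^ n" for n using x by (auto simp: spec_space_def a_def)
  assume "\<not> norm (A x) \<le> l * norm x"
  then have a1: "a 1 > l * a 0" by (simp add: a_def)
  have "x \<noteq> 0" using a1 by (auto simp: a_def)
  then have a0: "a 0 > 0" by (simp add: a_def)
  define q where "q = a 1 / a 0"
  have q: "q > l" using a1 a0 by (simp add: q_def field_simps)
  have grow: "a n > 0 \<and> a (Suc n) \<ge> q * a n" for n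
  proof (induction n)
    case (Suc n)
    have p: "a (Suc n) > 0" using Suc q l by (smt (verit) mult_pos_pos)
    have "(a (Suc n))\<^sup>2 \<le> a n * a (Suc (Suc n))"
      using sym_op_norm_square_le[OF A, of "(blinfun_apply A ^^ n) x"] by (simp add: a_def)
    moreover have "q * a n * a (Suc n) \<le> (a (Suc n))\<^sup>2"
      using Suc p by (simp add: power2_eq_square mult_right_mono)
    ultimately have "a n * (q * a (Suc n)) \<le> a n * a (Suc (Suc n))" by (simp add: mult_ac)
    then show ?case using p Suc by simp
  qed (simp add: a0, use a0 in \<open>simp add: q_def\<close>)
  have gp: "a n \<ge> q ^ n * a 0" for n
  proof (induction n)
    case (Suc n)
    have "q * (q ^ n * a 0) \<le> q * a n" using Suc q l by (intro mult_left_mono) auto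
    then show ?case using grow[of n] by (simp add: mult.assoc)
  qed simp
  show False
  proof (cases "l = 0")
    case True
    then show False using C[of 1] grow[of 1] by simp
  next
    case False
    then have l0: "l > 0" using l by simp
    then have "1 < q / l" using q by simp
    then obtain n where n: "(q / l) ^ n > C / a 0" using real_arch_pow by blast
    have "C * l ^ n < q ^ n * a 0" using n a0 l0 by (simp add: power_divide field_simps)
    then show False using gp[of n] C[of n] by simp
  qed
qed

lemma invariant_subset_spec_space:
  fixes A :: "'a::real_normed_vector \<Rightarrow>\<^sub>L 'a"
  assumes "x \<in> K" "\<And>x. x \<in> K \<Longrightarrow> blinfun_apply A x \<in> K"
    and "\<And>x. x \<in> K \<Longrightarrow> norm (A x) \<le> l * norm x" and l: "0 \<le> l"
  shows "x \<in> spec_space A l"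
proof -
  have "(blinfun_apply A ^^ n) x \<in> K \<and> norm ((blinfun_apply A ^^ n) x) \<le> norm x * l ^ n" for n
  proof (induction n)
    case (Suc n)
    then have "norm (A ((blinfun_apply A ^^ n) x)) \<le> l * (norm x * l ^ n)"
      using assms(3) l by (meson mult_left_mono order_trans)
    then show ?case using Suc assms(2) by (simp add: mult_ac)
  qed (simp add: assms(1))
  then show ?thesis by (auto simp: spec_space_def)
qed

text \<open>Symmetry allows the individual constants to be replaced by \<open>norm x\<close>, and
  the subspace becomes an intersection of closed conditions.\<close>

lemma closed_spec_space:
  fixes A :: "'a::real_inner \<Rightarrow>\<^sub>L 'a"
  assumes A: "sym_op A" and l: "0 \<le> l"
  shows "closed (spec_space A l)"
proof -
  have "spec_space A l = (\<Inter>n. {x. norm ((blinfun_apply A ^^ n) x) \<le> l ^ n * norm x})" (is "_ = ?R")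
  proof (intro equalityI subsetI)
    fix x assume x: "x \<in> spec_space A l"
    have "(blinfun_apply A ^^ n) x \<in> spec_space A l \<and> norm ((blinfun_apply A ^^ n) x) \<le> l ^ n * norm x" for n
    proof (induction n)
      case (Suc n)
      then have "norm (A ((blinfun_apply A ^^ n) x)) \<le> l * norm ((blinfun_apply A ^^ n) x)"
        using spec_space_norm_le[OF A l] by blast
      also have "\<dots> \<le> l * (l ^ n * norm x)" using Suc l by (intro mult_left_mono) auto
      finally show ?case using Suc spec_space_apply[of "(blinfun_apply A ^^ n) x" A l] by (simp add: mult_ac)
    qed (simp add: x)
    then show "x \<in> ?R" by blast
  next
    fix x assume "x \<in> ?R"
    then show "x \<in> spec_space A l" by (auto simp: spec_space_def mult.commute intro!: exI[of _ "norm x"])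
  qed
  moreover have "closed {x. norm ((blinfun_apply A ^^ n) x) \<le> l ^ n * norm x}" for n
    by (intro closed_Collect_le continuous_intros linear_continuous_on funpow_blinfun_linear)
  ultimately show ?thesis by (auto intro: closed_INT)
qed

text \<open>A bound on the form is weaker than a bound on the norm for a single vector. On an
  invariant subspace the compression \<open>C\<close> is symmetric, so its norm is controlled by its
  form, and \<open>C\<close> agrees with \<open>A\<close> there.\<close>

lemma form_bounded_subset_spec_space:
  fixes A :: "'a::{real_inner,complete_space} \<Rightarrow>\<^sub>L 'a"
  assumes A: "psd A" and l: "0 \<le> l" and K: "closed K" "subspace K"
    and inv: "\<And>x. x \<in> K \<Longrightarrow> A x \<in> K" and bd: "\<And>x. x \<in> K \<Longrightarrow> x \<bullet> A x \<le> l * (x \<bullet> x)"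
  shows "K \<subseteq> spec_space A l"
proof
  let ?P = "orth_proj K"
  define C where "C = ?P o\<^sub>L A o\<^sub>L ?P"
  have Cs: "sym_op C" unfolding C_def sym_op_def
    using sym_opD[OF psd_sym[OF A]] by (simp add: orth_proj_sym[OF K])
  have CK: "C x = A x" if "x \<in> K" for x
    using that inv[OF that] orth_proj_fixed_iff[OF K, of x] orth_proj_fixed_iff[OF K, of "A x"] by (simp add: C_def)
  have "norm C \<le> l"
  proof (rule sym_op_norm_le[OF Cs l])
    fix x
    have "x \<bullet> C x = ?P x \<bullet> A (?P x)" by (simp add: C_def flip: orth_proj_sym[OF K])
    moreover have "?P x \<bullet> A (?P x) \<le> l * (?P x \<bullet> ?P x)" by (intro bd orth_proj_mem K)
    moreover have "?P x \<bullet> ?P x \<le> x \<bullet> x"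
    proof -
      have "x \<bullet> x = ?P x \<bullet> ?P x + (x - ?P x) \<bullet> (x - ?P x)"
        using orth_proj_orth[OF K orth_proj_mem[OF K], of x x] by (simp add: inner_simps inner_commute)
      then show ?thesis by simp
    qed
    ultimately show "\<bar>x \<bullet> C x\<bar> \<le> l * (norm x)\<^sup>2"
      using psd_nonneg[OF A, of "?P x"] l by (smt (verit) mult_left_mono dot_square_norm)
  qed
  then have nb: "norm (A x) \<le> l * norm x" if "x \<in> K" for x
    using norm_blinfun[of C x] CK[OF that] by (metis mult_right_mono norm_ge_zero order_trans)
  fix x assume "x \<in> K"
  then show "x \<in> spec_space A l" by (rule invariant_subset_spec_space[OF _ inv nb l])
qed

text \<open>With \<open>B = A - l\<close> and \<open>D = \<bar>B\<bar>\<close>, the kernel of the positive part \<open>D + B\<close> lies in the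
  spectral subspace, and \<open>B = D\<close> on its complement.\<close>
lemma spec_space_complement:
  fixes A :: "'a::{real_inner,complete_space} \<Rightarrow>\<^sub>L 'a"
  assumes A: "psd A" and l: "0 \<le> l" and orth: "\<And>z. z \<in> spec_space A l \<Longrightarrow> x \<bullet> z = 0" and x: "x \<noteq> 0"
  shows "l * (x \<bullet> x) < x \<bullet> A x"
proof -
  define B where "B = A - l *\<^sub>R id_blinfun"
  have Bs: "sym_op B" unfolding B_def by (intro sym_op_arith sym_op_scaleR psd_sym[OF A] sym_op_id)
  obtain D where D: "psd D" "D o\<^sub>L D = B o\<^sub>L B"
    "\<And>T. T o\<^sub>L (B o\<^sub>L B) = (B o\<^sub>L B) o\<^sub>L T \<Longrightarrow> T o\<^sub>L D = D o\<^sub>L T"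
    using psd_sqrt_exists[OF sym_op_square_psd[OF Bs]] by metis
  have "B o\<^sub>L D = D o\<^sub>L B" by (rule D(3)) (simp add: blinfun_eq_iff)
  then have com: "B (D x) = D (B x)" for x by (metis blinfun_apply_blinfun_compose)
  have sq: "B (B x) = D (D x)" for x using D(2) by (metis blinfun_apply_blinfun_compose)
  define K where "K = {x. D x = - B x}"
  have AB: "A x = B x + l *\<^sub>R x" for x by (simp add: B_def blinfun.bilinear_simps)
  have K: "closed K" "subspace K" unfolding K_def
    by (auto intro!: closed_Collect_eq linear_continuous_on bounded_linear_minus blinfun.bounded_linear_right
        simp: subspace_def blinfun.bilinear_simps)
  have "K \<subseteq> spec_space A l"
  proof (rule form_bounded_subset_spec_space[OF A l K])
    show "A x \<in> K" if "x \<in> K" for x using that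
      by (simp add: K_def AB blinfun.bilinear_simps flip: com)
    show "x \<bullet> A x \<le> l * (x \<bullet> x)" if "x \<in> K" for x
    proof -
      have "B x = - D x" using that by (simp add: K_def)
      then show ?thesis using psd_nonneg[OF D(1), of x] by (simp add: AB inner_add_right inner_diff_right)
    qed
  qed
  then have xK: "x \<bullet> z = 0" if "z \<in> K" for z using orth that by blast
  \<comment> \<open>Since \<open>B\<close> and \<open>D\<close> commute and have equal squares, (D +
    B)(D - B) = 0.\<close>
  have "D u - B u \<in> K" for u by (simp add: K_def blinfun.bilinear_simps com sq)
  then have "x \<bullet> (D u - B u) = 0" for u using xK by blast
  then have "(D x - B x) \<bullet> u = 0" for u
    using sym_opD[OF Bs] sym_opD[OF psd_sym[OF D(1)]] by (simp add: inner_diff_left inner_diff_right)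
  then have DB: "D x = B x" by (metis inner_eq_zero_iff right_minus_eq)
  have "x \<bullet> D x \<noteq> 0"
  proof
    assume "x \<bullet> D x = 0"
    then have "D x = 0" by (rule psd_inner_eq_0[OF D(1)])
    then have "x \<in> K" using DB by (simp add: K_def)
    then show False using xK x by fastforce
  qed
  then show ?thesis using psd_nonneg[OF D(1), of x] by (simp add: DB AB inner_add_right)
qed

text \<open>Identifies the spectral subspace with the range of any commuting projection that
  separates the form at level \<open>l\<close>. It applies to the values of arbitrary spectral
  measures and to complements of projections. The strict inequality excludes a nonzero vector of the
  subspace in the kernel of \<open>P\<close>.\<close>

lemma spec_space_eq_range:
  fixes A :: "'a::{real_inner,complete_space} \<Rightarrow>\<^sub>L 'a"
  assumes A: "psd A" and l: "0 \<le> l" and P: "sym_op P" "P o\<^sub>L P = P" "P o\<^sub>L A = A o\<^sub>L P"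
    and le: "\<And>x. P x = x \<Longrightarrow> x \<bullet> A x \<le> l * (x \<bullet> x)"
    and gt: "\<And>x. P x = 0 \<Longrightarrow> x \<noteq> 0 \<Longrightarrow> l * (x \<bullet> x) < x \<bullet> A x"
  shows "spec_space A l = {x. P x = x}"
proof
  let ?K = "{x. P x = x}"
  have PA: "P (A x) = A (P x)" for x using P(3) by (metis blinfun_apply_blinfun_compose)
  have PP: "P (P x) = P x" for x using P(2) by (metis blinfun_apply_blinfun_compose)
  show sub: "?K \<subseteq> spec_space A l"
  proof (rule form_bounded_subset_spec_space[OF A l])
    show "closed ?K" by (intro closed_Collect_eq continuous_intros linear_continuous_on blinfun.bounded_linear_right)
    show "subspace ?K" by (simp add: subspace_def blinfun.bilinear_simps)
  qed (use le in \<open>simp_all add: PA\<close>)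
  show "spec_space A l \<subseteq> ?K"
  proof (rule subsetI, rule ccontr)
    fix x assume x: "x \<in> spec_space A l" "x \<notin> ?K"
    let ?z = "x - P x"
    have "?z \<in> spec_space A l" using x(1) sub PP by (intro subspace_diff subspace_spec_space) auto
    then have "norm (A ?z) \<le> l * norm ?z" by (rule spec_space_norm_le[OF psd_sym[OF A] l])
    then have "?z \<bullet> A ?z \<le> l * (?z \<bullet> ?z)"
      using norm_cauchy_schwarz[of ?z "A ?z"] mult_left_mono[of "norm (A ?z)" "l * norm ?z" "norm ?z"]
      by (simp add: dot_square_norm power2_eq_square mult_ac)
    moreover have "P ?z = 0" "?z \<noteq> 0" using x by (auto simp: blinfun.bilinear_simps PP)
    ultimately show False using gt[of ?z] by simp
  qed
qed

lemma orth_proj_range_eq: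
  fixes P :: "'a::{real_inner,complete_space} \<Rightarrow>\<^sub>L 'a"
  assumes P: "sym_op P" "P o\<^sub>L P = P"
  shows "orth_proj {x. P x = x} = P"
proof (rule blinfun_eqI)
  fix x
  have PP: "P (P x) = P x" for x using P(2) by (metis blinfun_apply_blinfun_compose)
  show "orth_proj {x. P x = x} x = P x"
  proof (rule orth_proj_eqI)
    show "closed {x. P x = x}"
      by (intro closed_Collect_eq continuous_intros linear_continuous_on blinfun.bounded_linear_right)
    show "subspace {x. P x = x}" by (simp add: subspace_def blinfun.bilinear_simps)
    fix z assume "z \<in> {x. P x = x}"
    then show "(x - P x) \<bullet> z = 0" using sym_opD[OF P(1), of x z] by (simp add: inner_diff_left)
  qed (simp add: PP)
qed

section \<open>Adjoints and von Neumann algebras\<close>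

lemma inner_scaleC_left: "(c *\<^sub>C x) \<bullet> y = x \<bullet> (cnj c *\<^sub>C (y::'h::complex_hilbert))"
  by (simp add: inner_eq_Re_cinner cinner_scaleC_left cinner_scaleC_right)

lemma Im_cinner: "Im (cinner x y) = x \<bullet> ((- \<i>) *\<^sub>C (y::'h::complex_hilbert))"
  by (simp add: inner_eq_Re_cinner cinner_scaleC_right)

lemma scaleC_minus_one: "(- 1) *\<^sub>C x = - (x::'h::complex_hilbert)"
  using scaleC_of_real[of "-1" x] by simp

lemma scaleC_one [simp]: "1 *\<^sub>C x = (x::'h::complex_hilbert)"
  using scaleC_of_real[of 1 x] by simp

lemma scaleC_minus_left: "(- c) *\<^sub>C x = - (c *\<^sub>C (x::'h::complex_hilbert))"
  using scaleC_scaleC[of "-1" c x] by (simp add: scaleC_minus_one)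

lemma scaleC_minus_right: "c *\<^sub>C (- x) = - (c *\<^sub>C (x::'h::complex_hilbert))"
  using scaleC_scaleC[of c "-1" x] by (simp add: scaleC_minus_one scaleC_minus_left)

lemma scaleC_diff_right: "c *\<^sub>C (x - y) = c *\<^sub>C x - c *\<^sub>C (y::'h::complex_hilbert)"
  using scaleC_add_right[of c x "-y"] by (simp add: scaleC_minus_right)

lemma scaleC_scaleR_commute: "c *\<^sub>C (r *\<^sub>R x) = r *\<^sub>R (c *\<^sub>C (x::'h::complex_hilbert))"
  by (metis scaleC_of_real scaleC_scaleC mult.commute)

lemma scaleC_zero_right [simp]: "c *\<^sub>C (0::'h::complex_hilbert) = 0"
  using norm_scaleC[of c "0::'h"] by simp

lemma inner_eqI: "(\<And>y. u \<bullet> y = v \<bullet> y) \<Longrightarrow> u = (v::'a::real_inner)"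
  by (metis inner_diff_left inner_eq_zero_iff right_minus_eq)

lemma BH_scaleC: "A \<in> BH \<Longrightarrow> A (c *\<^sub>C x) = c *\<^sub>C A x"
  by (simp add: BH_def)

lemma BH_closed [intro, simp]:
  "(0::'h::complex_hilbert op) \<in> BH" "(id_blinfun::'h op) \<in> BH"
  and BH_add [intro]: "A \<in> BH \<Longrightarrow> B \<in> BH \<Longrightarrow> A + B \<in> (BH::'h op set)"
  and BH_diff [intro]: "A \<in> BH \<Longrightarrow> B \<in> BH \<Longrightarrow> A - B \<in> (BH::'h op set)"
  and BH_compose [intro]: "A \<in> BH \<Longrightarrow> B \<in> BH \<Longrightarrow> (A o\<^sub>L B) \<in> (BH::'h op set)"
  and BH_op_scaleC [intro]: "A \<in> BH \<Longrightarrow> op_scaleC c A \<in> (BH::'h op set)"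
  and BH_scaleR [intro]: "A \<in> BH \<Longrightarrow> r *\<^sub>R A \<in> (BH::'h op set)"
  by (auto simp: BH_def blinfun.bilinear_simps scaleC_add_right scaleC_diff_right op_scaleC.rep_eq
      scaleC_scaleC mult.commute scaleC_scaleR_commute)

text \<open>Complex linearity in this form is inherited by everything that commutes with whatever
  commutes with \<open>A\<close>.\<close>

lemma BH_iff_commute: "A \<in> BH \<longleftrightarrow> (\<forall>c. op_scaleC c id_blinfun o\<^sub>L A = A o\<^sub>L op_scaleC c id_blinfun)"
  by (auto simp: BH_def blinfun_eq_iff op_scaleC.rep_eq)

text \<open>The imaginary part of \<open>cinner x y\<close> is the real inner product of
  \<open>x\<close> with \<open>- \<i> *\<^sub>C y\<close>, so for a complex-linear operator the real
  adjoint is already the complex one.\<close>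

lemma adj_cinner_iff:
  fixes A B :: "'h::complex_hilbert op"
  assumes A: "A \<in> BH"
  shows "(\<forall>x y. cinner (B x) y = cinner x (blinfun_apply A y)) \<longleftrightarrow> (\<forall>x y. blinfun_apply B x \<bullet> y = x \<bullet> A y)"
proof
  assume *: "\<forall>x y. B x \<bullet> y = x \<bullet> A y"
  show "\<forall>x y. cinner (B x) y = cinner x (A y)"
    by (intro allI complex_eqI) (simp_all only: Im_cinner inner_eq_Re_cinner[symmetric] *[rule_format] BH_scaleC[OF A])
qed (simp add: inner_eq_Re_cinner)

lemma adj_eqI:
  fixes A B :: "'h::complex_hilbert op"
  assumes A: "A \<in> BH" and B: "\<And>x y. blinfun_apply B x \<bullet> y = x \<bullet> A y"
  shows "adj A = B"
  unfolding adj_def adj_cinner_iff[OF A]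
proof (rule the_equality)
  fix C assume "\<forall>x y. blinfun_apply C x \<bullet> y = x \<bullet> A y"
  then have "C x \<bullet> y = B x \<bullet> y" for x y by (simp add: B)
  then show "C = B" by (intro blinfun_eqI) (rule inner_eqI)
qed (simp add: B)

lemma adj_inner:
  fixes A :: "'h::complex_hilbert op"
  assumes A: "A \<in> BH"
  shows "adj A x \<bullet> y = x \<bullet> A y"
proof -
  obtain B where B: "\<And>x y. x \<bullet> A y = blinfun_apply B x \<bullet> y" using real_adjoint_exists[of A] by blast
  then have "adj A = B" by (intro adj_eqI[OF A]) simp
  then show ?thesis by (simp add: B)
qed

lemma adj_inner_right: "A \<in> BH \<Longrightarrow> x \<bullet> adj A y = A x \<bullet> y"
  using adj_inner[of A y x] by (simp add: inner_commute)

lemma adj_BH [intro]: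
  assumes A: "A \<in> BH"
  shows "adj A \<in> BH"
  unfolding BH_def
  by (intro CollectI allI, rule inner_eqI) (simp add: adj_inner[OF A] inner_scaleC_left BH_scaleC[OF A])

lemma adj_adj: "A \<in> BH \<Longrightarrow> adj (adj A) = A"
  by (intro adj_eqI adj_BH) (simp_all add: adj_inner_right)

lemma adj_compose: "A \<in> BH \<Longrightarrow> B \<in> BH \<Longrightarrow> adj (A o\<^sub>L B) = adj B o\<^sub>L adj A"
  by (intro adj_eqI BH_compose) (simp_all add: adj_inner)

lemma adj_op_scaleC: "A \<in> BH \<Longrightarrow> adj (op_scaleC c A) = op_scaleC (cnj c) (adj A)"
  by (intro adj_eqI BH_op_scaleC) (simp_all add: adj_inner op_scaleC.rep_eq inner_scaleC_left BH_scaleC)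

lemma sym_op_iff_adj: "A \<in> BH \<Longrightarrow> sym_op A \<longleftrightarrow> adj A = A"
  using adj_inner[of A] adj_eqI[of A A] by (auto simp: sym_op_def)

lemma selfadjoint_op_iff: "selfadjoint_op A \<longleftrightarrow> A \<in> BH \<and> sym_op A"
  by (auto simp: selfadjoint_op_def sym_op_iff_adj)

lemma projection_op_iff: "projection_op P \<longleftrightarrow> P \<in> BH \<and> sym_op P \<and> P o\<^sub>L P = P"
  by (auto simp: projection_op_def sym_op_iff_adj)

text \<open>The hypothesis says that the form of \<open>A\<close> has no imaginary part. Testing it
  at \<open>x + \<i> *\<^sub>C y\<close> leaves exactly the symmetry relation.\<close>

lemma BH_form_zero_sym:
  fixes A :: "'h::complex_hilbert op"
  assumes A: "A \<in> BH" and zero: "\<And>x. x \<bullet> (\<i> *\<^sub>C blinfun_apply A x) = 0"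
  shows "sym_op A"
  unfolding sym_op_def
proof (intro allI)
  fix x y :: 'h
  let ?z = "\<i> *\<^sub>C y"
  have "(x + ?z) \<bullet> (\<i> *\<^sub>C A (x + ?z)) = 0" by (rule zero)
  then have "x \<bullet> (\<i> *\<^sub>C A ?z) + ?z \<bullet> (\<i> *\<^sub>C A x) = 0"
    using zero[of x] zero[of ?z] by (simp add: blinfun.bilinear_simps scaleC_add_right inner_simps)
  then show "A x \<bullet> y = x \<bullet> A y"
    by (simp add: BH_scaleC[OF A] scaleC_scaleC inner_scaleC_left scaleC_minus_one inner_commute[of "A x"])
qed

lemma BH_cinner_self:
  fixes A :: "'h::complex_hilbert op"
  assumes A: "A \<in> BH" "sym_op A"
  shows "cinner x (A x) = complex_of_real (x \<bullet> A x)"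
proof -
  have "x \<bullet> ((- \<i>) *\<^sub>C A x) = A x \<bullet> ((-\<i>) *\<^sub>C x)"
    by (metis BH_scaleC[OF A(1)] sym_opD[OF A(2)])
  also have "\<dots> = x \<bullet> (\<i> *\<^sub>C A x)"
    by (simp add: inner_commute[of "A x"] inner_scaleC_left)
  finally have "x \<bullet> ((- \<i>) *\<^sub>C A x) = 0" by (simp add: scaleC_minus_left)
  then show ?thesis by (simp add: complex_eq_iff Im_cinner inner_eq_Re_cinner[symmetric])
qed

text \<open>The imaginary part of the form of the difference gives symmetry, and then the real part
  bounds the norm by 0. This is the uniqueness behind the description in
  \<open>fun_calculus\<close>.\<close>

lemma BH_eqI_form:
  fixes A B :: "'h::complex_hilbert op"
  assumes "A \<in> BH" "B \<in> BH" and eq: "\<And>x. cinner x (blinfun_apply A x) = cinner x (blinfun_apply B x)"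
  shows "A = B"
proof -
  define D where "D = A - B"
  have D: "D \<in> BH" using assms by (auto simp: D_def)
  have e: "Re (cinner x (A x)) = Re (cinner x (B x))" "Im (cinner x (A x)) = Im (cinner x (B x))" for x
    using eq by simp_all
  have re: "x \<bullet> D x = 0" and im: "x \<bullet> (\<i> *\<^sub>C D x) = 0" for x
    using e[of x] by (simp_all add: D_def inner_eq_Re_cinner[symmetric] Im_cinner blinfun.bilinear_simps
        scaleC_diff_right inner_simps scaleC_minus_left)
  have s: "sym_op D" by (rule BH_form_zero_sym[OF D im])
  have "norm D \<le> 0" by (rule sym_op_norm_le[OF s]) (simp_all add: re)
  then show ?thesis by (simp add: D_def)
qed

lemma positive_op_iff: "positive_op A \<longleftrightarrow> A \<in> BH \<and> psd A"
proof
  assume A: "positive_op A"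
  then have B: "A \<in> BH" and nn: "cinner x (A x) \<in> \<real>\<^sub>\<ge>\<^sub>0" for x by (auto simp: positive_op_def)
  have "x \<bullet> (\<i> *\<^sub>C A x) = 0" for x
    using nn[of x] Im_cinner[of x "A x"] by (simp add: complex_nonneg_Reals_iff scaleC_minus_left)
  from BH_form_zero_sym[OF B this] show "A \<in> BH \<and> psd A"
    using B nn by (auto simp: psd_def inner_eq_Re_cinner complex_nonneg_Reals_iff)
qed (auto simp: positive_op_def BH_cinner_self psd_sym psd_nonneg)

lemma psd_adj_compose:
  assumes "A \<in> BH"
  shows "psd (adj A o\<^sub>L A)"
  using assms by (auto simp: psd_def sym_op_def adj_inner adj_inner_right)

lemma psd_sqrt_BH:
  assumes "A \<in> BH" "psd A"
  shows "\<exists>B\<in>BH. psd B \<and> B o\<^sub>L B = A \<and> (\<forall>T. T o\<^sub>L A = A o\<^sub>L T \<longrightarrow> T o\<^sub>L B = B o\<^sub>L T)"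
proof -
  obtain B where "psd B" "B o\<^sub>L B = A" "\<And>T. T o\<^sub>L A = A o\<^sub>L T \<Longrightarrow> T o\<^sub>L B = B o\<^sub>L T"
    using psd_sqrt_exists[OF assms(2)] by metis
  moreover from this have "B \<in> BH" using assms(1) unfolding BH_iff_commute by blast
  ultimately show ?thesis by blast
qed

lemma op_abs_eqI:
  assumes "a \<in> BH" "positive_op B" "B o\<^sub>L B = adj a o\<^sub>L a"
  shows "op_abs a = B"
  unfolding op_abs_def
proof (rule the_equality)
  fix C assume "positive_op C \<and> C o\<^sub>L C = adj a o\<^sub>L a"
  then show "C = B" using assms psd_sqrt_unique[of C B] by (simp add: positive_op_iff)
qed (use assms in simp)

lemma
  assumes a: "a \<in> BH"
  shows op_abs_BH: "op_abs a \<in> BH" and op_abs_psd: "psd (op_abs a)"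
    and op_abs_square: "op_abs a o\<^sub>L op_abs a = adj a o\<^sub>L a"
    and op_abs_commute: "T o\<^sub>L (adj a o\<^sub>L a) = (adj a o\<^sub>L a) o\<^sub>L T \<Longrightarrow> T o\<^sub>L op_abs a = op_abs a o\<^sub>L T"
proof -
  obtain B where B: "B \<in> BH" "psd B" "B o\<^sub>L B = adj a o\<^sub>L a"
    "\<And>T. T o\<^sub>L (adj a o\<^sub>L a) = (adj a o\<^sub>L a) o\<^sub>L T \<Longrightarrow> T o\<^sub>L B = B o\<^sub>L T"
    using psd_sqrt_BH[OF BH_compose[OF adj_BH[OF a] a] psd_adj_compose[OF a]] by blast
  have e: "op_abs a = B" by (rule op_abs_eqI[OF a]) (use B(1-3) in \<open>simp_all add: positive_op_iff\<close>)
  show "op_abs a \<in> BH" "psd (op_abs a)" "op_abs a o\<^sub>L op_abs a = adj a o\<^sub>L a"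
    by (rule B(1-3)[folded e])+
  show "T o\<^sub>L (adj a o\<^sub>L a) = (adj a o\<^sub>L a) o\<^sub>L T \<Longrightarrow> T o\<^sub>L op_abs a = op_abs a o\<^sub>L T"
    by (rule B(4)[folded e])
qed

lemma norm_op_abs:
  assumes a: "a \<in> BH"
  shows "norm (op_abs a x) = norm (a x)"
proof -
  have "op_abs a x \<bullet> op_abs a x = x \<bullet> (op_abs a o\<^sub>L op_abs a) x"
    using sym_opD[OF psd_sym[OF op_abs_psd[OF a]]] by simp
  then have "op_abs a x \<bullet> op_abs a x = x \<bullet> adj a (a x)" by (simp add: op_abs_square[OF a])
  then show ?thesis by (simp add: adj_inner_right[OF a] norm_eq_sqrt_inner)
qed

lemma commutant_BH: "T \<in> commutant M \<Longrightarrow> T \<in> BH"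
  by (simp add: commutant_def)

lemma commutant_commute: "T \<in> commutant M \<Longrightarrow> A \<in> M \<Longrightarrow> T o\<^sub>L A = A o\<^sub>L T"
  by (simp add: commutant_def)

section \<open>Closure properties of a von Neumann algebra\<close>

context
  fixes M :: "'h::complex_hilbert op set"
  assumes vN: "von_neumann_algebra M"
begin

lemma vn_BH: "A \<in> M \<Longrightarrow> A \<in> BH"
  using vN by (auto simp: von_neumann_algebra_def)

lemma vn_adj: "A \<in> M \<Longrightarrow> adj A \<in> M"
  using vN by (auto simp: von_neumann_algebra_def)

lemma vn_memI:
  assumes "A \<in> BH" "\<And>T. T \<in> commutant M \<Longrightarrow> T o\<^sub>L A = A o\<^sub>L T"
  shows "A \<in> M"
proof -
  have "A \<in> commutant (commutant M)" using assms by (auto simp: commutant_def)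
  then show ?thesis using vN by (simp add: von_neumann_algebra_def)
qed

text \<open>Needed because a projection commutes with \<open>T\<close> only if its range is
  invariant under both \<open>T\<close> and the adjoint.\<close>

lemma commutant_adj:
  assumes T: "T \<in> commutant M"
  shows "adj T \<in> commutant M"
  unfolding commutant_def
proof (intro CollectI conjI ballI)
  show "adj T \<in> BH" using T by (auto simp: commutant_def)
  fix A assume A: "A \<in> M"
  have "adj (T o\<^sub>L adj A) = adj (adj A o\<^sub>L T)" using T vn_adj[OF A] by (simp add: commutant_def)
  then show "adj T o\<^sub>L A = A o\<^sub>L adj T"
    using commutant_BH[OF T] vn_BH[OF A] by (simp add: adj_compose adj_BH adj_adj)
qed

lemma shows vn_0: "0 \<in> M" and vn_id: "id_blinfun \<in> M"
    and vn_add: "A \<in> M \<Longrightarrow> B \<in> M \<Longrightarrow> A + B \<in> M"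
    and vn_diff: "A \<in> M \<Longrightarrow> B \<in> M \<Longrightarrow> A - B \<in> M"
    and vn_compose: "A \<in> M \<Longrightarrow> B \<in> M \<Longrightarrow> (A o\<^sub>L B) \<in> M"
    and vn_op_scaleC: "A \<in> M \<Longrightarrow> op_scaleC c A \<in> M"
    and vn_scaleR: "A \<in> M \<Longrightarrow> r *\<^sub>R A \<in> M"
proof -
  have c: "T (A x) = A (T x)" if "T \<in> commutant M" "A \<in> M" for T A x
    using commutant_commute[OF that] by (metis blinfun_apply_blinfun_compose)
  have s: "T (c *\<^sub>C x) = c *\<^sub>C T x" if "T \<in> commutant M" for T c x
    using that by (simp add: commutant_def BH_scaleC)
  show "0 \<in> M" "id_blinfun \<in> M" by (auto intro!: vn_memI simp: blinfun_eq_iff)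
  show "A \<in> M \<Longrightarrow> B \<in> M \<Longrightarrow> A + B \<in> M" "A \<in> M \<Longrightarrow> B \<in> M \<Longrightarrow> A - B \<in> M"
     "A \<in> M \<Longrightarrow> B \<in> M \<Longrightarrow> (A o\<^sub>L B) \<in> M" "A \<in> M \<Longrightarrow> op_scaleC c A \<in> M" "A \<in> M \<Longrightarrow> r *\<^sub>R A \<in> M"
    by (auto intro!: vn_memI intro: vn_BH simp: blinfun_eq_iff blinfun.bilinear_simps s op_scaleC.rep_eq) (metis c)+
qed

lemma vn_op_abs:
  assumes a: "a \<in> M"
  shows "op_abs a \<in> M"
proof (rule vn_memI)
  show "op_abs a \<in> BH" by (rule op_abs_BH[OF vn_BH[OF a]])
  fix T assume "T \<in> commutant M"
  then show "T o\<^sub>L op_abs a = op_abs a o\<^sub>L T"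
    by (intro op_abs_commute vn_BH a commutant_commute[of T M] vn_compose vn_adj)
qed

lemma vn_orth_proj:
  assumes S: "closed S" "subspace S" and inv: "\<And>T x. T \<in> commutant M \<Longrightarrow> x \<in> S \<Longrightarrow> T x \<in> S"
  shows "orth_proj S \<in> M" and "projection_op (orth_proj S)"
proof -
  have com: "T o\<^sub>L orth_proj S = orth_proj S o\<^sub>L T" if T: "T \<in> commutant M" for T
  proof (rule blinfun_eqI)
    fix x
    have "orth_proj S (T x) = T (orth_proj S x)"
      by (rule orth_proj_commute[OF S, where T' = "adj T"])
         (use inv T commutant_adj[OF T] commutant_BH[OF T] in \<open>auto simp: adj_inner_right\<close>)
    then show "(T o\<^sub>L orth_proj S) x = (orth_proj S o\<^sub>L T) x" by simp
  qed
  \<comment> \<open>The scalars belong to the commutant, so the commutation just shown includes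
    complex linearity of the projection.\<close>
  have "op_scaleC c id_blinfun \<in> commutant M" for c
    by (auto simp: commutant_def blinfun_eq_iff op_scaleC.rep_eq BH_scaleC dest!: vn_BH)
  then have B: "orth_proj S \<in> BH" unfolding BH_iff_commute using com by blast
  show "orth_proj S \<in> M" by (rule vn_memI[OF B com])
  show "projection_op (orth_proj S)"
    by (auto simp: projection_op_iff B sym_op_def orth_proj_sym[OF S] orth_proj_idem[OF S] blinfun_eq_iff)
qed

lemma vn_spec_proj:
  assumes A: "A \<in> M" "sym_op A" and l: "0 \<le> l"
  shows "orth_proj (spec_space A l) \<in> M" and "projection_op (orth_proj (spec_space A l))"
  using vn_orth_proj[OF closed_spec_space[OF A(2) l] subspace_spec_space]
    spec_space_commute[OF commutant_commute[OF _ A(1)]] by blast+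

end

lemma BH_orth_proj:
  assumes S: "closed S" "subspace S" and inv: "\<And>c x. x \<in> S \<Longrightarrow> c *\<^sub>C x \<in> S"
  shows "orth_proj S \<in> BH" and "projection_op (orth_proj S)"
proof -
  have "orth_proj S (c *\<^sub>C x) = c *\<^sub>C orth_proj S x" for c x
    using orth_proj_commute[OF S, where T = "op_scaleC c id_blinfun" and T' = "op_scaleC (cnj c) id_blinfun"] inv
    by (simp add: op_scaleC.rep_eq inner_scaleC_left)
  then show B: "orth_proj S \<in> BH" by (simp add: BH_def)
  show "projection_op (orth_proj S)"
    by (auto simp: projection_op_iff B sym_op_def orth_proj_sym[OF S] orth_proj_idem[OF S] blinfun_eq_iff)
qed

lemma BH_spec_proj:
  assumes A: "A \<in> BH" "sym_op A" and l: "0 \<le> l"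
  shows "projection_op (orth_proj (spec_space A l))"
proof (rule BH_orth_proj(2)[OF closed_spec_space[OF A(2) l] subspace_spec_space])
  show "c *\<^sub>C x \<in> spec_space A l" if "x \<in> spec_space A l" for c x
    using spec_space_commute[of "op_scaleC c id_blinfun" A x l] A(1) that
    by (simp add: BH_iff_commute op_scaleC.rep_eq)
qed

section \<open>Projection-valued measures\<close>

lemma sym_op_eqI_form:
  fixes A B :: "'a::real_inner \<Rightarrow>\<^sub>L 'a"
  assumes "sym_op A" "sym_op B" "\<And>x. x \<bullet> A x = x \<bullet> B x"
  shows "A = B"
proof -
  have "norm (A - B) \<le> 0"
    by (rule sym_op_norm_le) (use assms in \<open>simp_all add: sym_op_arith blinfun.bilinear_simps inner_simps\<close>)
  then show ?thesis by simp
qed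

lemma sym_idem_inner:
  fixes P :: "'a::real_inner \<Rightarrow>\<^sub>L 'a"
  assumes "sym_op P" "P o\<^sub>L P = P"
  shows "x \<bullet> P x = (norm (P x))\<^sup>2" and "x \<bullet> P x \<le> (norm x)\<^sup>2" and "norm (P x) \<le> norm x"
proof -
  have "P (P x) = P x" using assms(2) by (metis blinfun_apply_blinfun_compose)
  then show e: "x \<bullet> P x = (norm (P x))\<^sup>2"
    using sym_opD[OF assms(1), of x "P x"] by (simp add: power2_norm_eq_inner)
  have "norm (P x) * norm (P x) \<le> norm x * norm (P x)"
    using norm_cauchy_schwarz[of x "P x"] e by (simp add: power2_eq_square)
  then show le: "norm (P x) \<le> norm x"
    by (cases "P x = 0") (auto simp: mult_le_cancel_right)
  show "x \<bullet> P x \<le> (norm x)\<^sup>2" unfolding e using le by (simp add: power_mono)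
qed

lemma projection_op_sym: "projection_op P \<Longrightarrow> sym_op P"
  and projection_op_BH: "projection_op P \<Longrightarrow> P \<in> BH"
  and projection_op_idem: "projection_op P \<Longrightarrow> P o\<^sub>L P = P"
  and projection_op_idem_apply: "projection_op P \<Longrightarrow> P (P x) = P x"
  by (auto simp: projection_op_iff dest: arg_cong[where f = "\<lambda>T. blinfun_apply T x"])

lemma projection_op_inner:
  assumes "projection_op P"
  shows "x \<bullet> P x = (norm (P x))\<^sup>2" and "x \<bullet> P x \<le> (norm x)\<^sup>2" and "norm (P x) \<le> norm x"
  using sym_idem_inner[OF projection_op_sym projection_op_idem] assms by auto

lemma projection_op_psd: "projection_op P \<Longrightarrow> psd P"
  by (simp add: psd_def projection_op_sym projection_op_inner)

lemma projection_op_diff_id: "projection_op P \<Longrightarrow> projection_op (id_blinfun - P)"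
  by (auto simp: projection_op_iff sym_op_arith blinfun_eq_iff blinfun.bilinear_simps
      dest: arg_cong[where f = "\<lambda>T. blinfun_apply T _"])

context
  fixes E :: "real set \<Rightarrow> 'h::complex_hilbert op"
  assumes E: "projection_valued_measure E"
begin

lemma pvm_projection: "B \<in> sets borel \<Longrightarrow> projection_op (E B)"
  using E by (simp add: projection_valued_measure_def)

lemma pvm_UNIV: "E UNIV = id_blinfun"
  using E by (simp add: projection_valued_measure_def)

lemma pvm_sums: "range F \<subseteq> sets borel \<Longrightarrow> disjoint_family F \<Longrightarrow> (\<lambda>n. E (F n) x) sums E (\<Union>n. F n) x"
  for F :: "nat \<Rightarrow> real set"
  using E by (simp add: projection_valued_measure_def)

lemma pvm_empty: "E {} = 0"
proof (rule blinfun_eqI)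
  fix x
  have "(\<lambda>n::nat. E {} x) sums E {} x" using pvm_sums[of "\<lambda>_. {}" x] by (simp add: disjoint_family_on_def)
  then show "E {} x = blinfun_apply 0 x" using summable_LIMSEQ_zero[OF sums_summable] LIMSEQ_const_iff by force
qed

lemma pvm_Un:
  assumes "A \<in> sets borel" "B \<in> sets borel" "A \<inter> B = {}"
  shows "E (A \<union> B) = E A + E B"
proof (rule blinfun_eqI)
  fix x
  let ?F = "\<lambda>n::nat. if n = 0 then A else if n = 1 then B else {}"
  have "disjoint_family ?F" using assms(3) by (auto simp: disjoint_family_on_def)
  moreover have "(\<Union>n. ?F n) = A \<union> B" by (auto split: if_splits)
  ultimately have "(\<lambda>n. E (?F n) x) sums E (A \<union> B) x"
    using pvm_sums[of ?F x] assms by auto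
  moreover have "(\<lambda>n. E (?F n) x) sums (\<Sum>n\<in>{0,1}. E (?F n) x)"
    by (rule sums_finite) (auto simp: pvm_empty)
  ultimately show "E (A \<union> B) x = (E A + E B) x" using sums_unique2 by (fastforce simp: blinfun.add_left)
qed

lemma pvm_Compl: "B \<in> sets borel \<Longrightarrow> E (- B) = id_blinfun - E B"
  using pvm_Un[of B "- B"] by (simp add: pvm_UNIV Compl_partition algebra_simps)

text \<open>Orthogonality is not an axiom of the measure. At a vector \<open>y\<close> in the range
  of \<open>E B\<close>, the form of the projection \<open>E (A \<union> B)\<close> is the squared
  norm of \<open>y\<close> plus that of \<open>E A y\<close>, and it cannot exceed the
  former.\<close>

lemma pvm_disjoint:
  assumes AB: "A \<in> sets borel" "B \<in> sets borel" "A \<inter> B = {}"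
  shows "E A (E B x) = 0"
proof -
  let ?y = "E B x"
  have "?y \<bullet> E (A \<union> B) ?y \<le> (norm ?y)\<^sup>2" using AB by (intro projection_op_inner pvm_projection) auto
  moreover have "?y \<bullet> E B ?y = (norm ?y)\<^sup>2"
    using AB projection_op_idem_apply[OF pvm_projection] by (simp add: power2_norm_eq_inner)
  ultimately have "?y \<bullet> E A ?y \<le> 0" by (simp add: pvm_Un[OF AB] blinfun.add_left inner_simps)
  then show ?thesis using projection_op_inner(1)[OF pvm_projection[OF AB(1)], of ?y] by simp
qed

lemma pvm_Int:
  assumes AB: "A \<in> sets borel" "B \<in> sets borel"
  shows "E (A \<inter> B) x = E A (E B x)"
proof -
  have m: "A \<inter> B \<in> sets borel" "A - B \<in> sets borel" "B - A \<in> sets borel" using AB by auto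
  have "E A = E ((A \<inter> B) \<union> (A - B))" "E B = E ((A \<inter> B) \<union> (B - A))"
    by (rule arg_cong[where f = E]; blast)+
  moreover have "E ((A \<inter> B) \<union> (A - B)) = E (A \<inter> B) + E (A - B)" "E ((A \<inter> B) \<union> (B - A)) = E (A \<inter> B) + E (B - A)"
    by (rule pvm_Un; use m in blast)+
  moreover have "E (A \<inter> B) (E (B - A) y) = 0" "E (A - B) (E (A \<inter> B) y) = 0" "E (A - B) (E (B - A) y) = 0" for y
    by (rule pvm_disjoint; use m in auto)+
  ultimately have e: "E A = E (A \<inter> B) + E (A - B)" "E B = E (A \<inter> B) + E (B - A)"
    and z: "E (A \<inter> B) (E (B - A) y) = 0" "E (A - B) (E (A \<inter> B) y) = 0" "E (A - B) (E (B - A) y) = 0" for y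
    by simp_all
  show ?thesis
    unfolding e(1) e(2) blinfun.bilinear_simps z projection_op_idem_apply[OF pvm_projection[OF m(1)]] by simp
qed

lemma sets_scalar_measure [simp, measurable_cong]: "sets (scalar_measure E x) = sets borel"
  and space_scalar_measure [simp]: "space (scalar_measure E x) = UNIV"
  using sets.sigma_sets_eq[of "borel :: real measure"]
  by (simp_all add: scalar_measure_def sets_measure_of_conv space_measure_of_conv)

lemma emeasure_scalar_measure:
  assumes B: "B \<in> sets borel"
  shows "emeasure (scalar_measure E x) B = ennreal (x \<bullet> E B x)"
proof -
  let ?m = "\<lambda>B. ennreal (Re (cinner x (E B x)))"
  have nn: "0 \<le> x \<bullet> E B x" if "B \<in> sets borel" for B
    using projection_op_inner(1)[OF pvm_projection[OF that]] by simp
  have "emeasure (scalar_measure E x) B = ?m B"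
  proof (rule emeasure_measure_of[OF scalar_measure_def])
    show "positive (sets (scalar_measure E x)) ?m"
      by (simp add: positive_def pvm_empty inner_eq_Re_cinner[symmetric])
    show "countably_additive (sets (scalar_measure E x)) ?m"
      unfolding countably_additive_def
    proof (intro allI impI)
      fix F :: "nat \<Rightarrow> real set"
      assume F: "range F \<subseteq> sets (scalar_measure E x)" "disjoint_family F"
      have "(\<lambda>n. x \<bullet> E (F n) x) sums (x \<bullet> E (\<Union>n. F n) x)"
        by (rule bounded_linear.sums[OF bounded_linear_inner_right pvm_sums]) (use F in auto)
      moreover have "0 \<le> x \<bullet> E (F n) x" for n using nn[of "F n"] F(1) by auto
      ultimately show "(\<Sum>n. ?m (F n)) = ?m (\<Union>n. F n)"
        by (simp add: inner_eq_Re_cinner[symmetric] suminf_ennreal_eq sums_iff)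
    qed
  qed (use B sets_scalar_measure in auto)
  then show ?thesis by (simp add: inner_eq_Re_cinner)
qed

lemma measure_scalar_measure:
  "B \<in> sets borel \<Longrightarrow> measure (scalar_measure E x) B = x \<bullet> E B x"
  using projection_op_inner(1)[OF pvm_projection] by (simp add: measure_def emeasure_scalar_measure)

lemma finite_measure_scalar_measure: "finite_measure (scalar_measure E x)"
  by (rule finite_measureI) (simp add: emeasure_scalar_measure)

lemma AE_scalar_measure:
  assumes "B \<in> sets borel" "E B x = x"
  shows "AE t in scalar_measure E x. t \<in> B"
proof (rule AE_I)
  show "emeasure (scalar_measure E x) (- B) = 0"
    using assms by (simp add: emeasure_scalar_measure pvm_Compl blinfun.bilinear_simps)
qed (use assms in auto)

lemma scalar_measure_restrict:
  assumes C: "C \<in> sets borel"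
  shows "scalar_measure E (E C x) = density (scalar_measure E x) (indicator C)"
proof (rule measure_eqI)
  fix B assume "B \<in> sets (scalar_measure E (E C x))"
  then have B: "B \<in> sets borel" by simp
  have "E C x \<bullet> E B (E C x) = x \<bullet> E C (E B (E C x))"
    by (rule sym_opD[OF projection_op_sym[OF pvm_projection[OF C]]])
  also have "E C (E B (E C x)) = E (C \<inter> B) x"
    using B C by (simp add: pvm_Int[symmetric] Int_ac)
  finally show "emeasure (scalar_measure E (E C x)) B = emeasure (density (scalar_measure E x) (indicator C)) B"
    using B C by (simp add: emeasure_scalar_measure emeasure_density nn_integral_indicator' indicator_inter_arith[symmetric] flip: times_ennreal.rep_eq)
qed simp

lemma integral_scalar_measure_restrict:
  fixes f :: "real \<Rightarrow> real"
  assumes C: "C \<in> sets borel" and f: "f \<in> borel_measurable borel"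
  shows "(\<integral>t. f t \<partial>scalar_measure E (E C x)) = (\<integral>t. indicator C t * f t \<partial>scalar_measure E x)"
proof -
  have "density (scalar_measure E x) (indicator C) = density (scalar_measure E x) (\<lambda>t. ennreal (indicator C t))"
    by (simp add: ennreal_indicator)
  then show ?thesis unfolding scalar_measure_restrict[OF C]
    using C f by (simp add: integral_density)
qed

text \<open>Makes integrals against the scalar measures quadratic forms in the vector, hence forms
  of operators.\<close>

lemma scalar_measure_parallelogram:
  "emeasure (scalar_measure E (x + y)) B + emeasure (scalar_measure E (x - y)) B
     = 2 * emeasure (scalar_measure E x) B + 2 * emeasure (scalar_measure E y) B"
proof (cases "B \<in> sets borel")
  case True
  have nn: "0 \<le> z \<bullet> E B z" for z
    using projection_op_inner(1)[OF pvm_projection[OF True]] by simp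
  have "ennreal ((x + y) \<bullet> E B (x + y)) + ennreal ((x - y) \<bullet> E B (x - y))
      = ennreal ((x + y) \<bullet> E B (x + y) + (x - y) \<bullet> E B (x - y))"
    by (intro ennreal_plus[symmetric] nn)
  also have "(x + y) \<bullet> E B (x + y) + (x - y) \<bullet> E B (x - y) = 2 * (x \<bullet> E B x) + 2 * (y \<bullet> E B y)"
    by (simp add: blinfun.bilinear_simps inner_simps)
  also have "ennreal (2 * (x \<bullet> E B x) + 2 * (y \<bullet> E B y)) = 2 * ennreal (x \<bullet> E B x) + 2 * ennreal (y \<bullet> E B y)"
    using nn by (simp add: ennreal_mult)
  finally show ?thesis using True by (simp add: emeasure_scalar_measure)
next
  case False then show ?thesis by (simp add: emeasure_notin_sets)
qed

lemma scalar_measure_scaleC: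
  "emeasure (scalar_measure E (c *\<^sub>C x)) B = ennreal ((cmod c)\<^sup>2) * emeasure (scalar_measure E x) B"
proof (cases "B \<in> sets borel")
  case True
  have "(c *\<^sub>C x) \<bullet> E B (c *\<^sub>C x) = (cmod c)\<^sup>2 * (x \<bullet> E B x)"
    unfolding projection_op_inner(1)[OF pvm_projection[OF True]]
    by (simp add: BH_scaleC[OF projection_op_BH[OF pvm_projection[OF True]]] norm_scaleC power_mult_distrib)
  then show ?thesis using True by (simp add: emeasure_scalar_measure ennreal_mult')
next
  case False then show ?thesis by (simp add: emeasure_notin_sets)
qed

end

section \<open>Uniqueness of spectral measures on half-lines\<close>

context
  fixes E :: "real set \<Rightarrow> 'h::complex_hilbert op" and A :: "'h op"
  assumes spec: "is_spectral_measure_of E A" and A: "A \<in> BH" "psd A"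
begin

lemma spec_pvm: "projection_valued_measure E"
  using spec by (simp add: is_spectral_measure_of_def)

lemma spec_form: "x \<bullet> A x = (\<integral>t. t \<partial>scalar_measure E x)"
proof -
  have "cinner x (A x) = complex_of_real (\<integral>t. t \<partial>scalar_measure E x)"
    using spec by (simp add: is_spectral_measure_of_def)
  then show ?thesis by (simp add: inner_eq_Re_cinner)
qed

lemma spec_integrable: "integrable (scalar_measure E x) (\<lambda>t. t)"
proof -
  obtain K where K: "E {-K..K} = id_blinfun" using spec by (auto simp: is_spectral_measure_of_def)
  interpret finite_measure "scalar_measure E x" by (rule finite_measure_scalar_measure[OF spec_pvm])
  have "AE t in scalar_measure E x. t \<in> {-K..K}"
    by (rule AE_scalar_measure[OF spec_pvm]) (simp_all add: K)
  then have "AE t in scalar_measure E x. norm t \<le> K" by (rule AE_mp) (auto intro!: AE_I2)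
  then show ?thesis
    by (rule integrable_const_bound) (rule measurable_ident_sets[OF sets_scalar_measure[OF spec_pvm]])
qed

text \<open>A spectral measure is tied to \<open>A\<close> only through the quadratic form.
  Splitting the integral over \<open>B\<close> and its complement shows that the form is block
  diagonal for \<open>E B\<close>.\<close>

lemma spec_commute:
  assumes B: "B \<in> sets borel"
  shows "E B o\<^sub>L A = A o\<^sub>L E B"
proof -
  let ?P = "E B" and ?Q = "E (- B)"
  note [measurable_cong] = sets_scalar_measure[OF spec_pvm]
  have sP: "sym_op ?P" and PP: "?P (?P x) = ?P x" for x
    using pvm_projection[OF spec_pvm B] by (auto simp: projection_op_sym projection_op_idem_apply)
  have As: "sym_op A" by (rule psd_sym[OF A(2)])
  have Q: "?Q x = x - ?P x" for x using B by (simp add: pvm_Compl[OF spec_pvm] blinfun.bilinear_simps)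
  have split: "x \<bullet> A x = ?P x \<bullet> A (?P x) + ?Q x \<bullet> A (?Q x)" for x
  proof -
    have i: "integrable (scalar_measure E x) (\<lambda>t. indicator C t * t)" if "C \<in> sets borel" for C
      using integrable_mult_indicator[OF _ spec_integrable[of x], of C] that by (simp add: sets_scalar_measure[OF spec_pvm])
    have "?P x \<bullet> A (?P x) + ?Q x \<bullet> A (?Q x)
       = (\<integral>t. indicator B t * t \<partial>scalar_measure E x) + (\<integral>t. indicator (- B) t * t \<partial>scalar_measure E x)"
      using B by (simp add: spec_form integral_scalar_measure_restrict[OF spec_pvm])
    also have "\<dots> = (\<integral>t. indicator B t * t + indicator (- B) t * t \<partial>scalar_measure E x)"
      using B by (intro Bochner_Integration.integral_add[symmetric] i) auto
    also have "(\<lambda>t. indicator B t * t + indicator (- B) t * t) = (\<lambda>t::real. t)"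
      by (auto simp: fun_eq_iff indicator_def)
    finally show ?thesis by (simp add: spec_form)
  qed
  \<comment> \<open>With P and Q = 1 - P this is A - (PAP + QAQ), the off-diagonal part of
    \<open>A\<close>.\<close>
  define S where "S = (A o\<^sub>L ?P) + (?P o\<^sub>L A) - 2 *\<^sub>R (?P o\<^sub>L A o\<^sub>L ?P)"
  have Ss: "sym_op S" unfolding sym_op_def S_def
    using sym_opD[OF sP] sym_opD[OF As] by (simp add: blinfun.bilinear_simps inner_simps)
  have "S = 0"
  proof (rule sym_op_eqI_form[OF Ss sym_op_0])
    fix x
    have "x \<bullet> A (?P x) = A x \<bullet> ?P x" "x \<bullet> ?P (A x) = ?P x \<bullet> A x" "x \<bullet> ?P (A (?P x)) = ?P x \<bullet> A (?P x)"
      using sym_opD[OF sP] sym_opD[OF As] by simp_all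
    then show "x \<bullet> S x = x \<bullet> blinfun_apply 0 x"
      using split[of x] by (simp add: S_def Q blinfun.bilinear_simps inner_simps inner_commute)
  qed
  then have "S x = 0" for x by simp
  then have S0: "A (?P x) + ?P (A x) = 2 *\<^sub>R ?P (A (?P x))" for x
    by (simp add: S_def blinfun.bilinear_simps)
  have "?P (A (?P x)) = ?P (A x)" for x
    using arg_cong[OF S0[of x], of "blinfun_apply ?P"] by (simp add: blinfun.bilinear_simps PP scaleR_2)
  then show ?thesis using S0 by (intro blinfun_eqI) (simp add: scaleR_2)
qed

text \<open>On the range of \<open>E {..s}\<close> the scalar measure lives on \<open>{..s}\<close>,
  on the complement on \<open>{s<..}\<close>. There equality of the integrals of \<open>t\<close>
  and \<open>s\<close> would force the measure, whose mass is the squared norm of the vector, to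
  vanish.\<close>

lemma spec_space_eq_range_pvm:
  assumes s: "0 \<le> s"
  shows "spec_space A s = {x. E {..s} x = x}"
proof (rule spec_space_eq_range[OF A(2) s])
  note [measurable_cong] = sets_scalar_measure[OF spec_pvm]
  have P: "projection_op (E {..s})" by (rule pvm_projection[OF spec_pvm]) simp
  then show "sym_op (E {..s})" "E {..s} o\<^sub>L E {..s} = E {..s}"
    by (simp_all add: projection_op_sym projection_op_idem)
  show "E {..s} o\<^sub>L A = A o\<^sub>L E {..s}" by (rule spec_commute) simp
  fix x
  interpret finite_measure "scalar_measure E x" by (rule finite_measure_scalar_measure[OF spec_pvm])
  have const: "(\<integral>t. s \<partial>scalar_measure E x) = s * (x \<bullet> x)"
    by (simp add: measure_scalar_measure[OF spec_pvm] space_scalar_measure[OF spec_pvm] pvm_UNIV[OF spec_pvm] mult.commute)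
  {
    assume "E {..s} x = x"
    then have "AE t in scalar_measure E x. t \<in> {..s}" by (intro AE_scalar_measure[OF spec_pvm]) auto
    then have "(\<integral>t. t \<partial>scalar_measure E x) \<le> (\<integral>t. s \<partial>scalar_measure E x)"
      by (intro integral_mono_AE spec_integrable) auto
    then show "x \<bullet> A x \<le> s * (x \<bullet> x)" unfolding spec_form const .
  }
  assume "E {..s} x = 0" and x: "x \<noteq> 0"
  then have "E {s<..} x = x" using pvm_Compl[OF spec_pvm, of "{..s}"] by (simp add: Compl_atMost blinfun.bilinear_simps)
  then have ae: "AE t in scalar_measure E x. t \<in> {s<..}" by (intro AE_scalar_measure[OF spec_pvm]) auto
  have "(\<integral>t. t \<partial>scalar_measure E x) \<noteq> (\<integral>t. s \<partial>scalar_measure E x)"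
  proof
    assume "(\<integral>t. t \<partial>scalar_measure E x) = (\<integral>t. s \<partial>scalar_measure E x)"
    then have "(\<integral>t. t - s \<partial>scalar_measure E x) = 0" using spec_integrable by simp
    moreover have "AE t in scalar_measure E x. 0 \<le> t - s" using ae by (rule AE_mp) (auto intro!: AE_I2)
    ultimately have "AE t in scalar_measure E x. t - s = 0"
      using integral_nonneg_eq_0_iff_AE[of "scalar_measure E x" "\<lambda>t. t - s"] spec_integrable by simp
    with ae have "AE t in scalar_measure E x. False" by eventually_elim auto
    then have "emeasure (scalar_measure E x) UNIV = 0" by (simp add: AE_iff_measurable[OF _ refl] space_scalar_measure[OF spec_pvm])
    then have "\<not> x \<bullet> x > 0" by (simp add: emeasure_scalar_measure[OF spec_pvm] pvm_UNIV[OF spec_pvm] ennreal_eq_0_iff del: inner_gt_zero_iff)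
    then show False using x unfolding inner_gt_zero_iff by simp
  qed
  moreover have "(\<integral>t. s \<partial>scalar_measure E x) \<le> (\<integral>t. t \<partial>scalar_measure E x)"
    using ae by (intro integral_mono_AE spec_integrable) auto
  ultimately show "s * (x \<bullet> x) < x \<bullet> A x" unfolding spec_form const by simp
qed

text \<open>The right-hand side does not mention \<open>E\<close>, so the choice inside
  \<open>spectral_measure\<close> is harmless and spectral measures constructed in other ways can be
  compared with it.\<close>

lemma spec_greaterThan:
  assumes s: "0 \<le> s"
  shows "E {s<..} = id_blinfun - orth_proj (spec_space A s)"
proof -
  have P: "projection_op (E {..s})" by (rule pvm_projection[OF spec_pvm]) simp
  have "orth_proj (spec_space A s) = E {..s}"
    unfolding spec_space_eq_range_pvm[OF s]
    by (rule orth_proj_range_eq) (use P in \<open>simp_all add: projection_op_sym projection_op_idem\<close>)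
  then show ?thesis using pvm_Compl[OF spec_pvm, of "{..s}"] by (simp add: Compl_atMost)
qed

text \<open>A nonzero vector in this range would make the form negative. The functional calculus can
  therefore ignore the values of \<open>t powr p\<close> at negative \<open>t\<close>.\<close>

lemma spec_lessThan_0: "E {..<0} = 0"
proof (rule blinfun_eqI)
  fix x
  let ?y = "E {..<0} x"
  note [measurable_cong] = sets_scalar_measure[OF spec_pvm]
  have P: "projection_op (E {..<0})" by (rule pvm_projection[OF spec_pvm]) simp
  have ae: "AE t in scalar_measure E ?y. t \<in> {..<0}"
    by (rule AE_scalar_measure[OF spec_pvm]) (simp_all add: projection_op_idem_apply[OF P])
  have "0 \<le> - (\<integral>t. t \<partial>scalar_measure E ?y)"
    by (subst integral_minus[symmetric], rule integral_nonneg_AE) (use ae in eventually_elim, auto)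
  then have "(\<integral>t. - t \<partial>scalar_measure E ?y) = 0"
    using psd_nonneg[OF A(2), of ?y] by (simp add: spec_form)
  moreover have "AE t in scalar_measure E ?y. 0 \<le> - t" using ae by eventually_elim auto
  ultimately have "AE t in scalar_measure E ?y. - t = 0"
    using integral_nonneg_eq_0_iff_AE[of "scalar_measure E ?y" "\<lambda>t. - t"] spec_integrable by simp
  with ae have "AE t in scalar_measure E ?y. False" by eventually_elim auto
  then have "emeasure (scalar_measure E ?y) UNIV = 0" by (simp add: AE_iff_measurable[OF _ refl] space_scalar_measure[OF spec_pvm])
  then have "\<not> ?y \<bullet> ?y > 0" by (simp add: emeasure_scalar_measure[OF spec_pvm] pvm_UNIV[OF spec_pvm] ennreal_eq_0_iff del: inner_gt_zero_iff)
  then show "?y = blinfun_apply 0 x" unfolding inner_gt_zero_iff by simp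
qed

end

section \<open>The spectral family of a positive operator\<close>

text \<open>Covers linear combinations of finite measures and matrix coefficients of projections, so
  that an identity between them becomes the vanishing of a single set function.\<close>

definition signed_additive :: "(real set \<Rightarrow> real) \<Rightarrow> bool" where
  "signed_additive f \<longleftrightarrow> (\<forall>F :: nat \<Rightarrow> real set. range F \<subseteq> sets borel \<and> disjoint_family F \<longrightarrow>
     (\<lambda>n. f (F n)) sums f (\<Union>n. F n))"

lemma signed_additive_arith:
  assumes "signed_additive f" "signed_additive g"
  shows "signed_additive (\<lambda>B. f B + g B)" "signed_additive (\<lambda>B. f B - g B)"
  using assms by (auto simp: signed_additive_def intro: sums_add sums_diff)

lemma signed_additive_mult: "signed_additive f \<Longrightarrow> signed_additive (\<lambda>B. c * f B)"
  by (auto simp: signed_additive_def intro: sums_mult)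

lemma signed_additive_Int:
  assumes f: "signed_additive f" and C: "C \<in> sets borel"
  shows "signed_additive (\<lambda>B. f (C \<inter> B))"
  unfolding signed_additive_def
proof (intro allI impI)
  fix F :: "nat \<Rightarrow> real set" assume F: "range F \<subseteq> sets borel \<and> disjoint_family F"
  then have "range (\<lambda>n. C \<inter> F n) \<subseteq> sets borel" using C by auto
  moreover have "disjoint_family (\<lambda>n. C \<inter> F n)" using F by (auto simp: disjoint_family_on_def)
  ultimately have "(\<lambda>n. f (C \<inter> F n)) sums f (\<Union>n. C \<inter> F n)" by (intro f[unfolded signed_additive_def, rule_format] conjI)
  then show "(\<lambda>n. f (C \<inter> F n)) sums f (C \<inter> (\<Union>n. F n))" by simp
qed

lemma signed_additive_measure:
  assumes "finite_measure m" "sets m = sets borel"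
  shows "signed_additive (measure m)"
  using finite_measure.finite_measure_UNION[OF assms(1)] assms(2) by (simp add: signed_additive_def)

text \<open>The signed form of uniqueness of finite measures: half-lines are stable under
  intersection and generate the Borel sets. The value at \<open>UNIV\<close> is what handles
  complements.\<close>

lemma signed_additive_eq_0:
  assumes f: "signed_additive f" and f0: "\<And>a. f {..a} = 0" "f UNIV = 0" and B: "B \<in> sets borel"
  shows "f B = 0"
proof -
  have fs: "(\<lambda>n. f (F n)) sums f (\<Union>n. F n)" if "range F \<subseteq> sets borel" "disjoint_family F" for F :: "nat \<Rightarrow> real set"
    using f that by (auto simp: signed_additive_def)
  have e: "f {} = 0"
  proof -
    have "(\<lambda>n::nat. f {}) sums f {}" using fs[of "\<lambda>_. {}"] by (simp add: disjoint_family_on_def)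
    then show ?thesis using summable_LIMSEQ_zero[OF sums_summable] LIMSEQ_const_iff by force
  qed
  have borel: "sets (borel :: real measure) = sigma_sets UNIV (range atMost)"
    unfolding borel_eq_atMost by (simp add: atMost_def)
  show ?thesis
  proof (rule sigma_sets_induct_disjoint[of "range (atMost :: real \<Rightarrow> real set)" UNIV B])
    show "Int_stable (range (atMost :: real \<Rightarrow> real set))" by (auto simp: Int_stable_def)
    show "B \<in> sigma_sets UNIV (range atMost)" using B borel by simp
    fix C assume C: "C \<in> sigma_sets UNIV (range (atMost :: real \<Rightarrow> real set))" "f C = 0"
    then have Cb: "C \<in> sets borel" using borel by blast
    let ?F = "\<lambda>n::nat. if n = 0 then C else if n = 1 then - C else {}"
    have "(\<lambda>n. f (?F n)) sums f (\<Union>n. ?F n)"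
      by (rule fs) (use Cb in \<open>auto simp: disjoint_family_on_def\<close>)
    also have "(\<Union>n. ?F n) = UNIV" by (auto split: if_splits)
    finally have "(\<lambda>n. f (?F n)) sums 0" by (simp add: f0)
    moreover have "(\<lambda>n. f (?F n)) sums (\<Sum>n\<in>{0,1}. f (?F n))" by (rule sums_finite) (auto simp: e)
    ultimately have "(\<Sum>n\<in>{0,1}. f (?F n)) = 0" using sums_unique2 by blast
    then show "f (UNIV - C) = 0" using C(2) by (simp add: Compl_eq_Diff_UNIV)
  next
    fix F :: "nat \<Rightarrow> real set"
    assume F: "disjoint_family F" "range F \<subseteq> sigma_sets UNIV (range atMost)" "\<And>i. f (F i) = 0"
    then have "(\<lambda>n. f (F n)) sums f (\<Union>n. F n)" using fs[of F] borel by blast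
    then have "(\<lambda>n. 0) sums f (\<Union>n. F n)" using F(3) by simp
    then show "f (\<Union>n. F n) = 0" using sums_unique2[OF sums_zero] by metis
  qed (auto simp: f0 e)
qed

text \<open>Over n equal pieces the increments of \<open>h\<close> sum to at most (b - a)(F b - F
  a)/n. This replaces Riemann-Stieltjes sums in the comparison of a form with an integral.\<close>

lemma real_eq_of_bounded_increments:
  fixes h F :: "real \<Rightarrow> real"
  assumes ab: "a \<le> b" and mono: "\<And>s t. a \<le> s \<Longrightarrow> s \<le> t \<Longrightarrow> F s \<le> F t"
    and inc: "\<And>s t. a \<le> s \<Longrightarrow> s \<le> t \<Longrightarrow> \<bar>h t - h s\<bar> \<le> (t - s) * (F t - F s)"
  shows "h b = h a"
proof -
  have bound: "real (Suc n) * \<bar>h b - h a\<bar> \<le> (b - a) * (F b - F a)" for n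
  proof -
    define d where "d = (b - a) / real (Suc n)"
    have d: "0 \<le> d" "real (Suc n) * d = b - a" using ab by (simp_all add: d_def)
    have "\<bar>h (a + real k * d) - h a\<bar> \<le> d * (F (a + real k * d) - F a)" for k
    proof (induction k)
      case (Suc k)
      have k: "a \<le> a + real k * d" "a + real k * d \<le> a + real (Suc k) * d" using d(1) by (simp_all add: algebra_simps)
      have "\<bar>h (a + real (Suc k) * d) - h (a + real k * d)\<bar>
          \<le> ((a + real (Suc k) * d) - (a + real k * d)) * (F (a + real (Suc k) * d) - F (a + real k * d))"
        by (rule inc[OF k])
      also have "(a + real (Suc k) * d) - (a + real k * d) = d" by (simp add: algebra_simps)
      finally show ?case using Suc by (simp add: right_diff_distrib)
    qed simp
    from this[of "Suc n"] have "\<bar>h b - h a\<bar> \<le> d * (F b - F a)" using d(2) by simp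
    then have "real (Suc n) * \<bar>h b - h a\<bar> \<le> real (Suc n) * (d * (F b - F a))" by (intro mult_left_mono) auto
    also have "\<dots> = (b - a) * (F b - F a)" using d(2) by (simp only: mult.assoc[symmetric])
    finally show ?thesis .
  qed
  show ?thesis
  proof (rule ccontr)
    assume "h b \<noteq> h a"
    then obtain n where "(b - a) * (F b - F a) < real n * \<bar>h b - h a\<bar>" using reals_Archimedean3[of "\<bar>h b - h a\<bar>"] by auto
    also have "\<dots> \<le> real (Suc n) * \<bar>h b - h a\<bar>" by (intro mult_right_mono) auto
    finally show False using bound[of n] by simp
  qed
qed

lemma spec_space_mono:
  assumes "0 \<le> l" "l \<le> m"
  shows "spec_space A l \<subseteq> spec_space A m"
proof
  fix x assume "x \<in> spec_space A l"
  then obtain C where C: "norm ((blinfun_apply A ^^ n) x) \<le> C * l ^ n" for n by (auto simp: spec_space_def)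
  have "0 \<le> C" using C[of 0] norm_ge_zero[of x] by (simp del: norm_ge_zero)
  then have "C * l ^ n \<le> C * m ^ n" for n using assms by (intro mult_left_mono power_mono)
  then have "norm ((blinfun_apply A ^^ n) x) \<le> C * m ^ n" for n using C[of n] by (meson order_trans)
  then show "x \<in> spec_space A m" by (auto simp: spec_space_def)
qed

section \<open>The resolution of the identity and its scalar measures\<close>

definition spec_family :: "'h::complex_hilbert op \<Rightarrow> real \<Rightarrow> 'h op" where
  "spec_family A l = (if l < 0 then 0 else orth_proj (spec_space A l))"

context
  fixes A :: "'h::complex_hilbert op"
  assumes A: "A \<in> BH" "psd A"
begin

lemma spec_family_projection: "projection_op (spec_family A l)"
  using BH_spec_proj[OF A(1) psd_sym[OF A(2)], of l]
  by (auto simp: spec_family_def projection_op_iff)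

lemma spec_family_apply_mem: "0 \<le> l \<Longrightarrow> spec_family A l x \<in> spec_space A l"
  using orth_proj_mem[OF closed_spec_space[OF psd_sym[OF A(2)]] subspace_spec_space] by (simp add: spec_family_def)

lemma spec_family_fixed: "0 \<le> l \<Longrightarrow> spec_family A l x = x \<longleftrightarrow> x \<in> spec_space A l"
  using orth_proj_fixed_iff[OF closed_spec_space[OF psd_sym[OF A(2)]] subspace_spec_space] by (simp add: spec_family_def)

lemma spec_family_compose:
  assumes "l \<le> m"
  shows "spec_family A m (spec_family A l x) = spec_family A l x"
    and "spec_family A l (spec_family A m x) = spec_family A l x"
proof -
  show *: "spec_family A m (spec_family A l x) = spec_family A l x" for x
  proof (cases "l < 0")
    case False
    then show ?thesis
      using spec_family_apply_mem[of l x] spec_space_mono[of l m A] assms by (subst spec_family_fixed) auto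
  qed (simp add: spec_family_def)
  show "spec_family A l (spec_family A m x) = spec_family A l x"
  proof (rule inner_eqI)
    fix y
    show "spec_family A l (spec_family A m x) \<bullet> y = spec_family A l x \<bullet> y"
      by (simp add: sym_opD[OF projection_op_sym[OF spec_family_projection]] *)
  qed
qed

lemma spec_family_top: "norm A \<le> l \<Longrightarrow> spec_family A l = id_blinfun"
proof (rule blinfun_eqI)
  fix x assume l: "norm A \<le> l"
  then have l0: "0 \<le> l" using norm_ge_zero[of A] by linarith
  have "norm (A x) \<le> l * norm x" for x
    using norm_blinfun[of A x] mult_right_mono[OF l, of "norm x"] by simp
  then have "x \<in> spec_space A l" by (intro invariant_subset_spec_space[of x UNIV A l]) (use l0 in auto)
  then show "spec_family A l x = id_blinfun x" using spec_family_fixed[OF l0] by simp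
qed

lemma spec_family_commute: "spec_family A l (A x) = A (spec_family A l x)"
proof (cases "l < 0")
  case False
  then show ?thesis
    using orth_proj_commute[OF closed_spec_space[OF psd_sym[OF A(2)]] subspace_spec_space, of l A A]
      spec_space_apply[of _ A l] sym_opD[OF psd_sym[OF A(2)]] by (simp add: spec_family_def)
qed (simp add: spec_family_def)

definition spec_distr :: "'h \<Rightarrow> real \<Rightarrow> real" where
  "spec_distr x l = (norm (spec_family A l x))\<^sup>2"

lemma spec_distr_inner: "spec_distr x l = x \<bullet> spec_family A l x"
  by (simp add: spec_distr_def projection_op_inner[OF spec_family_projection])

lemma spec_distr_diff:
  assumes "l \<le> m"
  shows "spec_distr x m - spec_distr x l = (norm (spec_family A m x - spec_family A l x))\<^sup>2"
proof -
  have "spec_family A m x \<bullet> spec_family A l x = x \<bullet> spec_family A l x"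
    "spec_family A l x \<bullet> spec_family A m x = x \<bullet> spec_family A l x"
    using spec_family_compose[OF assms] sym_opD[OF projection_op_sym[OF spec_family_projection]] by auto
  moreover have "spec_family A k x \<bullet> spec_family A k x = x \<bullet> spec_family A k x" for k
    using projection_op_inner(1)[OF spec_family_projection] by (simp add: power2_norm_eq_inner)
  ultimately show ?thesis
    by (simp add: spec_distr_inner power2_norm_eq_inner inner_simps)
qed

lemma spec_distr_mono: "l \<le> m \<Longrightarrow> spec_distr x l \<le> spec_distr x m"
  using spec_distr_diff[of l m x] by (metis zero_le_power2 diff_ge_0_iff_ge)

text \<open>The decreasing squared norms converge, and their differences are the squared distances
  of the projected vectors, so these form a Cauchy sequence. The limit inherits the growth rate
  \<open>a\<close> and the orthogonality relations that characterize the projection.\<close>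

lemma spec_distr_right_cont_seq:
  assumes a: "0 \<le> a"
  shows "(\<lambda>n. spec_family A (a + 1 / real (Suc n)) x) \<longlonglongrightarrow> spec_family A a x"
proof -
  let ?b = "\<lambda>n. a + 1 / real (Suc n)"
  let ?f = "\<lambda>n. spec_distr x (?b n)" and ?y = "\<lambda>n. spec_family A (?b n) x"
  have dec: "?b n \<le> ?b m" if "m \<le> n" for m n using that by (simp add: frac_le)
  have "decseq ?f" unfolding decseq_def by (intro allI impI spec_distr_mono dec)
  moreover have "0 \<le> ?f n" for n by (simp add: spec_distr_def)
  ultimately have "convergent ?f" using decseq_convergent[of ?f 0] by (metis convergentI)
  then have C: "Cauchy ?f" by (rule convergent_Cauchy)
  have "Cauchy ?y"
  proof (rule CauchyI')
    fix e :: real assume e: "0 < e"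
    then obtain N where N: "\<And>m n. m \<ge> N \<Longrightarrow> n \<ge> N \<Longrightarrow> dist (?f m) (?f n) < e\<^sup>2"
      using metric_CauchyD[OF C, of "e\<^sup>2"] by auto
    have "dist (?y m) (?y n) < e" if "m \<ge> N" "n > m" for m n
    proof -
      have "(norm (?y m - ?y n))\<^sup>2 < e\<^sup>2"
        using spec_distr_diff[of "?b n" "?b m" x, OF dec] N[of m n] that by (simp add: dist_real_def)
      then show ?thesis using e by (simp add: dist_norm power_less_imp_less_base)
    qed
    then show "\<exists>M. \<forall>m\<ge>M. \<forall>n>m. dist (?y m) (?y n) < e" by blast
  qed
  then obtain z where z: "?y \<longlonglongrightarrow> z" using Cauchy_convergent unfolding convergent_def by blast
  have b: "?b \<longlonglongrightarrow> a + 0" by (intro tendsto_intros LIMSEQ_inverse_real_of_nat[unfolded inverse_eq_divide])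
  have "norm ((blinfun_apply A ^^ k) z) \<le> norm x * a ^ k" for k
  proof -
    \<comment> \<open>The constant \<open>norm x\<close> does not depend on \<open>n\<close>; this
      lets the growth estimate survive the limit.\<close>
    have bound: "norm ((blinfun_apply A ^^ k) (?y n)) \<le> norm x * ?b n ^ k" for n
    proof -
      have b0: "0 \<le> ?b n" using a by simp
      let ?S = "spec_space A (?b n)"
      have "norm (A y) \<le> ?b n * norm y" if "y \<in> ?S" for y
        using spec_space_norm_le[OF psd_sym[OF A(2)] b0 that] .
      then have "(blinfun_apply A ^^ k) (?y n) \<in> ?S \<and> norm ((blinfun_apply A ^^ k) (?y n)) \<le> norm (?y n) * ?b n ^ k"
      proof (induction k)
        case (Suc k)
        then have "norm (A ((blinfun_apply A ^^ k) (?y n))) \<le> ?b n * (norm (?y n) * ?b n ^ k)"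
          using b0 by (meson mult_left_mono order_trans)
        then show ?case using Suc spec_space_apply[of "(blinfun_apply A ^^ k) (?y n)" A "?b n"] by (simp add: mult_ac)
      qed (use spec_family_apply_mem[OF b0] in simp)
      moreover have "norm (?y n) * ?b n ^ k \<le> norm x * ?b n ^ k"
        using b0 by (intro mult_right_mono projection_op_inner(3)[OF spec_family_projection]) simp
      ultimately show ?thesis by linarith
    qed
    have "(\<lambda>n. norm ((blinfun_apply A ^^ k) (?y n))) \<longlonglongrightarrow> norm ((blinfun_apply A ^^ k) z)"
      by (intro tendsto_norm bounded_linear.tendsto[OF funpow_blinfun_linear] z)
    moreover have "(\<lambda>n. norm x * ?b n ^ k) \<longlonglongrightarrow> norm x * (a + 0) ^ k" by (intro tendsto_intros b)
    ultimately have "norm ((blinfun_apply A ^^ k) z) \<le> norm x * (a + 0) ^ k"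
      using bound by (intro LIMSEQ_le) auto
    then show ?thesis by simp
  qed
  then have zS: "z \<in> spec_space A a" unfolding spec_space_def by blast
  have "orth_proj (spec_space A a) x = z"
  proof (rule orth_proj_eqI[OF closed_spec_space[OF psd_sym[OF A(2)] a] subspace_spec_space zS])
    fix u assume u: "u \<in> spec_space A a"
    have "(x - ?y n) \<bullet> u = 0" for n
    proof -
      have "spec_family A (?b n) u = u"
        using u spec_space_mono[of a "?b n" A] a by (subst spec_family_fixed) auto
      then show ?thesis
        by (simp add: inner_diff_left sym_opD[OF projection_op_sym[OF spec_family_projection]])
    qed
    moreover have "(\<lambda>n. (x - ?y n) \<bullet> u) \<longlonglongrightarrow> (x - z) \<bullet> u" by (intro tendsto_intros z)
    ultimately have "(\<lambda>n. 0) \<longlonglongrightarrow> (x - z) \<bullet> u" by simp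
    then show "(x - z) \<bullet> u = 0" by (simp add: LIMSEQ_const_iff)
  qed
  then show ?thesis using z a by (simp add: spec_family_def)
qed

lemma spec_distr_right_cont: "continuous (at_right a) (spec_distr x)"
proof (rule iffD2[OF continuous_at_right_real_increasing[where f = "spec_distr x", OF spec_distr_mono]], assumption, intro allI impI)
  fix e :: real assume e: "0 < e"
  show "\<exists>d>0. spec_distr x (a + d) - spec_distr x a < e"
  proof (cases "a < 0")
    case True
    then show ?thesis using e by (intro exI[of _ "- a / 2"]) (simp add: spec_distr_def spec_family_def)
  next
    case False
    then have "(\<lambda>n. spec_distr x (a + 1 / real (Suc n))) \<longlonglongrightarrow> spec_distr x a"
      unfolding spec_distr_def by (intro tendsto_intros spec_distr_right_cont_seq) simp
    from LIMSEQ_D[OF this e] obtain n where "norm (spec_distr x (a + 1 / real (Suc n)) - spec_distr x a) < e" by blast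
    then show ?thesis by (intro exI[of _ "1 / real (Suc n)"]) simp
  qed
qed

text \<open>The Lebesgue-Stieltjes measure that will turn out to be the scalar measure of
  \<open>A\<close> at \<open>x\<close>; the projection-valued measure is recovered from it.\<close>

definition spec_meas :: "'h \<Rightarrow> real measure" where
  "spec_meas x = interval_measure (spec_distr x)"

lemma sets_spec_meas [simp, measurable_cong]: "sets (spec_meas x) = sets borel"
  and space_spec_meas [simp]: "space (spec_meas x) = UNIV"
  by (simp_all add: spec_meas_def)

lemma spec_meas_Ioc: "l \<le> m \<Longrightarrow> emeasure (spec_meas x) {l<..m} = ennreal (spec_distr x m - spec_distr x l)"
  unfolding spec_meas_def by (intro emeasure_interval_measure_Ioc spec_distr_mono spec_distr_right_cont)

lemma spec_distr_neg: "l < 0 \<Longrightarrow> spec_distr x l = 0"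
  by (simp add: spec_distr_def spec_family_def)

lemma spec_distr_top: "norm A \<le> l \<Longrightarrow> spec_distr x l = (norm x)\<^sup>2"
  by (simp add: spec_distr_def spec_family_top)

lemma emeasure_spec_meas_atMost: "emeasure (spec_meas x) {..l} = ennreal (spec_distr x l)"
proof -
  let ?F = "\<lambda>n::nat. {- real (Suc n)<..l}"
  have "(\<lambda>n. emeasure (spec_meas x) (?F n)) \<longlonglongrightarrow> emeasure (spec_meas x) (\<Union>n. ?F n)"
    by (rule Lim_emeasure_incseq) (auto simp: incseq_def)
  moreover have "emeasure (spec_meas x) (?F n) = ennreal (spec_distr x l)" for n
  proof (cases "- real (Suc n) \<le> l")
    case True then show ?thesis by (subst spec_meas_Ioc) (auto simp: spec_distr_neg)
  next
    case False
    then have "?F n = {}" "l < 0" by auto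
    then show ?thesis by (simp only: spec_distr_neg) simp
  qed
  moreover have "(\<Union>n. ?F n) = {..l}"
  proof (intro equalityI subsetI)
    fix t assume "t \<in> {..l}"
    moreover obtain n where "- t < real n" using reals_Archimedean2 by blast
    ultimately show "t \<in> (\<Union>n. ?F n)" by (auto intro!: exI[of _ n])
  qed auto
  ultimately show ?thesis by (simp only: LIMSEQ_const_iff)
qed

lemma emeasure_spec_meas_UNIV: "emeasure (spec_meas x) UNIV = ennreal ((norm x)\<^sup>2)"
proof -
  let ?F = "\<lambda>n::nat. {..norm A + real n}"
  have "(\<lambda>n. emeasure (spec_meas x) (?F n)) \<longlonglongrightarrow> emeasure (spec_meas x) (\<Union>n. ?F n)"
    by (rule Lim_emeasure_incseq) (auto simp: incseq_def)
  moreover have "emeasure (spec_meas x) (?F n) = ennreal ((norm x)\<^sup>2)" for n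
    by (simp add: emeasure_spec_meas_atMost spec_distr_top)
  moreover have "(\<Union>n. ?F n) = UNIV"
  proof (intro equalityI subsetI)
    fix t :: real
    obtain n where "t - norm A < real n" using reals_Archimedean2 by blast
    then show "t \<in> (\<Union>n. ?F n)" by (auto intro!: exI[of _ n])
  qed auto
  ultimately show ?thesis by (simp only: LIMSEQ_const_iff)
qed

lemma finite_spec_meas: "finite_measure (spec_meas x)"
  by (rule finite_measureI) (simp add: emeasure_spec_meas_UNIV)

lemma measure_spec_meas: "measure (spec_meas x) {..l} = spec_distr x l" "measure (spec_meas x) UNIV = (norm x)\<^sup>2"
  by (simp_all add: measure_def emeasure_spec_meas_atMost emeasure_spec_meas_UNIV spec_distr_def)

lemma signed_additive_spec_meas: "signed_additive (measure (spec_meas x))"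
  by (rule signed_additive_measure[OF finite_spec_meas]) simp

lemma spec_meas_parallelogram:
  "measure (spec_meas (x + y)) B + measure (spec_meas (x - y)) B = 2 * measure (spec_meas x) B + 2 * measure (spec_meas y) B"
proof (cases "B \<in> sets borel")
  case True
  let ?f = "\<lambda>B. measure (spec_meas (x + y)) B + measure (spec_meas (x - y)) B
    - (2 * measure (spec_meas x) B + 2 * measure (spec_meas y) B)"
  have "?f B = 0"
  proof (rule signed_additive_eq_0[where f = ?f, OF _ _ _ True])
    show "signed_additive ?f" by (intro signed_additive_arith signed_additive_mult signed_additive_spec_meas)
    show "?f {..a} = 0" for a
      by (simp add: measure_spec_meas spec_distr_def blinfun.bilinear_simps parallelogram_law)
    show "?f UNIV = 0" by (simp add: measure_spec_meas parallelogram_law)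
  qed
  then show ?thesis by simp
next
  case False then show ?thesis by (simp add: measure_notin_sets)
qed

lemma spec_meas_scaleC: "measure (spec_meas (c *\<^sub>C x)) B = (cmod c)\<^sup>2 * measure (spec_meas x) B"
proof (cases "B \<in> sets borel")
  case True
  let ?f = "\<lambda>B. measure (spec_meas (c *\<^sub>C x)) B - (cmod c)\<^sup>2 * measure (spec_meas x) B"
  have "?f B = 0"
  proof (rule signed_additive_eq_0[where f = ?f, OF _ _ _ True])
    show "signed_additive ?f" by (intro signed_additive_arith signed_additive_mult signed_additive_spec_meas)
    show "?f {..a} = 0" for a
      by (simp add: measure_spec_meas spec_distr_def BH_scaleC[OF projection_op_BH[OF spec_family_projection]]
          norm_scaleC power_mult_distrib)
    show "?f UNIV = 0" by (simp add: measure_spec_meas norm_scaleC power_mult_distrib)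
  qed
  then show ?thesis by simp
next
  case False then show ?thesis by (simp add: measure_notin_sets)
qed

end

text \<open>The hypothesis makes the forms of c*Tc and \<open>(cmod c)\<^sup>2 *\<^sub>R T\<close>
  agree. Both are symmetric, hence equal, and cancelling the conjugate of c gives
  homogeneity.\<close>

lemma sym_op_BH_I:
  fixes T :: "'h::complex_hilbert op"
  assumes T: "sym_op T" and c: "\<And>c x. (c *\<^sub>C x) \<bullet> T (c *\<^sub>C x) = (cmod c)\<^sup>2 * (x \<bullet> T x)"
  shows "T \<in> BH"
  unfolding BH_def
proof (intro CollectI allI)
  fix c x
  let ?c = "op_scaleC c id_blinfun" and ?d = "op_scaleC (cnj c) (id_blinfun :: 'h op)"
  show "T (c *\<^sub>C x) = c *\<^sub>C T x"
  proof (cases "c = 0")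
    case True
    then show ?thesis using norm_scaleC[of 0 x] norm_scaleC[of 0 "T x"] by (simp add: blinfun.bilinear_simps)
  next
    case False
    have "?d o\<^sub>L T o\<^sub>L ?c = (cmod c)\<^sup>2 *\<^sub>R T"
    proof (rule sym_op_eqI_form)
      show "sym_op (?d o\<^sub>L T o\<^sub>L ?c)"
        using sym_opD[OF T] by (simp add: sym_op_def op_scaleC.rep_eq inner_scaleC_left)
      show "sym_op ((cmod c)\<^sup>2 *\<^sub>R T)" by (rule sym_op_scaleR[OF T])
      show "y \<bullet> (?d o\<^sub>L T o\<^sub>L ?c) y = y \<bullet> ((cmod c)\<^sup>2 *\<^sub>R T) y" for y
        using c[of c y] by (simp add: op_scaleC.rep_eq inner_scaleC_left blinfun.bilinear_simps)
    qed
    then have "cnj c *\<^sub>C T (c *\<^sub>C x) = (cmod c)\<^sup>2 *\<^sub>R T x"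
      by (auto simp: op_scaleC.rep_eq blinfun.bilinear_simps dest: arg_cong[where f = "\<lambda>T. blinfun_apply T x"])
    then have "c *\<^sub>C cnj c *\<^sub>C T (c *\<^sub>C x) = (cmod c)\<^sup>2 *\<^sub>R (c *\<^sub>C T x)"
      by (simp add: scaleC_scaleR_commute)
    then have "(cmod c)\<^sup>2 *\<^sub>R T (c *\<^sub>C x) = (cmod c)\<^sup>2 *\<^sub>R (c *\<^sub>C T x)"
      by (simp only: scaleC_scaleC complex_norm_square[symmetric] scaleC_of_real)
    then show ?thesis using False by simp
  qed
qed

section \<open>Spectral theorem and powers of positive operators\<close>

lemma spec_space_form_le:
  assumes "sym_op A" "0 \<le> l" "x \<in> spec_space A l"
  shows "x \<bullet> A x \<le> l * (x \<bullet> x)"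
  using norm_cauchy_schwarz[of x "A x"] mult_left_mono[OF spec_space_norm_le[OF assms], of "norm x"]
  by (simp add: dot_square_norm power2_eq_square mult_ac)

context
  fixes A :: "'h::complex_hilbert op"
  assumes A: "A \<in> BH" "psd A"
begin

text \<open>A negative left endpoint keeps a possible atom at 0, which comes from the kernel of
  \<open>A\<close>, inside the half-open interval.\<close>

lemma spec_meas_AE: "AE t in spec_meas A x. t \<in> {- 1<..norm A}"
proof (rule AE_I)
  interpret finite_measure "spec_meas A x" by (rule finite_spec_meas[OF A])
  have n: "- 1 \<le> norm A" using norm_ge_zero[of A] by linarith
  have "measure (spec_meas A x) {- 1<..norm A} = (norm x)\<^sup>2"
    using spec_meas_Ioc[OF A n, of x] by (simp add: measure_def spec_distr_top[OF A] spec_distr_neg[OF A])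
  then have "measure (spec_meas A x) (space (spec_meas A x) - {- 1<..norm A}) = 0"
    using finite_measure_compl[of "{- 1<..norm A}"] by (simp add: sets_spec_meas[OF A] space_spec_meas[OF A] measure_spec_meas[OF A])
  then show "emeasure (spec_meas A x) (space (spec_meas A x) - {- 1<..norm A}) = 0"
    by (simp add: emeasure_eq_measure)
qed (auto simp: sets_spec_meas[OF A] space_spec_meas[OF A])

text \<open>On \<open>{s<..t}\<close> the increments of the truncated integral and of the truncated
  form both lie between \<open>s\<close> and \<open>t\<close> times the mass: the first trivially,
  the second by the estimates on and off the spectral subspaces. Hence their difference is at most
  (t - s) times the mass.\<close>

lemma spec_meas_form: "x \<bullet> A x = (\<integral>t. t \<partial>spec_meas A x)"
proof -
  let ?m = "spec_meas A x" and ?R = "spec_family A"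
  note [measurable_cong] = sets_spec_meas[OF A]
  interpret finite_measure ?m by (rule finite_spec_meas[OF A])
  have Rs: "?R l y \<bullet> z = y \<bullet> ?R l z" for l y z
    by (rule sym_opD[OF projection_op_sym[OF spec_family_projection[OF A]]])
  define g where "g C t = indicator C t * t" for C and t :: real
  have gm [measurable]: "g {s<..t} \<in> borel_measurable borel" for s t
    unfolding g_def by measurable
  have gi: "integrable ?m (g {s<..t})" for s t
    by (rule integrable_const_bound[where B = "max \<bar>s\<bar> \<bar>t\<bar>"])
       (auto intro!: AE_I2 simp: g_def indicator_def)
  define h where "h l = (\<integral>t. g {-1<..l} t \<partial>?m) - x \<bullet> A (?R l x)" for l
  have "h (norm A) = h (-1)"
  proof (rule real_eq_of_bounded_increments[where h = h and a = "-1" and b = "norm A" and F = "spec_distr A x"])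
    show "- 1 \<le> norm A" using norm_ge_zero[of A] by linarith
    show "spec_distr A x s \<le> spec_distr A x t" if "- 1 \<le> s" "s \<le> t" for s t by (rule spec_distr_mono[OF A that(2)])
    fix s t :: real assume st: "- 1 \<le> s" "s \<le> t"
    have d: "measure ?m {s<..t} = spec_distr A x t - spec_distr A x s"
      using spec_meas_Ioc[OF A st(2), of x] spec_distr_mono[OF A st(2)] by (simp add: measure_def)
    have int: "(\<integral>u. g {-1<..t} u \<partial>?m) - (\<integral>u. g {-1<..s} u \<partial>?m) = (\<integral>u. g {s<..t} u \<partial>?m)"
    proof -
      have "g {s<..t} = (\<lambda>u. g {-1<..t} u - g {-1<..s} u)" using st by (auto simp: g_def indicator_def fun_eq_iff)
      then show ?thesis using gi by simp
    qed
    have ii: "integrable ?m (indicator {s<..t} :: real \<Rightarrow> real)"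
      by (rule integrable_real_indicator) (simp_all add: sets_spec_meas[OF A] emeasure_eq_measure)
    have ci: "integrable ?m (\<lambda>u. indicator {s<..t} u * c)" "(\<integral>u. indicator {s<..t} u * c \<partial>?m) = c * measure ?m {s<..t}" for c :: real
      using ii by (simp_all add: sets_spec_meas[OF A] mult.commute)
    have "(\<integral>u. indicator {s<..t} u * s \<partial>?m) \<le> (\<integral>u. g {s<..t} u \<partial>?m)"
      by (intro integral_mono ci gi) (auto simp: g_def indicator_def)
    then have lo: "s * measure ?m {s<..t} \<le> (\<integral>u. g {s<..t} u \<partial>?m)" by (simp only: ci)
    have "(\<integral>u. g {s<..t} u \<partial>?m) \<le> (\<integral>u. indicator {s<..t} u * t \<partial>?m)"
      by (intro integral_mono ci gi) (auto simp: g_def indicator_def)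
    then have hi: "(\<integral>u. g {s<..t} u \<partial>?m) \<le> t * measure ?m {s<..t}" by (simp only: ci)
    \<comment> \<open>The component of \<open>x\<close> between the levels \<open>s\<close> and
      \<open>t\<close>; it lies in the spectral subspace for \<open>t\<close> and is orthogonal to
      the one for \<open>s\<close>.\<close>
    define y where "y = ?R t x - ?R s x"
    have yy: "y \<bullet> y = measure ?m {s<..t}"
      using spec_distr_diff[OF A st(2), of x] by (simp add: y_def d power2_norm_eq_inner)
    have Rt: "?R t y = y" and Rs0: "?R s y = 0"
      using spec_family_compose[OF A st(2)] spec_family_compose[OF A order_refl] by (simp_all add: y_def blinfun.diff_right)
    have form: "x \<bullet> A (?R t x) - x \<bullet> A (?R s x) = y \<bullet> A y"
    proof -
      have "y \<bullet> A y = (?R t x - ?R s x) \<bullet> A y" by (simp add: y_def)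
      also have "\<dots> = x \<bullet> A (?R t y - ?R s y)"
        by (simp add: inner_diff_left Rs spec_family_commute[OF A] blinfun.diff_right inner_diff_right)
      also have "\<dots> = x \<bullet> A y" by (simp add: Rt Rs0)
      finally show ?thesis by (simp add: y_def blinfun.diff_right inner_diff_right)
    qed
    have fl: "s * (y \<bullet> y) \<le> y \<bullet> A y"
    proof (cases "s < 0")
      case True
      then have "s * (y \<bullet> y) \<le> 0" by (simp add: mult_nonpos_nonneg)
      then show ?thesis using psd_nonneg[OF A(2), of y] by linarith
    next
      case False
      have "y \<bullet> z = 0" if "z \<in> spec_space A s" for z
      proof -
        have "?R s z = z" using that False by (simp add: spec_family_fixed[OF A])
        then have "y \<bullet> z = ?R s y \<bullet> z" by (simp add: Rs)
        then show ?thesis by (simp add: Rs0)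
      qed
      then show ?thesis using spec_space_complement[OF A(2), of s y] False by (cases "y = 0") auto
    qed
    have fh: "y \<bullet> A y \<le> t * (y \<bullet> y)"
    proof (cases "t < 0")
      case True
      then have "y = 0" using Rt by (simp add: spec_family_def)
      then show ?thesis by simp
    next
      case False
      then show ?thesis using spec_family_fixed[OF A, of t y] Rt by (intro spec_space_form_le psd_sym[OF A(2)]) auto
    qed
    show "\<bar>h t - h s\<bar> \<le> (t - s) * (spec_distr A x t - spec_distr A x s)"
      using lo hi fl fh int form unfolding yy d h_def by (simp add: left_diff_distrib abs_le_iff)
  qed
  also have "h (-1) = 0" by (simp add: h_def g_def spec_family_def)
  finally have "x \<bullet> A x = (\<integral>t. g {-1<..norm A} t \<partial>?m)"
    by (simp add: h_def spec_family_top[OF A])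
  also have "\<dots> = (\<integral>t. t \<partial>?m)"
  proof (rule integral_cong_AE)
    show "AE t in ?m. g {-1<..norm A} t = t"
      using spec_meas_AE[of x] by eventually_elim (simp add: g_def)
  qed (simp_all add: g_def)
  finally show ?thesis .
qed

text \<open>For each set the value of the scalar measure is a quadratic form in the vector, and
  \<open>E\<close> consists of the operators of these forms. What remains is multiplicativity and
  strong additivity.\<close>

theorem spectral_measure_exists: "\<exists>E. is_spectral_measure_of E A"
proof -
  let ?m = "spec_meas A"
  have "\<exists>T :: 'h op. sym_op T \<and> (\<forall>x. x \<bullet> T x = measure (?m x) B)" for B
  proof -
    have "\<bar>measure (?m x) B\<bar> \<le> 1 * (norm x)\<^sup>2" for x
      using finite_measure.bounded_measure[OF finite_spec_meas[OF A], of x B]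
      by (simp add: space_spec_meas[OF A] measure_spec_meas[OF A])
    from quadratic_form_represented[OF spec_meas_parallelogram[OF A, where B = B] this]
    show ?thesis unfolding sym_op_def by metis
  qed
  then obtain E :: "real set \<Rightarrow> 'h op" where Es: "\<And>B. sym_op (E B)"
    and Eform: "\<And>B x. x \<bullet> E B x = measure (?m x) B" by metis
  have E_BH: "E B \<in> BH" for B
    by (rule sym_op_BH_I[OF Es]) (simp add: Eform spec_meas_scaleC[OF A])
  have E_atMost: "E {..a} = spec_family A a" for a
    by (rule sym_op_eqI_form[OF Es projection_op_sym[OF spec_family_projection[OF A]]])
       (simp add: Eform measure_spec_meas[OF A] spec_distr_inner[OF A])
  have E_UNIV: "E UNIV = id_blinfun"
    by (rule sym_op_eqI_form[OF Es sym_op_id]) (simp add: Eform measure_spec_meas[OF A] power2_norm_eq_inner)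
  have E_empty: "E {} = 0" by (rule sym_op_eqI_form[OF Es sym_op_0]) (simp add: Eform)
  have E_signed: "signed_additive (\<lambda>B. x \<bullet> E B y)" for x y
  proof -
    have "x \<bullet> E B y = (1/4) * (measure (?m (x + y)) B - measure (?m (x - y)) B)" for B
      using sym_opD[OF Es, of B x y] unfolding Eform[symmetric]
      by (simp add: blinfun.bilinear_simps inner_simps inner_commute)
    then show ?thesis
      by (simp only:) (intro signed_additive_mult signed_additive_arith signed_additive_spec_meas[OF A])
  qed
  \<comment> \<open>Multiplicativity is extended one factor at a time: on pairs of half-lines it is
    the nesting of the spectral family.\<close>
  have comp_atMost: "x \<bullet> E C (E {..a} y) = x \<bullet> E ({..a} \<inter> C) y" if C: "C \<in> sets borel" for C a x y
  proof -
    let ?f = "\<lambda>C. x \<bullet> E C (E {..a} y) - x \<bullet> E ({..a} \<inter> C) y"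
    have "?f C = 0"
    proof (rule signed_additive_eq_0[where f = ?f, OF _ _ _ C])
      show "signed_additive ?f"
        by (intro signed_additive_arith E_signed signed_additive_Int[where f = "\<lambda>B. x \<bullet> E B y"]) simp
      have "{..a} \<inter> {..b} = {..min a b}" for b by auto
      then show "?f {..b} = 0" for b
        using spec_family_compose[OF A, of a b] spec_family_compose[OF A, of b a]
        by (cases "a \<le> b") (auto simp: E_atMost min_def)
    qed (simp add: E_UNIV)
    then show ?thesis by simp
  qed
  have comp: "x \<bullet> E C (E D y) = x \<bullet> E (C \<inter> D) y" if C: "C \<in> sets borel" and D: "D \<in> sets borel" for C D x y
  proof -
    let ?f = "\<lambda>D. x \<bullet> E C (E D y) - x \<bullet> E (C \<inter> D) y"
    have e: "?f = (\<lambda>D. E C x \<bullet> E D y - x \<bullet> E (C \<inter> D) y)" by (simp add: sym_opD[OF Es])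
    have "?f D = 0"
    proof (rule signed_additive_eq_0[where f = ?f, OF _ _ _ D])
      show "signed_additive ?f" unfolding e
        by (intro signed_additive_arith E_signed signed_additive_Int[where f = "\<lambda>B. x \<bullet> E B y"] C)
      show "?f {..b} = 0" for b by (simp add: comp_atMost[OF C] Int_commute)
    qed (simp add: E_UNIV)
    then show ?thesis by simp
  qed
  have E_idem: "E B (E C x) = E (B \<inter> C) x" if "B \<in> sets borel" "C \<in> sets borel" for B C x
    by (rule inner_eqI) (subst (1 2) inner_commute, rule comp[OF that])
  have E_proj: "projection_op (E B)" if "B \<in> sets borel" for B
    using E_idem[OF that that] by (auto simp: projection_op_iff E_BH Es intro!: blinfun_eqI)
  have pvm: "projection_valued_measure E" unfolding projection_valued_measure_def
  proof (intro conjI ballI allI impI)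
    fix F :: "nat \<Rightarrow> real set" and x
    assume F: "range F \<subseteq> sets borel \<and> disjoint_family F"
    let ?U = "\<Union>n. F n"
    have Fb: "F n \<in> sets borel" and Ub: "?U \<in> sets borel" for n using F by auto
    \<comment> \<open>Orthogonality of the summands converts strong convergence into convergence of
      the scalar series.\<close>
    have dist: "(norm ((\<Sum>n<N. E (F n) x) - E ?U x))\<^sup>2 = x \<bullet> E ?U x - (\<Sum>n<N. x \<bullet> E (F n) x)" for N
    proof -
      have FF: "E (F n) x \<bullet> E (F m) x = (if n = m then x \<bullet> E (F n) x else 0)" for n m
      proof -
        have "E (F n) x \<bullet> E (F m) x = x \<bullet> E (F n \<inter> F m) x" by (simp add: sym_opD[OF Es] E_idem[OF Fb Fb])
        then show ?thesis using F by (auto simp: disjoint_family_on_def E_empty)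
      qed
      have UF: "E (F n) x \<bullet> E ?U x = x \<bullet> E (F n) x" for n
      proof -
        have "F n \<inter> ?U = F n" by blast
        then show ?thesis by (simp add: sym_opD[OF Es] E_idem[OF Fb Ub])
      qed
      have UU: "E ?U x \<bullet> E ?U x = x \<bullet> E ?U x" by (simp add: sym_opD[OF Es] E_idem[OF Ub Ub])
      let ?S = "\<Sum>n<N. E (F n) x" and ?s = "\<Sum>n<N. x \<bullet> E (F n) x"
      have "?S \<bullet> ?S = ?s" by (simp add: inner_sum_left inner_sum_right FF)
      moreover have "?S \<bullet> E ?U x = ?s" by (simp add: inner_sum_left UF)
      ultimately show ?thesis using UU
        by (simp add: power2_norm_eq_inner inner_diff_left inner_diff_right inner_commute)
    qed
    have "(\<lambda>n. x \<bullet> E (F n) x) sums (x \<bullet> E ?U x)"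
      using E_signed[of x x] F unfolding signed_additive_def by blast
    then have "(\<lambda>N. x \<bullet> E ?U x - (\<Sum>n<N. x \<bullet> E (F n) x)) \<longlonglongrightarrow> x \<bullet> E ?U x - x \<bullet> E ?U x"
      unfolding sums_def by (intro tendsto_intros)
    then have "(\<lambda>N. (norm ((\<Sum>n<N. E (F n) x) - E ?U x))\<^sup>2) \<longlonglongrightarrow> 0" by (simp add: dist)
    then have "(\<lambda>N. sqrt ((norm ((\<Sum>n<N. E (F n) x) - E ?U x))\<^sup>2)) \<longlonglongrightarrow> sqrt 0" by (rule tendsto_real_sqrt)
    then have "(\<lambda>N. norm ((\<Sum>n<N. E (F n) x) - E ?U x)) \<longlonglongrightarrow> 0" by simp
    then show "(\<lambda>n. E (F n) x) sums E ?U x" unfolding sums_def by (subst LIM_zero_iff[symmetric]) (rule tendsto_norm_zero_cancel)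
  qed (simp_all add: E_proj E_UNIV)
  have meas: "scalar_measure E x = ?m x" for x
  proof (rule measure_eqI)
    fix B assume "B \<in> sets (scalar_measure E x)"
    then show "emeasure (scalar_measure E x) B = emeasure (?m x) B"
      by (simp add: sets_scalar_measure[OF pvm] emeasure_scalar_measure[OF pvm] Eform
          finite_measure.emeasure_eq_measure[OF finite_spec_meas[OF A]])
  qed (simp add: sets_scalar_measure[OF pvm] sets_spec_meas[OF A])
  have supp: "E {-(norm A + 1)..norm A + 1} = id_blinfun"
  proof (rule sym_op_eqI_form[OF Es sym_op_id])
    fix x
    interpret finite_measure "?m x" by (rule finite_spec_meas[OF A])
    have "measure (?m x) {-(norm A + 1)..norm A + 1} = measure (?m x) UNIV"
    proof (rule finite_measure_eq_AE)
      show "AE t in ?m x. t \<in> {-(norm A + 1)..norm A + 1} \<longleftrightarrow> t \<in> UNIV"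
        using spec_meas_AE[of x] by eventually_elim (use norm_ge_zero[of A] in \<open>auto simp del: norm_ge_zero\<close>)
    qed (simp_all add: sets_spec_meas[OF A])
    then show "x \<bullet> E {-(norm A + 1)..norm A + 1} x = x \<bullet> id_blinfun x"
      by (simp add: Eform measure_spec_meas[OF A] power2_norm_eq_inner)
  qed
  have "is_spectral_measure_of E A"
    unfolding is_spectral_measure_of_def
    using pvm exI[of "\<lambda>K. E {-K..K} = id_blinfun", OF supp] by (auto simp: BH_cinner_self[OF A(1) psd_sym[OF A(2)]] meas spec_meas_form)
  then show ?thesis by blast
qed

lemma spectral_measure_spec: "is_spectral_measure_of (spectral_measure A) A"
  unfolding spectral_measure_def by (rule someI_ex[OF spectral_measure_exists])

lemma spectral_measure_greaterThan:
  "0 \<le> s \<Longrightarrow> spectral_measure A {s<..} = id_blinfun - orth_proj (spec_space A s)"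
  by (rule spec_greaterThan[OF spectral_measure_spec A])

end

section \<open>Functional calculus and powers\<close>

text \<open>Carries the parallelogram identity from measures to integrals; the factors 2 enter
  through scaled measures.\<close>

lemma nn_integral_measure_add_eq:
  assumes sets [measurable_cong]: "sets a = sets borel" "sets b = sets borel" "sets c = sets borel" "sets d = sets borel"
    and eq: "\<And>B. B \<in> sets borel \<Longrightarrow> emeasure a B + emeasure b B = emeasure c B + emeasure d B"
    and f: "f \<in> borel_measurable (borel :: 'a::topological_space measure)"
  shows "(\<integral>\<^sup>+ t. f t \<partial>a) + (\<integral>\<^sup>+ t. f t \<partial>b) = (\<integral>\<^sup>+ t. f t \<partial>c) + (\<integral>\<^sup>+ t. f t \<partial>d)"
  using f
proof (induction f rule: borel_measurable_induct)
  case (cong f g)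
  then have "f = g" by (auto simp: fun_eq_iff)
  then show ?case using cong by simp
next
  case (set B)
  then show ?case using eq sets by simp
next
  case (mult u r)
  then have [measurable]: "u \<in> borel_measurable borel" by simp
  show ?case using mult.IH by (simp add: nn_integral_cmult distrib_left[symmetric])
next
  case (add u v)
  then have [measurable]: "u \<in> borel_measurable borel" "v \<in> borel_measurable borel" by simp_all
  have "p' + p + (q' + q) = r' + r + (s' + s)" if "p + q = r + s" "p' + q' = r' + s'" for p q r s p' q' r' s' :: ennreal
  proof -
    have "p' + p + (q' + q) = (p' + q') + (p + q)" "r' + r + (s' + s) = (r' + s') + (r + s)" by (simp_all add: ac_simps)
    then show ?thesis using that by simp
  qed
  from this[OF add.IH] show ?case by (simp add: nn_integral_add)
next
  case (seq U)
  have [measurable]: "U i \<in> borel_measurable borel" for i by (rule seq(1))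
  have inc: "incseq (\<lambda>i. \<integral>\<^sup>+ t. U i t \<partial>m)" for m
    using \<open>incseq U\<close> by (auto simp: incseq_def le_fun_def intro!: nn_integral_mono)
  have sup: "(\<integral>\<^sup>+ t. (SUP i. U i) t \<partial>m) = (SUP i. \<integral>\<^sup>+ t. U i t \<partial>m)" if [measurable_cong]: "sets m = sets borel" for m
    using \<open>incseq U\<close> by (simp add: nn_integral_monotone_convergence_SUP SUP_apply image_comp)
  show ?case
    unfolding sup[OF sets(1)] sup[OF sets(2)] sup[OF sets(3)] sup[OF sets(4)]
      ennreal_SUP_add[OF inc inc, symmetric] seq.IH ..
qed

text \<open>The integral of \<open>g\<close> against the scalar measures is a bounded quadratic
  form, and pushing \<open>E\<close> forward along \<open>g\<close> gives a spectral measure of its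
  operator. Boundedness is required only on a set \<open>C\<close> that carries
  \<open>E\<close>.\<close>

lemma pvm_fun_calculus:
  fixes E :: "real set \<Rightarrow> 'h::complex_hilbert op"
  assumes E: "projection_valued_measure E"
    and g [measurable]: "g \<in> borel_measurable borel" and g0: "\<And>t. 0 \<le> g t"
    and C: "C \<in> sets borel" "E C = id_blinfun" and gK: "\<And>t. t \<in> C \<Longrightarrow> g t \<le> K"
  obtains T where "T \<in> BH" "psd T"
    "\<And>x. cinner x (blinfun_apply T x) = complex_of_real (\<integral>t. g t \<partial>scalar_measure E x)"
    "is_spectral_measure_of (\<lambda>B. E (g -` B)) T"
proof -
  note [measurable_cong] = sets_scalar_measure[OF E]
  let ?Q = "\<lambda>x. \<integral>t. g t \<partial>scalar_measure E x"
  let ?N = "\<lambda>x. \<integral>\<^sup>+t. ennreal (g t) \<partial>scalar_measure E x"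
  have ae: "AE t in scalar_measure E x. t \<in> C" for x
    by (rule AE_scalar_measure[OF E C(1)]) (simp add: C(2))
  have mU: "measure (scalar_measure E x) UNIV = (norm x)\<^sup>2" for x
    by (simp add: measure_scalar_measure[OF E] pvm_UNIV[OF E] power2_norm_eq_inner)
  have gi: "integrable (scalar_measure E x) g" for x
  proof -
    interpret finite_measure "scalar_measure E x" by (rule finite_measure_scalar_measure[OF E])
    have "AE t in scalar_measure E x. norm (g t) \<le> K" using ae[of x] by eventually_elim (simp add: g0 gK)
    then show ?thesis by (rule integrable_const_bound) simp
  qed
  have QN: "?N x = ennreal (?Q x)" for x by (rule nn_integral_eq_integral[OF gi]) (simp add: g0)
  have Q0: "0 \<le> ?Q x" for x by (rule integral_nonneg_AE) (simp add: g0)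
  have par: "?Q (x + y) + ?Q (x - y) = 2 * ?Q x + 2 * ?Q y" for x y
  proof -
    let ?d = "\<lambda>x. scale_measure 2 (scalar_measure E x)"
    have "?N (x + y) + ?N (x - y) = (\<integral>\<^sup>+t. ennreal (g t) \<partial>?d x) + (\<integral>\<^sup>+t. ennreal (g t) \<partial>?d y)"
      by (rule nn_integral_measure_add_eq)
         (simp_all add: sets_scalar_measure[OF E] scalar_measure_parallelogram[OF E])
    also have "\<dots> = 2 * ?N x + 2 * ?N y" by (simp add: nn_integral_scale_measure)
    finally have "ennreal (?Q (x + y) + ?Q (x - y)) = ennreal (2 * ?Q x + 2 * ?Q y)"
      unfolding QN using Q0 by (simp add: ennreal_plus ennreal_mult)
    then show ?thesis
      by (subst (asm) ennreal_inj) (intro add_nonneg_nonneg mult_nonneg_nonneg Q0 order_refl zero_le_numeral)+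
  qed
  have bd: "\<bar>?Q x\<bar> \<le> K * (norm x)\<^sup>2" for x
  proof -
    interpret finite_measure "scalar_measure E x" by (rule finite_measure_scalar_measure[OF E])
    have "?Q x \<le> (\<integral>t. K \<partial>scalar_measure E x)"
      by (rule integral_mono_AE[OF gi]) (use ae[of x] in \<open>simp, eventually_elim, simp add: gK\<close>)
    then show ?thesis using Q0[of x] by (simp add: space_scalar_measure[OF E] mU mult.commute)
  qed
  obtain T :: "'h op" where T: "\<And>x y. T x \<bullet> y = x \<bullet> T y" "\<And>x. x \<bullet> T x = ?Q x"
    using quadratic_form_represented[OF par bd] by metis
  have Ts: "sym_op T" using T(1) by (simp add: sym_op_def)
  have scale: "?Q (c *\<^sub>C x) = (cmod c)\<^sup>2 * ?Q x" for c x
  proof -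
    have "scalar_measure E (c *\<^sub>C x) = scale_measure (ennreal ((cmod c)\<^sup>2)) (scalar_measure E x)"
      by (rule measure_eqI) (simp_all add: sets_scalar_measure[OF E] scalar_measure_scaleC[OF E])
    then have "?N (c *\<^sub>C x) = ennreal ((cmod c)\<^sup>2) * ?N x" by (simp add: nn_integral_scale_measure)
    then have "ennreal (?Q (c *\<^sub>C x)) = ennreal ((cmod c)\<^sup>2 * ?Q x)" unfolding QN using Q0 by (simp add: ennreal_mult)
    then show ?thesis using Q0 by simp
  qed
  have TB: "T \<in> BH" by (rule sym_op_BH_I[OF Ts]) (simp add: T(2) scale)
  have Tc: "cinner x (T x) = complex_of_real (?Q x)" for x by (simp add: BH_cinner_self[OF TB Ts] T(2))
  have Tp: "psd T" by (simp add: psd_def Ts T(2) Q0)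
  let ?E = "\<lambda>B. E (g -` B)"
  have pre: "g -` B \<in> sets borel" if "B \<in> sets borel" for B
    using measurable_sets[OF g that] by simp
  have pvm: "projection_valued_measure ?E"
    unfolding projection_valued_measure_def
  proof (intro conjI ballI allI impI)
    show "projection_op (?E B)" if "B \<in> sets borel" for B by (rule pvm_projection[OF E pre[OF that]])
    fix F :: "nat \<Rightarrow> real set" and x assume F: "range F \<subseteq> sets borel \<and> disjoint_family F"
    have "range (\<lambda>n. g -` F n) \<subseteq> sets borel" using F pre by auto
    moreover have "disjoint_family (\<lambda>n. g -` F n)" using F unfolding disjoint_family_on_def by blast
    ultimately have "(\<lambda>n. E (g -` F n) x) sums E (\<Union>n. g -` F n) x" by (rule pvm_sums[OF E])
    then show "(\<lambda>n. ?E (F n) x) sums ?E (\<Union>n. F n) x" by (simp add: vimage_UN)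
  qed (simp add: pvm_UNIV[OF E])
  have "scalar_measure ?E x = distr (scalar_measure E x) borel g" for x
  proof (rule measure_eqI)
    fix B assume "B \<in> sets (scalar_measure ?E x)"
    then have B: "B \<in> sets borel" by (simp add: sets_scalar_measure[OF pvm])
    show "emeasure (scalar_measure ?E x) B = emeasure (distr (scalar_measure E x) borel g) B"
      using B pre[OF B] by (simp add: emeasure_scalar_measure[OF pvm] emeasure_distr emeasure_scalar_measure[OF E] space_scalar_measure[OF E])
  qed (simp add: sets_scalar_measure[OF pvm])
  then have int: "(\<integral>t. t \<partial>scalar_measure ?E x) = ?Q x" for x
    by (simp add: integral_distr)
  have supp: "?E {- max K 0..max K 0} = id_blinfun"
  proof (rule blinfun_eqI)
    fix x
    let ?D = "g -` {- max K 0..max K 0}"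
    have D: "?D \<in> sets borel" by (rule pre) simp
    have "C \<subseteq> ?D"
    proof
      fix t assume "t \<in> C"
      then show "t \<in> ?D" using gK[of t] g0[of t] by auto
    qed
    then have "?D \<inter> C = C" by blast
    then show "E ?D x = id_blinfun x" using pvm_Int[OF E D C(1), of x] by (simp add: C(2))
  qed
  have "is_spectral_measure_of ?E T"
    unfolding is_spectral_measure_of_def using pvm supp Tc by (auto simp: int)
  then show thesis using that TB Tp Tc by blast
qed

lemma op_powr_greaterThan:
  fixes A :: "'h::complex_hilbert op"
  assumes A: "A \<in> BH" "psd A" and p: "0 < p" and s: "0 \<le> s"
  shows "spectral_measure (op_powr A p) {s<..} = spectral_measure A {s powr (1 / p)<..}"
proof -
  let ?E = "spectral_measure A"
  note spec = spectral_measure_spec[OF A]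
  have E: "projection_valued_measure ?E" by (rule spec_pvm[OF spec A])
  obtain K where K: "?E {-K..K} = id_blinfun" using spec by (auto simp: is_spectral_measure_of_def)
  have E0: "?E {0..} = id_blinfun"
    using pvm_Compl[OF E, of "{..<0}"] spec_lessThan_0[OF spec A] A by (simp add: Compl_lessThan)
  have C: "?E ({0..} \<inter> {-K..K}) = id_blinfun"
    by (rule blinfun_eqI) (subst pvm_Int[OF E], simp_all add: E0 K)
  let ?g = "\<lambda>t::real. t powr p"
  obtain T where T: "T \<in> BH" "psd T"
    "\<And>x. cinner x (blinfun_apply T x) = complex_of_real (\<integral>t. ?g t \<partial>scalar_measure ?E x)"
    "is_spectral_measure_of (\<lambda>B. ?E (?g -` B)) T"
  proof (rule pvm_fun_calculus[OF E _ _ _ C])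
    show "?g \<in> borel_measurable borel" by simp
    show "?g t \<le> K powr p" if "t \<in> {0..} \<inter> {-K..K}" for t using that p by (auto intro: powr_mono2)
  qed auto
  have eq: "op_powr A p = T"
    unfolding op_powr_def fun_calculus_def
    by (rule the_equality) (use T in \<open>auto intro: BH_eqI_form\<close>)
  have "spectral_measure T {s<..} = ?E (?g -` {s<..})"
    using spectral_measure_greaterThan[OF T(1,2) s] spec_greaterThan[OF T(4,1,2) s] by simp
  also have "\<dots> = ?E {s powr (1 / p)<..}"
  proof (rule blinfun_eqI)
    fix x
    have m: "?g -` {s<..} \<in> sets borel"
      using measurable_sets[of ?g borel borel "{s<..}"] by simp
    have "t powr p > s \<longleftrightarrow> t > s powr (1 / p)" if t: "0 \<le> t" for t
    proof -
      have "(s powr (1 / p)) powr p = s" using s p by (simp add: powr_powr)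
      then show ?thesis using t p powr_less_mono2[of p t "s powr (1/p)"] powr_less_mono2[of p "s powr (1/p)" t]
        by (metis linorder_neqE_linordered_idom powr_ge_zero order_less_asym)
    qed
    \<comment> \<open>The two sets agree only on the nonnegative half-line, but this half-line
      carries the whole spectral measure.\<close>
    then have "{0..} \<inter> ?g -` {s<..} = {0..} \<inter> {s powr (1 / p)<..}" by auto
    then show "?E (?g -` {s<..}) x = ?E {s powr (1 / p)<..} x"
      using pvm_Int[OF E _ m, of "{0..}" x] pvm_Int[OF E, of "{0..}" "{s powr (1 / p)<..}" x] by (simp add: E0)
  qed
  finally show ?thesis unfolding eq .
qed

section \<open>Supports and meets of projections under a trace\<close>

text \<open>Powers as operators rather than as iterated functions, because the trace has to be
  applied to them.\<close>

primrec op_pow :: "('a::real_normed_vector \<Rightarrow>\<^sub>L 'a) \<Rightarrow> nat \<Rightarrow> 'a \<Rightarrow>\<^sub>L 'a" where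
  "op_pow A 0 = id_blinfun"
| "op_pow A (Suc n) = A o\<^sub>L op_pow A n"

lemma op_pow_commute: "A (op_pow A n x) = op_pow A n (A x)"
  by (induction n arbitrary: x) simp_all

lemma op_pow_add: "op_pow A (m + n) x = op_pow A m (op_pow A n x)"
  by (induction m) simp_all

lemma sym_op_pow: "sym_op A \<Longrightarrow> sym_op (op_pow A n)"
proof (induction n)
  case (Suc n)
  then have "op_pow A (Suc n) x \<bullet> y = x \<bullet> op_pow A (Suc n) y" for x y
    using sym_opD[of A] sym_opD[of "op_pow A n"] by (simp add: op_pow_commute)
  then show ?case by (simp add: sym_op_def)
qed simp

lemma norm_op_pow_le:
  assumes "norm C \<le> 1"
  shows "norm (op_pow C (Suc n) x) \<le> norm (op_pow C n x)" and "norm (op_pow C n x) \<le> norm x"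
proof -
  have c: "norm (C y) \<le> norm y" for y
    using norm_blinfun[of C y] mult_right_mono[OF assms, of "norm y"] by simp
  show "norm (op_pow C (Suc n) x) \<le> norm (op_pow C n x)" by (simp add: c)
  show "norm (op_pow C n x) \<le> norm x" by (induction n) (auto intro: order_trans[OF c])
qed

lemma psd_contraction_norm_square_le:
  fixes A :: "'a::{real_inner,complete_space} \<Rightarrow>\<^sub>L 'a"
  assumes A: "psd A" "\<And>x. x \<bullet> A x \<le> (norm x)\<^sup>2"
  shows "(norm (A x))\<^sup>2 \<le> x \<bullet> A x"
proof -
  obtain B where B: "psd B" "B o\<^sub>L B = A" using psd_sqrt_exists[OF A(1)] by metis
  have sq: "(norm (B y))\<^sup>2 = y \<bullet> A y" for y
    using sym_opD[OF psd_sym[OF B(1)]] B(2) by (auto simp: power2_norm_eq_inner)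
  have "(norm (A x))\<^sup>2 = (norm (B (B x)))\<^sup>2" using B(2) by auto
  also have "\<dots> \<le> (norm (B x))\<^sup>2" unfolding sq[of "B x"] by (rule A(2))
  finally show ?thesis by (simp add: sq)
qed

lemma id_minus_psd_norm_le:
  fixes A :: "'a::real_inner \<Rightarrow>\<^sub>L 'a"
  assumes A: "psd A" "\<And>x. x \<bullet> A x \<le> (norm x)\<^sup>2"
  shows "norm (id_blinfun - A) \<le> 1"
proof (rule sym_op_norm_le)
  show "sym_op (id_blinfun - A)" by (intro sym_op_arith psd_sym[OF A(1)] sym_op_id)
qed (use psd_nonneg[OF A(1)] A(2) in \<open>auto simp: blinfun.bilinear_simps inner_simps power2_norm_eq_inner\<close>)

lemma subspace_closure:
  fixes S :: "'a::real_normed_vector set"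
  assumes S: "subspace S"
  shows "subspace (closure S)"
proof (rule subspaceI)
  show "0 \<in> closure S" using subspace_0[OF S] closure_subset by blast
  fix x assume "x \<in> closure S"
  then obtain u where u: "\<And>n. u n \<in> S" "u \<longlonglongrightarrow> x" unfolding closure_sequential by blast
  have "r *\<^sub>R u n \<in> S" for r n by (rule subspace_scale[OF S u(1)])
  then show "r *\<^sub>R x \<in> closure S" for r
    unfolding closure_sequential using u(2) by (intro exI[of _ "\<lambda>n. r *\<^sub>R u n"]) (simp add: tendsto_intros)
  fix y assume "y \<in> closure S"
  then obtain v where v: "\<And>n. v n \<in> S" "v \<longlonglongrightarrow> y" unfolding closure_sequential by blast
  have "u n + v n \<in> S" for n by (rule subspace_add[OF S u(1) v(1)])
  then show "x + y \<in> closure S"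
    unfolding closure_sequential using u(2) v(2) by (intro exI[of _ "\<lambda>n. u n + v n"]) (simp add: tendsto_intros)
qed

lemma subspace_kernel: "closed {x. blinfun_apply A x = 0}" "subspace {x. blinfun_apply A x = 0}"
  by (auto intro!: closed_Collect_eq linear_continuous_on blinfun.bounded_linear_right continuous_on_const
      simp: subspace_def blinfun.bilinear_simps)

lemma orth_kernel_closure_range:
  fixes A :: "'a::{real_inner,complete_space} \<Rightarrow>\<^sub>L 'a"
  assumes A: "sym_op A" and x: "\<And>z. A z = 0 \<Longrightarrow> x \<bullet> z = 0"
  shows "x \<in> closure (range (blinfun_apply A))"
proof -
  let ?S = "closure (range (blinfun_apply A))"
  have "subspace (range (blinfun_apply A))"
    by (rule linear_subspace_image[OF bounded_linear.linear[OF blinfun.bounded_linear_right] subspace_UNIV])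
  then have S: "closed ?S" "subspace ?S" by (auto intro: subspace_closure)
  let ?y = "x - orth_proj ?S x"
  have "?y \<bullet> A u = 0" for u by (rule orth_proj_orth[OF S]) (rule subsetD[OF closure_subset rangeI])
  then have "A ?y \<bullet> u = 0 \<bullet> u" for u by (simp add: sym_opD[OF A])
  then have "A ?y = 0" by (rule inner_eqI)
  then have "x \<bullet> ?y = 0" by (rule x)
  moreover have "?y \<bullet> orth_proj ?S x = 0" by (rule orth_proj_orth[OF S orth_proj_mem[OF S]])
  ultimately have "?y \<bullet> ?y = 0" by (simp add: inner_diff_left inner_diff_right inner_commute)
  then show ?thesis using orth_proj_mem[OF S, of x] by simp
qed

text \<open>The quantity \<open>\<parallel>C\<^sup>n y\<parallel>\<^sup>2\<close> is decreasing and its decrements dominate \<open>\<parallel>A C\<^sup>n y\<parallel>\<^sup>2\<close>, which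
  therefore tends to \<open>0\<close>.\<close>
lemma op_pow_tendsto_kernel_proj:
  fixes A :: "'a::{real_inner,complete_space} \<Rightarrow>\<^sub>L 'a"
  assumes A: "psd A" "\<And>x. x \<bullet> A x \<le> (norm x)\<^sup>2"
  shows "(\<lambda>n. op_pow (id_blinfun - A) n x) \<longlonglongrightarrow> orth_proj {x. A x = 0} x"
proof -
  define C where "C = id_blinfun - A"
  let ?K = "{x. A x = 0}"
  note K = subspace_kernel[of A]
  have nC: "norm C \<le> 1" unfolding C_def by (rule id_minus_psd_norm_le[OF A])
  have C: "C x = x - A x" for x by (simp add: C_def blinfun.bilinear_simps)
  have CA: "op_pow C n (A y) = A (op_pow C n y)" for n y
    by (induction n) (simp_all add: C blinfun.bilinear_simps)
  have ran: "(\<lambda>n. op_pow C n (A y)) \<longlonglongrightarrow> 0" for y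
  proof -
    let ?a = "\<lambda>n. (norm (op_pow C n y))\<^sup>2"
    have "decseq ?a" by (rule decseq_SucI) (intro power_mono norm_op_pow_le[OF nC] norm_ge_zero)
    then have "convergent ?a" using decseq_convergent[of ?a 0] by (metis convergentI zero_le_power2)
    then obtain L where L: "?a \<longlonglongrightarrow> L" by (auto simp: convergent_def)
    have "(\<lambda>n. ?a n - ?a (Suc n)) \<longlonglongrightarrow> L - L" by (intro tendsto_diff L LIMSEQ_Suc)
    then have lim: "(\<lambda>n. ?a n - ?a (Suc n)) \<longlonglongrightarrow> 0" by simp
    have dec: "(norm (op_pow C n (A y)))\<^sup>2 \<le> ?a n - ?a (Suc n)" for n
    proof -
      let ?z = "op_pow C n y"
      have "(norm (?z - A ?z))\<^sup>2 = (norm ?z)\<^sup>2 - 2 * (?z \<bullet> A ?z) + (norm (A ?z))\<^sup>2"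
        by (simp add: power2_norm_eq_inner inner_diff_left inner_diff_right inner_commute)
      then show ?thesis using psd_contraction_norm_square_le[OF A, of ?z] by (simp add: CA C)
    qed
    have "(\<lambda>n. (norm (op_pow C n (A y)))\<^sup>2) \<longlonglongrightarrow> 0"
      by (rule tendsto_sandwich[OF _ _ tendsto_const lim]) (simp_all only: dec zero_le_power2 eventually_True)
    then have "(\<lambda>n. sqrt ((norm (op_pow C n (A y)))\<^sup>2)) \<longlonglongrightarrow> sqrt 0" by (rule tendsto_real_sqrt)
    then show ?thesis by (simp add: tendsto_norm_zero_iff)
  qed
  have orth: "(\<lambda>n. op_pow C n u) \<longlonglongrightarrow> 0" if u: "\<And>z. A z = 0 \<Longrightarrow> u \<bullet> z = 0" for u
  proof (rule LIMSEQ_I)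
    fix e :: real assume e: "0 < e"
    \<comment> \<open>Convergence to 0 is known on the range of \<open>A\<close>; it passes to the
      closure because all powers of \<open>C\<close> are contractions.\<close>
    have "u \<in> closure (range (blinfun_apply A))" by (rule orth_kernel_closure_range[OF psd_sym[OF A(1)] u])
    then obtain y where y: "dist (A y) u < e / 2" using e unfolding closure_approachable by (metis half_gt_zero rangeE)
    obtain N where N: "\<And>n. n \<ge> N \<Longrightarrow> norm (op_pow C n (A y)) < e / 2" using LIMSEQ_D[OF ran[of y], of "e/2"] e by auto
    have "norm (op_pow C n u) < e" if "n \<ge> N" for n
    proof -
      have "op_pow C n u = op_pow C n (A y) - op_pow C n (A y - u)" by (simp add: blinfun.diff_right)
      then have "norm (op_pow C n u) \<le> norm (op_pow C n (A y)) + norm (op_pow C n (A y - u))"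
        by (metis norm_triangle_ineq4)
      also have "norm (op_pow C n (A y - u)) \<le> norm (A y - u)" by (rule norm_op_pow_le[OF nC])
      finally show ?thesis using N[OF that] y by (simp add: dist_norm)
    qed
    then show "\<exists>N. \<forall>n\<ge>N. norm (op_pow C n u - 0) < e" by auto
  qed
  let ?P = "orth_proj ?K"
  have "op_pow C n (?P x) = ?P x" for n
  proof (induction n)
    case (Suc n)
    have "A (?P x) = 0" using orth_proj_mem[OF K, of x] by simp
    then show ?case using Suc by (simp add: C)
  qed simp
  then have "op_pow C n x = ?P x + op_pow C n (x - ?P x)" for n by (simp add: blinfun.diff_right)
  moreover have "(\<lambda>n. ?P x + op_pow C n (x - ?P x)) \<longlonglongrightarrow> ?P x + 0"
    by (intro tendsto_add tendsto_const orth orth_proj_orth[OF K]) simp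
  ultimately show ?thesis by (simp add: C_def)
qed

section \<open>Trace identities for supports and meets\<close>

context
  fixes M :: "'h::complex_hilbert op set" and \<tau> :: "'h op \<Rightarrow> complex"
  assumes vN: "von_neumann_algebra M"
    and tau: "faithful_normal_finite_trace M \<tau>" and tau_id: "\<tau> id_blinfun = 1"
begin

lemma trace_add: "A \<in> M \<Longrightarrow> B \<in> M \<Longrightarrow> \<tau> (A + B) = \<tau> A + \<tau> B"
  and trace_commute: "A \<in> M \<Longrightarrow> B \<in> M \<Longrightarrow> \<tau> (A o\<^sub>L B) = \<tau> (B o\<^sub>L A)"
  using tau by (auto simp: faithful_normal_finite_trace_def positive_functional_on_def)

lemma trace_nonneg: "A \<in> M \<Longrightarrow> psd A \<Longrightarrow> 0 \<le> Re (\<tau> A)"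
  using tau vn_BH[OF vN]
  by (auto simp: faithful_normal_finite_trace_def positive_functional_on_def positive_op_iff complex_nonneg_Reals_iff)

lemma trace_diff:
  assumes "A \<in> M" "B \<in> M"
  shows "\<tau> (A - B) = \<tau> A - \<tau> B"
  using trace_add[OF vn_diff[OF vN assms] assms(2)] by simp

lemma trace_mono:
  assumes "A \<in> M" "B \<in> M" "psd (B - A)"
  shows "Re (\<tau> A) \<le> Re (\<tau> B)"
  using trace_nonneg[OF vn_diff[OF vN assms(2,1)] assms(3)] by (simp add: trace_diff assms)

lemma trace_normal:
  assumes "D \<subseteq> {A \<in> M. positive_op A}" "directed_ops D" "is_lub_in M D S"
  shows "Re (\<tau> S) = (SUP A\<in>D. Re (\<tau> A))"
  using tau assms by (simp add: faithful_normal_finite_trace_def)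

lemma trace_projection_bounds:
  assumes "P \<in> M" "projection_op P"
  shows "0 \<le> Re (\<tau> P)" "Re (\<tau> P) \<le> 1"
proof -
  show "0 \<le> Re (\<tau> P)" by (rule trace_nonneg[OF assms(1) projection_op_psd[OF assms(2)]])
  have "Re (\<tau> P) \<le> Re (\<tau> id_blinfun)"
    by (intro trace_mono assms vn_id[OF vN] projection_op_psd projection_op_diff_id)
  then show "Re (\<tau> P) \<le> 1" by (simp add: tau_id)
qed

lemma vn_op_pow: "A \<in> M \<Longrightarrow> op_pow A n \<in> M"
  by (induction n) (auto intro: vn_id[OF vN] vn_compose[OF vN])

lemma vn_kernel_proj:
  assumes A: "A \<in> M"
  shows "orth_proj {x. A x = 0} \<in> M" and "projection_op (orth_proj {x. A x = 0})"
proof -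
  have inv: "A (T x) = 0" if "T \<in> commutant M" "A x = 0" for T x
    using commutant_commute[OF that(1) A] that(2) by (metis blinfun.zero_right blinfun_apply_blinfun_compose)
  show "orth_proj {x. A x = 0} \<in> M" "projection_op (orth_proj {x. A x = 0})"
    using vn_orth_proj[OF vN subspace_kernel[of A]] inv by auto
qed

text \<open>Even powers of the symmetric contraction C = 1 - A have the form of the squared norm of
  the image under \<open>op_pow C n\<close>. So 1 minus these powers increases, with supremum the
  support of \<open>A\<close>, and normality applies.\<close>

lemma trace_support:
  assumes A: "A \<in> M" "psd A" "\<And>x. x \<bullet> A x \<le> (norm x)\<^sup>2"
  shows "Re (\<tau> (id_blinfun - orth_proj {x. A x = 0}))
    = (SUP n. Re (\<tau> (id_blinfun - op_pow (id_blinfun - A) (n + n))))"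
proof -
  define C where "C = id_blinfun - A"
  define Y where "Y n = id_blinfun - op_pow C (n + n)" for n
  let ?P = "orth_proj {x. A x = 0}"
  note K = subspace_kernel[of A]
  have CM: "C \<in> M" unfolding C_def by (intro vn_diff[OF vN] vn_id[OF vN] A)
  have Cs: "sym_op C" unfolding C_def by (intro sym_op_arith sym_op_id psd_sym[OF A(2)])
  have nC: "norm C \<le> 1" unfolding C_def by (rule id_minus_psd_norm_le[OF A(2,3)])
  have YM: "Y n \<in> M" for n unfolding Y_def by (intro vn_diff[OF vN] vn_id[OF vN] vn_op_pow CM)
  have Ys: "sym_op (Y n)" for n unfolding Y_def by (intro sym_op_arith sym_op_id sym_op_pow Cs)
  have Yform: "x \<bullet> Y n x = (norm x)\<^sup>2 - (norm (op_pow C n x))\<^sup>2" for n x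
    by (simp add: Y_def blinfun.bilinear_simps inner_diff_right op_pow_add power2_norm_eq_inner sym_opD[OF sym_op_pow[OF Cs]])
  have Ypsd: "psd (Y n)" for n
    using Ys norm_op_pow_le(2)[OF nC] by (simp add: psd_def Yform power_mono)
  have Ymono: "psd (Y n - Y m)" if "m \<le> n" for m n
  proof -
    have "decseq (\<lambda>n. norm (op_pow C n x))" for x by (rule decseq_SucI) (rule norm_op_pow_le[OF nC])
    then have "norm (op_pow C n x) \<le> norm (op_pow C m x)" for x using that by (auto simp: decseq_def)
    then show ?thesis
      using sym_op_arith(2)[OF Ys Ys] by (auto simp: psd_def blinfun.bilinear_simps inner_diff_right Yform power_mono)
  qed
  have PM: "?P \<in> M" "projection_op ?P" by (rule vn_kernel_proj[OF A(1)])+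
  let ?S = "id_blinfun - ?P"
  have SM: "?S \<in> M" by (intro vn_diff[OF vN] vn_id[OF vN] PM)
  have Sp: "projection_op ?S" by (rule projection_op_diff_id[OF PM(2)])
  have Sform: "x \<bullet> ?S x = (norm x)\<^sup>2 - (norm (?P x))\<^sup>2" for x
    by (simp add: blinfun.bilinear_simps inner_diff_right projection_op_inner[OF PM(2)] power2_norm_eq_inner)
  have lim: "(\<lambda>n. op_pow C n x) \<longlonglongrightarrow> ?P x" for x
    unfolding C_def by (rule op_pow_tendsto_kernel_proj[OF A(2,3)])
  have "Re (\<tau> ?S) = (SUP B\<in>range Y. Re (\<tau> B))"
  proof (rule trace_normal)
    show "range Y \<subseteq> {A \<in> M. positive_op A}"
      using YM Ypsd vn_BH[OF vN] by (auto simp: positive_op_iff)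
    show "directed_ops (range Y)"
      unfolding directed_ops_def
    proof (intro conjI ballI)
      fix B B' assume "B \<in> range Y" "B' \<in> range Y"
      then obtain m n where "B = Y m" "B' = Y n" by blast
      then have "op_le B (Y (max m n))" "op_le B' (Y (max m n))"
        using vn_BH[OF vN vn_diff[OF vN YM YM]] by (auto simp: op_le_def positive_op_iff intro!: Ymono)
      then show "\<exists>D\<in>range Y. op_le B D \<and> op_le B' D" by blast
    qed simp
    show "is_lub_in M (range Y) ?S"
      unfolding is_lub_in_def
    proof (intro conjI ballI impI)
      show "selfadjoint_op ?S" using projection_op_sym[OF Sp] projection_op_BH[OF Sp] by (simp add: selfadjoint_op_iff)
      fix B assume "B \<in> range Y"
      then obtain n where B: "B = Y n" by blast
      have "norm (?P x) \<le> norm (op_pow C n x)" for x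
      proof -
        have "decseq (\<lambda>n. norm (op_pow C n x))" by (rule decseq_SucI) (rule norm_op_pow_le[OF nC])
        then show ?thesis by (rule decseq_ge[OF _ tendsto_norm[OF lim]])
      qed
      then show "op_le B ?S"
        unfolding op_le_def positive_op_iff B
        using vn_BH[OF vN vn_diff[OF vN SM YM]] sym_op_arith(2)[OF projection_op_sym[OF Sp] Ys]
        by (simp add: psd_def blinfun.diff_left[of ?S] inner_diff_right[of _ "?S _"] Sform Yform power_mono)
    next
      fix B assume BM: "B \<in> M" and B: "selfadjoint_op B \<and> (\<forall>A\<in>range Y. op_le A B)"
      have Bs: "sym_op B" using B by (simp add: selfadjoint_op_iff)
      have "x \<bullet> ?S x \<le> x \<bullet> B x" for x
      proof -
        have "(norm x)\<^sup>2 - (norm (op_pow C n x))\<^sup>2 \<le> x \<bullet> B x" for n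
        proof -
          have "psd (B - Y n)" using B by (simp add: op_le_def positive_op_iff)
          then show ?thesis using psd_nonneg[of "B - Y n" x] by (simp add: blinfun.diff_left inner_diff_right Yform)
        qed
        moreover have "(\<lambda>n. (norm x)\<^sup>2 - (norm (op_pow C n x))\<^sup>2) \<longlonglongrightarrow> (norm x)\<^sup>2 - (norm (?P x))\<^sup>2"
          by (intro tendsto_intros lim)
        ultimately show ?thesis unfolding Sform by (intro LIMSEQ_le_const2) auto
      qed
      then show "op_le ?S B"
        unfolding op_le_def positive_op_iff
        using vn_BH[OF vN vn_diff[OF vN BM SM]] sym_op_arith(2)[OF Bs projection_op_sym[OF Sp]]
        by (simp add: psd_def blinfun.diff_left[of B] inner_diff_right[of _ "B _"])
    qed (rule SM)
  qed
  also have "\<dots> = (SUP n. Re (\<tau> (Y n)))" by (simp add: image_comp)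
  finally show ?thesis by (simp add: Y_def C_def)
qed

text \<open>The traces of all powers of \<open>T\<^sup>* T\<close> and \<open>T T\<^sup>*\<close> agree, and both supports are limits of polynomials.\<close>
lemma trace_support_adj:
  assumes T: "T \<in> M" "norm T \<le> 1"
  shows "Re (\<tau> (id_blinfun - orth_proj {x. T x = 0})) = Re (\<tau> (id_blinfun - orth_proj {x. adj T x = 0}))"
proof -
  let ?A = "adj T o\<^sub>L T" and ?A' = "T o\<^sub>L adj T"
  let ?C = "id_blinfun - ?A" and ?C' = "id_blinfun - ?A'"
  have TB: "T \<in> BH" and TaM: "adj T \<in> M" using vn_BH[OF vN T(1)] vn_adj[OF vN T(1)] .
  have AM: "?A \<in> M" "?A' \<in> M" by (intro vn_compose[OF vN] T TaM)+
  have form: "x \<bullet> ?A x = (norm (T x))\<^sup>2" "x \<bullet> ?A' x = (norm (adj T x))\<^sup>2" for x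
    by (simp_all add: adj_inner_right[OF TB] adj_inner[OF TB, symmetric] power2_norm_eq_inner)
  have nT: "norm (T x) \<le> norm x" for x
    using norm_blinfun[of T x] mult_right_mono[OF T(2), of "norm x"] by simp
  have nTa: "norm (adj T x) \<le> norm x" for x
  proof (cases "adj T x = 0")
    case False
    have "(norm (adj T x))\<^sup>2 = x \<bullet> T (adj T x)" by (simp add: power2_norm_eq_inner adj_inner[OF TB])
    also have "\<dots> \<le> norm x * norm (T (adj T x))" by (rule norm_cauchy_schwarz)
    also have "\<dots> \<le> norm x * norm (adj T x)" by (intro mult_left_mono nT) simp
    finally show ?thesis using False by (simp add: power2_eq_square)
  qed simp
  have psd: "psd ?A" "psd ?A'"
    using psd_adj_compose[OF TB] psd_adj_compose[OF adj_BH[OF TB]] adj_adj[OF TB] by simp_all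
  have le: "x \<bullet> ?A x \<le> (norm x)\<^sup>2" "x \<bullet> ?A' x \<le> (norm x)\<^sup>2" for x
    unfolding form by (intro power_mono nT nTa norm_ge_zero)+
  have CM: "op_pow ?C k \<in> M" "op_pow ?C' k \<in> M" for k by (intro vn_op_pow vn_diff[OF vN] vn_id[OF vN] AM)+
  have TC: "T (op_pow ?C k x) = op_pow ?C' k (T x)" for k x
    by (induction k) (simp_all add: blinfun.bilinear_simps)
  have tr: "\<tau> (op_pow ?C k) = \<tau> (op_pow ?C' k)" for k
  proof (induction k)
    case (Suc k)
    \<comment> \<open>Peeling off one factor leaves a term in which cyclicity moves the adjoint to
      the other end.\<close>
    have "op_pow ?C (Suc k) = op_pow ?C k - (adj T o\<^sub>L (T o\<^sub>L op_pow ?C k))"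
      by (rule blinfun_eqI) (simp add: blinfun.bilinear_simps)
    then have "\<tau> (op_pow ?C (Suc k)) = \<tau> (op_pow ?C k) - \<tau> (adj T o\<^sub>L (T o\<^sub>L op_pow ?C k))"
      using trace_diff[OF CM(1) vn_compose[OF vN TaM vn_compose[OF vN T(1) CM(1)]]] by simp
    also have "\<tau> (adj T o\<^sub>L (T o\<^sub>L op_pow ?C k)) = \<tau> ((T o\<^sub>L op_pow ?C k) o\<^sub>L adj T)"
      by (intro trace_commute vn_compose[OF vN] T TaM CM)
    also have "(T o\<^sub>L op_pow ?C k) o\<^sub>L adj T = op_pow ?C' k o\<^sub>L ?A'"
      by (rule blinfun_eqI) (simp add: TC)
    also have "\<tau> (op_pow ?C k) - \<tau> (op_pow ?C' k o\<^sub>L ?A') = \<tau> (op_pow ?C' k - (op_pow ?C' k o\<^sub>L ?A'))"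
      unfolding Suc by (rule trace_diff[symmetric]) (intro CM vn_compose[OF vN] AM)+
    also have "op_pow ?C' k - (op_pow ?C' k o\<^sub>L ?A') = op_pow ?C' (Suc k)"
      by (rule blinfun_eqI) (simp only: op_pow.simps blinfun_apply_blinfun_compose op_pow_commute, simp add: blinfun.bilinear_simps)
    finally show ?case .
  qed simp
  have "{x. ?A x = 0} = {x. T x = 0}"
    using form(1) by (auto simp del: blinfun_apply_blinfun_compose) (metis inner_zero_right norm_eq_zero power_eq_0_iff, simp)
  moreover have "{x. ?A' x = 0} = {x. adj T x = 0}"
    using form(2) by (auto simp del: blinfun_apply_blinfun_compose) (metis inner_zero_right norm_eq_zero power_eq_0_iff, simp)
  moreover have "Re (\<tau> (id_blinfun - op_pow ?C k)) = Re (\<tau> (id_blinfun - op_pow ?C' k))" for k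
    using tr by (simp add: trace_diff vn_id[OF vN] CM)
  ultimately show ?thesis
    using trace_support[OF AM(1) psd(1) le(1)] trace_support[OF AM(2) psd(2) le(2)] by simp
qed

text \<open>The operator T = (1 - F)E has initial support E - G, while its final support lies below
  1 - F. Equality of the traces of both supports gives the inequality.\<close>

lemma trace_proj_Int:
  assumes E: "E \<in> M" "projection_op E" and F: "F \<in> M" "projection_op F"
  defines "G \<equiv> orth_proj ({x. E x = x} \<inter> {x. F x = x})"
  shows "G \<in> M" "projection_op G" "Re (\<tau> E) + Re (\<tau> F) \<le> 1 + Re (\<tau> G)"
proof -
  let ?S = "{x. E x = x} \<inter> {x. F x = x}"
  have "{x. B x = x} = {x. (B - id_blinfun) x = 0}" for B :: "'h op" by (simp add: blinfun.bilinear_simps)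
  then have S: "closed ?S" "subspace ?S"
    using subspace_kernel by (auto intro!: closed_Int subspace_inter)
  have inv: "B (T x) = T x" if "T \<in> commutant M" "B \<in> M" "B x = x" for T x B
    using commutant_commute[OF that(1,2)] that(3) by (metis blinfun_apply_blinfun_compose)
  show G: "G \<in> M" "projection_op G"
    using vn_orth_proj[OF vN S] inv E(1) F(1) by (auto simp: G_def)
  define T where "T = (id_blinfun - F) o\<^sub>L E"
  have TM: "T \<in> M" unfolding T_def by (intro vn_compose[OF vN] vn_diff[OF vN] vn_id[OF vN] E F)
  have T: "T x = E x - F (E x)" for x by (simp add: T_def blinfun.bilinear_simps)
  have Es: "E x \<bullet> y = x \<bullet> E y" and Fs: "F x \<bullet> y = x \<bullet> F y" for x y
    using E(2) F(2) by (simp_all add: projection_op_sym sym_opD)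
  have EE: "E (E x) = E x" and FF: "F (F x) = F x" for x
    using E(2) F(2) by (simp_all add: projection_op_idem_apply)
  have "norm T \<le> 1"
  proof (rule norm_blinfun_bound)
    fix x
    have "T x = (id_blinfun - F) (E x)" by (simp add: T_def)
    then show "norm (T x) \<le> 1 * norm x"
      using projection_op_inner(3)[OF projection_op_diff_id[OF F(2)], of "E x"] projection_op_inner(3)[OF E(2), of x] by simp
  qed simp
  note main = trace_support_adj[OF TM this]
  have GE: "E (G x) = G x" "F (G x) = G x" for x using orth_proj_mem[OF S, of x] by (auto simp: G_def)
  \<comment> \<open>The kernel of T is the orthogonal sum of the kernel of E and the meet of the two
    ranges.\<close>
  have "orth_proj {x. T x = 0} = id_blinfun - E + G"
  proof (rule blinfun_eqI)
    fix x
    have "orth_proj {x. T x = 0} x = x - E x + G x"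
    proof (rule orth_proj_eqI[OF subspace_kernel])
      show "x - E x + G x \<in> {x. T x = 0}" by (simp add: T blinfun.bilinear_simps EE GE)
      fix z assume "z \<in> {x. T x = 0}"
      then have "E z \<in> ?S" by (simp add: T EE)
      then have "(x - G x) \<bullet> E z = 0" unfolding G_def by (rule orth_proj_orth[OF S])
      then have "E (x - G x) \<bullet> z = 0" by (simp add: Es)
      then show "(x - (x - E x + G x)) \<bullet> z = 0" by (simp add: blinfun.bilinear_simps GE)
    qed
    then show "orth_proj {x. T x = 0} x = (id_blinfun - E + G) x" by (simp add: blinfun.bilinear_simps)
  qed
  then have "id_blinfun - orth_proj {x. T x = 0} = E - G" by simp
  then have l: "Re (\<tau> (id_blinfun - orth_proj {x. T x = 0})) = Re (\<tau> E) - Re (\<tau> G)"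
    by (simp add: trace_diff E G)
  let ?P = "orth_proj {x. adj T x = 0}"
  have P: "?P \<in> M" "projection_op ?P" by (rule vn_kernel_proj[OF vn_adj[OF vN TM]])+
  have "adj T = E o\<^sub>L (id_blinfun - F)"
    by (rule adj_eqI[OF vn_BH[OF vN TM]]) (simp add: T blinfun.bilinear_simps Es Fs inner_diff_left inner_diff_right)
  then have "adj T (F x) = 0" for x by (simp add: blinfun.bilinear_simps FF)
  then have PF: "?P (F x) = F x" for x by (subst orth_proj_fixed_iff[OF subspace_kernel]) simp
  \<comment> \<open>The adjoint E(1 - F) annihilates the range of F, so F lies below the kernel
    projection of the adjoint.\<close>
  have "psd (?P - F)" unfolding psd_def
  proof (intro conjI allI)
    show "sym_op (?P - F)" by (intro sym_op_arith projection_op_sym P F)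
    fix x
    have "norm (F (?P x)) \<le> norm (?P x)" by (rule projection_op_inner(3)[OF F(2)])
    moreover have "F (?P x) = F x"
      by (rule inner_eqI) (simp add: Fs sym_opD[OF projection_op_sym[OF P(2)]] PF)
    ultimately show "0 \<le> x \<bullet> (?P - F) x"
      by (simp add: blinfun.bilinear_simps inner_diff_right projection_op_inner(1)[OF P(2)] projection_op_inner(1)[OF F(2)] power_mono)
  qed
  then have "Re (\<tau> F) \<le> Re (\<tau> ?P)" by (intro trace_mono P F)
  then show "Re (\<tau> E) + Re (\<tau> F) \<le> 1 + Re (\<tau> G)"
    using main l by (simp add: trace_diff vn_id[OF vN] P tau_id)
qed

end

section \<open>Projections of prescribed trace in a II_1 factor\<close>

lemma orth_proj_norm_le: "closed S \<Longrightarrow> subspace S \<Longrightarrow> norm (orth_proj S x) \<le> norm x"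
  using sym_idem_inner(3)[of "orth_proj S" x] orth_proj_sym[of S] orth_proj_idem[of S]
  by (simp add: sym_op_def blinfun_eq_iff)

lemma orth_proj_inner: "closed S \<Longrightarrow> subspace S \<Longrightarrow> x \<bullet> orth_proj S x = (norm (orth_proj S x))\<^sup>2"
  using sym_idem_inner(1)[of "orth_proj S" x] orth_proj_sym[of S] orth_proj_idem[of S]
  by (simp add: sym_op_def blinfun_eq_iff)

lemma orth_proj_nested:
  assumes "closed S" "subspace S" "closed U" "subspace U" "S \<subseteq> U"
  shows "orth_proj S (orth_proj U x) = orth_proj S x"
proof (rule orth_proj_eqI[OF assms(1,2)])
  show "orth_proj S x \<in> S" by (rule orth_proj_mem[OF assms(1,2)])
  fix z assume z: "z \<in> S"
  have "(x - orth_proj S x) \<bullet> z = 0" "(x - orth_proj U x) \<bullet> z = 0"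
    using orth_proj_orth[OF assms(1,2) z] orth_proj_orth[OF assms(3,4)] z assms(5) by auto
  then show "(orth_proj U x - orth_proj S x) \<bullet> z = 0" by (simp add: inner_diff_left)
qed

lemma orth_proj_mono:
  assumes "closed S" "subspace S" "closed U" "subspace U" "S \<subseteq> U"
  shows "psd (orth_proj U - orth_proj S)"
  unfolding psd_def
proof (intro conjI allI)
  show "sym_op (orth_proj U - orth_proj S)"
    by (intro sym_op_arith) (simp_all add: sym_op_def orth_proj_sym assms)
  fix x
  have "norm (orth_proj S x) \<le> norm (orth_proj U x)"
    using orth_proj_norm_le[OF assms(1,2), of "orth_proj U x"] by (simp add: orth_proj_nested assms)
  then show "0 \<le> x \<bullet> (orth_proj U - orth_proj S) x"
    by (simp add: blinfun.diff_left inner_diff_right orth_proj_inner assms power_mono)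
qed

lemma orth_proj_nearest:
  assumes S: "closed S" "subspace S" and z: "z \<in> S"
  shows "norm (x - orth_proj S x) \<le> norm (x - z)"
proof -
  have "(x - orth_proj S x) \<bullet> (orth_proj S x - z) = 0"
    using orth_proj_orth[OF S subspace_diff[OF S(2) orth_proj_mem[OF S] z]] .
  then have "(norm ((x - orth_proj S x) + (orth_proj S x - z)))\<^sup>2 = (norm (x - orth_proj S x))\<^sup>2 + (norm (orth_proj S x - z))\<^sup>2"
    by (simp only: power2_norm_eq_inner inner_add_left inner_add_right inner_commute[of "orth_proj S x - z" "x - orth_proj S x"])
  then have "(norm (x - orth_proj S x))\<^sup>2 \<le> (norm (x - z))\<^sup>2" by simp
  then show ?thesis by simp
qed

context
  fixes M :: "'h::complex_hilbert op set"
  assumes M: "factor_type_II1 M"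
begin

lemma II1_vN: "von_neumann_algebra M"
  using M by (simp add: factor_type_II1_def factor_def)

text \<open>A minimal projection \<open>P\<close> would satisfy \<open>P M P = \<complex> P\<close>, hence be abelian.\<close>
lemma II1_no_minimal_projection:
  assumes P: "P \<in> M" "projection_op P" "P \<noteq> 0"
  shows "\<exists>Q\<in>M. projection_op Q \<and> P o\<^sub>L Q = Q \<and> Q \<noteq> 0 \<and> Q \<noteq> P"
proof (rule ccontr)
  assume no: "\<not> ?thesis"
  have min: "Q = 0 \<or> Q = P" if "Q \<in> M" "projection_op Q" "P o\<^sub>L Q = Q" for Q
    using no that by blast
  note vN = II1_vN
  have Ps: "P x \<bullet> y = x \<bullet> P y" and PP: "P (P x) = P x" for x y
    using P(2) by (simp_all add: sym_opD[OF projection_op_sym] projection_op_idem_apply)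
  have pos: "\<exists>c. P o\<^sub>L A o\<^sub>L P = c *\<^sub>R P" if A: "A \<in> M" "psd A" for A
  proof -
    define B where "B = P o\<^sub>L A o\<^sub>L P"
    have BM: "B \<in> M" unfolding B_def by (intro vn_compose[OF vN] P A)
    have Bs: "sym_op B" using sym_opD[OF psd_sym[OF A(2)]] by (simp add: B_def sym_op_def Ps)
    have Bp: "psd B"
    proof -
      have "x \<bullet> B x = P x \<bullet> A (P x)" for x by (simp add: B_def Ps)
      then show ?thesis using Bs psd_nonneg[OF A(2)] by (simp add: psd_def)
    qed
    have PB: "P o\<^sub>L B = B o\<^sub>L P" by (rule blinfun_eqI) (simp add: B_def PP)
    \<comment> \<open>Each spectral projection of \<open>B\<close> cuts down to a subprojection of
      \<open>P\<close>; by minimality this is \<open>0\<close> or \<open>P\<close>.\<close>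
    have alt: "(\<forall>x. P x = x \<longrightarrow> x \<in> spec_space B l) \<or> (\<forall>x. P x = x \<longrightarrow> (\<forall>z\<in>spec_space B l. x \<bullet> z = 0))"
      if l: "0 \<le> l" for l
    proof -
      note S = closed_spec_space[OF Bs l] subspace_spec_space[of B l]
      let ?R = "orth_proj (spec_space B l)"
      have RM: "?R \<in> M" and Rp: "projection_op ?R" by (rule vn_spec_proj[OF vN BM Bs l])+
      have com: "?R (P x) = P (?R x)" for x
        by (rule orth_proj_commute[OF S Ps]) (rule spec_space_commute[OF PB]; assumption)+
      have RR: "?R (?R x) = ?R x" for x by (rule orth_proj_idem[OF S])
      have "?R o\<^sub>L P = 0 \<or> ?R o\<^sub>L P = P"
      proof (rule min)
        show "?R o\<^sub>L P \<in> M" by (intro vn_compose[OF vN] RM P)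
        then show "projection_op (?R o\<^sub>L P)"
          using vn_BH[OF vN] by (simp add: projection_op_iff sym_op_def orth_proj_sym[OF S] Ps com blinfun_eq_iff RR PP)
        show "P o\<^sub>L (?R o\<^sub>L P) = ?R o\<^sub>L P" by (rule blinfun_eqI) (simp add: com PP)
      qed
      then show ?thesis
      proof
        assume "?R o\<^sub>L P = 0"
        then have "?R (P x) = 0" for x by (metis blinfun.zero_left blinfun_apply_blinfun_compose)
        then have "\<forall>x. P x = x \<longrightarrow> (\<forall>z\<in>spec_space B l. x \<bullet> z = 0)" using orth_proj_eq_0_iff[OF S] by metis
        then show ?thesis by blast
      next
        assume "?R o\<^sub>L P = P"
        then have "?R (P x) = P x" for x by (metis blinfun_apply_blinfun_compose)
        then have "\<forall>x. P x = x \<longrightarrow> x \<in> spec_space B l" using orth_proj_fixed_iff[OF S] by metis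
        then show ?thesis by blast
      qed
    qed
    define L where "L = {l. 0 \<le> l \<and> (\<forall>x. P x = x \<longrightarrow> x \<in> spec_space B l)}"
    have "norm (B x) \<le> norm B * norm x" for x by (rule norm_blinfun)
    then have "norm B \<in> L" unfolding L_def
      using invariant_subset_spec_space[of _ UNIV B "norm B"] by auto
    then have L0: "L \<noteq> {}" by blast
    have bdd: "bdd_below L" by (rule bdd_belowI[of _ 0]) (simp add: L_def)
    \<comment> \<open>The threshold at which the spectral projection jumps from \<open>0\<close> to
      \<open>P\<close> is the only possible value of the form on unit vectors of the range.\<close>
    define c where "c = Inf L"
    have c0: "0 \<le> c" unfolding c_def by (rule cInf_greatest[OF L0]) (simp add: L_def)
    have form: "x \<bullet> B x = c * (x \<bullet> x)" if x: "P x = x" for x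
    proof (cases "x = 0")
      case False
      then have xx: "0 < x \<bullet> x" by simp
      define q where "q = (x \<bullet> B x) / (x \<bullet> x)"
      have q: "x \<bullet> B x = q * (x \<bullet> x)" using xx by (simp add: q_def)
      have "q \<le> c" unfolding c_def
      proof (rule cInf_greatest[OF L0])
        fix l assume "l \<in> L"
        then have "x \<bullet> B x \<le> l * (x \<bullet> x)" using x by (intro spec_space_form_le Bs) (auto simp: L_def)
        then show "q \<le> l" using xx by (simp add: q)
      qed
      moreover have "c \<le> q"
      proof (rule ccontr)
        assume "\<not> c \<le> q"
        define l where "l = max 0 ((q + c) / 2)"
        have "0 \<le> q" using psd_nonneg[OF Bp, of x] xx by (simp add: q_def)
        with \<open>\<not> c \<le> q\<close> have l: "q < l" "l < c" "0 \<le> l" by (auto simp: l_def)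
        then have "l \<notin> L" using cInf_lower[OF _ bdd] unfolding c_def by force
        then have "\<forall>z\<in>spec_space B l. x \<bullet> z = 0" using alt[OF l(3)] x l(3) by (auto simp: L_def)
        then have "l * (x \<bullet> x) < x \<bullet> B x" by (intro spec_space_complement[OF Bp l(3) _ False]) blast
        then show False using l xx by (simp add: q)
      qed
      ultimately show ?thesis using q by simp
    qed simp
    have "B = c *\<^sub>R P"
    proof (rule sym_op_eqI_form[OF Bs sym_op_scaleR[OF projection_op_sym[OF P(2)]]])
      fix x
      have "x \<bullet> B x = P x \<bullet> B (P x)" by (simp add: B_def Ps PP)
      also have "\<dots> = c * (P x \<bullet> P x)" by (rule form[OF PP])
      finally show "x \<bullet> B x = x \<bullet> (c *\<^sub>R P) x" by (simp add: blinfun.scaleR_left Ps PP)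
    qed
    then show ?thesis unfolding B_def by blast
  qed
  have sym: "\<exists>c. \<forall>x. P (A (P x)) = c *\<^sub>R P x" if A: "A \<in> M" "sym_op A" for A
  proof -
    \<comment> \<open>The shift makes a symmetric operator positive and only changes the
      scalar.\<close>
    let ?B = "A + norm A *\<^sub>R id_blinfun"
    have "psd ?B" unfolding psd_def
    proof (intro conjI allI)
      show "sym_op ?B" by (intro sym_op_arith A sym_op_scaleR sym_op_id)
      fix x
      have "- (x \<bullet> A x) \<le> norm x * norm (A x)" using norm_cauchy_schwarz[of "- x" "A x"] by simp
      also have "\<dots> \<le> norm x * (norm A * norm x)" by (intro mult_left_mono norm_blinfun norm_ge_zero)
      finally show "0 \<le> x \<bullet> ?B x"
        by (simp add: blinfun.bilinear_simps inner_simps dot_square_norm power2_eq_square mult_ac)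
    qed
    moreover have "?B \<in> M" by (intro vn_add[OF vN] vn_scaleR[OF vN] vn_id[OF vN] A)
    ultimately obtain c where c: "P o\<^sub>L ?B o\<^sub>L P = c *\<^sub>R P" using pos by blast
    have "P (A (P x)) = (c - norm A) *\<^sub>R P x" for x
      using arg_cong[OF c, of "\<lambda>T. blinfun_apply T x"] by (simp add: blinfun.bilinear_simps PP algebra_simps)
    then show ?thesis by blast
  qed
  have all: "\<exists>z. \<forall>x. P (A (P x)) = z *\<^sub>C P x" if A: "A \<in> M" for A
  proof -
    have AB: "A \<in> BH" by (rule vn_BH[OF vN A])
    have PB: "P \<in> BH" by (rule vn_BH[OF vN P(1)])
    \<comment> \<open>Both operators are selfadjoint and A = (H - iK)/2, whence the scalar
      \<open>Complex (a/2) (- b/2)\<close> below.\<close>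
    let ?H = "A + adj A" and ?K = "op_scaleC \<i> (A - adj A)"
    have HM: "?H \<in> M" "?K \<in> M"
      by (intro vn_add[OF vN] vn_op_scaleC[OF vN] vn_diff[OF vN] vn_adj[OF vN] A)+
    have "sym_op ?H" by (simp add: sym_op_def blinfun.bilinear_simps inner_simps adj_inner[OF AB] adj_inner_right[OF AB])
    moreover have "sym_op ?K"
      unfolding sym_op_def
    proof (intro allI)
      fix x y
      have "?K x \<bullet> y = (A x - adj A x) \<bullet> ((- \<i>) *\<^sub>C y)"
        by (simp add: op_scaleC.rep_eq blinfun.diff_left inner_scaleC_left)
      also have "\<dots> = x \<bullet> adj A ((- \<i>) *\<^sub>C y) - x \<bullet> A ((- \<i>) *\<^sub>C y)"
        by (simp only: inner_diff_left adj_inner[OF AB] adj_inner_right[OF AB])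
      also have "\<dots> = x \<bullet> ?K y"
        unfolding BH_scaleC[OF AB] BH_scaleC[OF adj_BH[OF AB]]
        by (simp add: op_scaleC.rep_eq blinfun.diff_left scaleC_minus_left scaleC_diff_right inner_diff_right)
      finally show "?K x \<bullet> y = x \<bullet> ?K y" .
    qed
    ultimately obtain a b where a: "\<And>x. P (?H (P x)) = a *\<^sub>R P x" and b: "\<And>x. P (?K (P x)) = b *\<^sub>R P x"
      using sym[OF HM(1)] sym[OF HM(2)] by blast
    have "P (A (P x)) = Complex (a/2) (- b/2) *\<^sub>C P x" for x
    proof -
      have "P (A (P x)) + P (adj A (P x)) = complex_of_real a *\<^sub>C P x"
        using a[of x] by (simp add: blinfun.bilinear_simps scaleC_of_real)
      moreover have "\<i> *\<^sub>C (P (A (P x)) - P (adj A (P x))) = complex_of_real b *\<^sub>C P x"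
        using b[of x] by (simp add: op_scaleC.rep_eq BH_scaleC[OF PB] blinfun.bilinear_simps scaleC_of_real)
      then have "(- \<i>) *\<^sub>C \<i> *\<^sub>C (P (A (P x)) - P (adj A (P x))) = (- \<i> * complex_of_real b) *\<^sub>C P x"
        by (simp add: scaleC_scaleC)
      then have "P (A (P x)) - P (adj A (P x)) = (- \<i> * complex_of_real b) *\<^sub>C P x"
        by (simp add: scaleC_scaleC)
      ultimately have "P (A (P x)) + P (A (P x)) = (complex_of_real a + - \<i> * complex_of_real b) *\<^sub>C P x"
        unfolding scaleC_add_left by (metis (no_types, lifting) add_diff_cancel_left' add.assoc add_diff_eq diff_add_cancel add.commute)
      then have "2 *\<^sub>R P (A (P x)) = (complex_of_real a + - \<i> * complex_of_real b) *\<^sub>C P x" by (simp add: scaleR_2)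
      then have "(1/2) *\<^sub>R (2 *\<^sub>R P (A (P x))) = complex_of_real (1/2) *\<^sub>C (complex_of_real a + - \<i> * complex_of_real b) *\<^sub>C P x"
        by (simp only: scaleC_of_real)
      moreover have "complex_of_real (1/2) * (complex_of_real a + - \<i> * complex_of_real b) = Complex (a/2) (- b/2)"
        by (simp add: complex_eq_iff)
      ultimately show ?thesis by (simp only: scaleC_scaleC) simp
    qed
    then show ?thesis by blast
  qed
  have "abelian_proj M P" unfolding abelian_proj_def
  proof (intro conjI ballI)
    fix A B assume AB: "A \<in> M" "B \<in> M"
    obtain z w where z: "\<And>x. P (A (P x)) = z *\<^sub>C P x" and w: "\<And>x. P (B (P x)) = w *\<^sub>C P x"
      using all AB by metis
    show "(P o\<^sub>L A o\<^sub>L P) o\<^sub>L (P o\<^sub>L B o\<^sub>L P) = (P o\<^sub>L B o\<^sub>L P) o\<^sub>L (P o\<^sub>L A o\<^sub>L P)"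
      by (rule blinfun_eqI)
         (simp add: z w BH_scaleC[OF projection_op_BH[OF P(2)]] BH_scaleC[OF vn_BH[OF vN AB(1)]]
           BH_scaleC[OF vn_BH[OF vN AB(2)]] PP scaleC_scaleC mult.commute)
  qed (use P in auto)
  then show False using M P(3) by (simp add: factor_type_II1_def)
qed

section \<open>Exhaustion by projections of small trace\<close>

context
  fixes \<tau> :: "'h op \<Rightarrow> complex"
  assumes tau: "faithful_normal_finite_trace M \<tau>" and tau_id: "\<tau> id_blinfun = 1"
begin

lemma subprojection_compl:
  assumes P: "P \<in> M" "projection_op P" and Q: "Q \<in> M" "projection_op Q" "P o\<^sub>L Q = Q"
  shows "P - Q \<in> M" "projection_op (P - Q)" "P o\<^sub>L (P - Q) = P - Q" "Q o\<^sub>L P = Q" "Q o\<^sub>L (P - Q) = 0"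
proof -
  show m: "P - Q \<in> M" by (rule vn_diff[OF II1_vN P(1) Q(1)])
  have PQ: "P (Q x) = Q x" for x using Q(3) by (metis blinfun_apply_blinfun_compose)
  have s: "P x \<bullet> y = x \<bullet> P y" "Q x \<bullet> y = x \<bullet> Q y" for x y
    using P(2) Q(2) by (simp_all add: sym_opD[OF projection_op_sym])
  have QP: "Q (P x) = Q x" for x by (rule inner_eqI) (simp add: s PQ)
  show "projection_op (P - Q)"
    using vn_BH[OF II1_vN m] by (simp add: projection_op_iff sym_op_def blinfun_eq_iff blinfun.bilinear_simps
        inner_simps s PQ QP projection_op_idem_apply[OF P(2)] projection_op_idem_apply[OF Q(2)])
  show "P o\<^sub>L (P - Q) = P - Q" "Q o\<^sub>L P = Q" "Q o\<^sub>L (P - Q) = 0"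
    by (simp_all add: blinfun_eq_iff blinfun.bilinear_simps PQ QP projection_op_idem_apply[OF P(2)]
        projection_op_idem_apply[OF Q(2)])
qed

text \<open>A nonminimal projection splits into two nonzero parts, one of which has at most half the
  trace; this is iterated.\<close>

lemma small_subprojection:
  assumes P: "P \<in> M" "projection_op P" "P \<noteq> 0" and e: "0 < e"
  obtains Q where "Q \<in> M" "projection_op Q" "P o\<^sub>L Q = Q" "Q \<noteq> 0" "Re (\<tau> Q) \<le> e"
proof -
  have half: "\<exists>Q'\<in>M. projection_op Q' \<and> Q o\<^sub>L Q' = Q' \<and> Q' \<noteq> 0 \<and> Re (\<tau> Q') \<le> Re (\<tau> Q) / 2"
    if Q: "Q \<in> M" "projection_op Q" "Q \<noteq> 0" for Q
  proof -
    obtain R where R: "R \<in> M" "projection_op R" "Q o\<^sub>L R = R" "R \<noteq> 0" "R \<noteq> Q"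
      using II1_no_minimal_projection[OF Q] by blast
    note c = subprojection_compl[OF Q(1,2) R(1-3)]
    have "Re (\<tau> (Q - R)) = Re (\<tau> Q) - Re (\<tau> R)" by (simp add: trace_diff[OF II1_vN tau tau_id] Q R)
    then consider "Re (\<tau> R) \<le> Re (\<tau> Q) / 2" | "Re (\<tau> (Q - R)) \<le> Re (\<tau> Q) / 2" by linarith
    then show ?thesis
    proof cases
      case 1 then show ?thesis using R by blast
    next
      case 2 then show ?thesis using c R(5) by (metis eq_iff_diff_eq_0)
    qed
  qed
  have iter: "\<exists>Q\<in>M. projection_op Q \<and> P o\<^sub>L Q = Q \<and> Q \<noteq> 0 \<and> Re (\<tau> Q) \<le> (1/2) ^ n" for n
  proof (induction n)
    case 0
    show ?case
      using P trace_projection_bounds[OF II1_vN tau tau_id P(1,2)] by (intro bexI[of _ P]) (auto simp: projection_op_idem)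
  next
    case (Suc n)
    then obtain Q where Q: "Q \<in> M" "projection_op Q" "P o\<^sub>L Q = Q" "Q \<noteq> 0" "Re (\<tau> Q) \<le> (1/2) ^ n" by blast
    obtain Q' where Q': "Q' \<in> M" "projection_op Q'" "Q o\<^sub>L Q' = Q'" "Q' \<noteq> 0" "Re (\<tau> Q') \<le> Re (\<tau> Q) / 2"
      using half[OF Q(1,2,4)] by blast
    have "P o\<^sub>L Q' = Q'"
      using Q(3) Q'(3) by (intro blinfun_eqI) (metis blinfun_apply_blinfun_compose)
    then show ?case using Q' Q(5) by (intro bexI[of _ Q']) auto
  qed
  obtain n where "(1/2 :: real) ^ n < e" using real_arch_pow_inv[OF e, of "1/2"] by auto
  then show thesis using iter[of n] that by (meson less_imp_le order_trans)
qed

text \<open>Supplies the upper bounds for a maximality argument. Chains are taken among subspaces,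
  where the join is the closed union, and normality evaluates the trace of its projection.\<close>

lemma chain_closure_trace:
  assumes C: "\<C> \<noteq> {}" and chain: "\<And>S S'. S \<in> \<C> \<Longrightarrow> S' \<in> \<C> \<Longrightarrow> S \<subseteq> S' \<or> S' \<subseteq> S"
    and S: "\<And>S. S \<in> \<C> \<Longrightarrow> closed S" "\<And>S. S \<in> \<C> \<Longrightarrow> subspace S"
    and inv: "\<And>S T x. S \<in> \<C> \<Longrightarrow> T \<in> commutant M \<Longrightarrow> x \<in> S \<Longrightarrow> blinfun_apply T x \<in> S"
  defines "U \<equiv> closure (\<Union>\<C>)"
  shows "subspace U" and "\<And>T x. T \<in> commutant M \<Longrightarrow> x \<in> U \<Longrightarrow> blinfun_apply T x \<in> U"
    and "Re (\<tau> (orth_proj U)) = (SUP S\<in>\<C>. Re (\<tau> (orth_proj S)))"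
proof -
  note vN = II1_vN
  have "subspace (\<Union>\<C>)"
  proof (rule subspaceI)
    show "0 \<in> \<Union>\<C>" using C subspace_0[OF S(2)] by blast
    show "x + y \<in> \<Union>\<C>" if xy: "x \<in> \<Union>\<C>" "y \<in> \<Union>\<C>" for x y
    proof -
      obtain X Y where XY: "X \<in> \<C>" "Y \<in> \<C>" "x \<in> X" "y \<in> Y" using xy by blast
      then obtain Z where "Z \<in> \<C>" "x \<in> Z" "y \<in> Z" using chain[of X Y] by blast
      then show ?thesis using subspace_add[OF S(2)] by blast
    qed
    show "r *\<^sub>R x \<in> \<Union>\<C>" if "x \<in> \<Union>\<C>" for r x using that subspace_scale[OF S(2)] by blast
  qed
  then show Us: "subspace U" unfolding U_def by (rule subspace_closure)
  have Uc: "closed U" unfolding U_def by simp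
  have SU: "S \<subseteq> U" if "S \<in> \<C>" for S unfolding U_def by (rule order_trans[OF Union_upper[OF that] closure_subset])
  show Uinv: "T x \<in> U" if T: "T \<in> commutant M" and x: "x \<in> U" for T x
  proof -
    have "blinfun_apply T ` closure (\<Union>\<C>) \<subseteq> U"
    proof (rule image_closure_subset[OF _ Uc])
      show "continuous_on (closure (\<Union>\<C>)) (blinfun_apply T)" by (intro linear_continuous_on blinfun.bounded_linear_right)
      show "blinfun_apply T ` \<Union>\<C> \<subseteq> U" using inv[OF _ T] SU by blast
    qed
    then show ?thesis using x unfolding U_def by blast
  qed
  have PS: "orth_proj S \<in> M" "projection_op (orth_proj S)" if "S \<in> \<C>" for S
    using vn_orth_proj[OF vN S(1)[OF that] S(2)[OF that]] inv[OF that] by blast+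
  have PU: "orth_proj U \<in> M" "projection_op (orth_proj U)"
    using vn_orth_proj[OF vN Uc Us] Uinv by blast+
  have le: "op_le (orth_proj S) (orth_proj S')" if "S \<subseteq> S'" "S \<in> \<C>" "S' = U \<or> S' \<in> \<C>" for S S'
    unfolding op_le_def positive_op_iff using that PS PU S Uc Us
    by (auto intro!: orth_proj_mono vn_BH[OF vN] vn_diff[OF vN])
  have "Re (\<tau> (orth_proj U)) = (SUP A\<in>orth_proj ` \<C>. Re (\<tau> A))"
  proof (rule trace_normal[OF vN tau tau_id])
    show "orth_proj ` \<C> \<subseteq> {A \<in> M. positive_op A}"
      using PS by (auto simp: positive_op_iff projection_op_psd projection_op_BH)
    show "directed_ops (orth_proj ` \<C>)" unfolding directed_ops_def
    proof (intro conjI ballI)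
      fix A B assume "A \<in> orth_proj ` \<C>" "B \<in> orth_proj ` \<C>"
      then obtain S S' where SS: "S \<in> \<C>" "S' \<in> \<C>" "A = orth_proj S" "B = orth_proj S'" by blast
      then obtain X where "X \<in> \<C>" "S \<subseteq> X" "S' \<subseteq> X" using chain[of S S'] by blast
      then show "\<exists>D\<in>orth_proj ` \<C>. op_le A D \<and> op_le B D" using SS le by blast
    qed (use C in simp)
    show "is_lub_in M (orth_proj ` \<C>) (orth_proj U)" unfolding is_lub_in_def
    proof (intro conjI ballI impI)
      show "selfadjoint_op (orth_proj U)" using PU by (simp add: selfadjoint_op_iff projection_op_sym projection_op_BH)
      show "op_le A (orth_proj U)" if "A \<in> orth_proj ` \<C>" for A using that le SU by blast
    next
      fix B assume BM: "B \<in> M" and B: "selfadjoint_op B \<and> (\<forall>A\<in>orth_proj ` \<C>. op_le A B)"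
      have Bs: "sym_op B" using B by (simp add: selfadjoint_op_iff)
      have "x \<bullet> orth_proj U x \<le> x \<bullet> B x" for x
      proof -
        let ?y = "orth_proj U x"
        have "?y \<in> closure (\<Union>\<C>)" using orth_proj_mem[OF Uc Us] unfolding U_def by blast
        then obtain z where z: "\<And>n. z n \<in> \<Union>\<C>" "z \<longlonglongrightarrow> ?y" unfolding closure_sequential by blast
        from z(1) have "\<exists>X. X \<in> \<C> \<and> z n \<in> X" for n by blast
        then obtain X where X: "\<And>n. X n \<in> \<C>" "\<And>n. z n \<in> X n" by metis
        let ?w = "\<lambda>n. orth_proj (X n) x"
        \<comment> \<open>The nearest-point property makes the projections onto members of the chain
          at least as good as the approximating vectors, so their forms at \<open>x\<close> converge
          to that of the join.\<close>
        have near: "norm (?w n - ?y) \<le> norm (z n - ?y)" for n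
          using orth_proj_nearest[OF S(1)[OF X(1)] S(2)[OF X(1)] X(2), of ?y]
          by (simp add: orth_proj_nested[OF S(1)[OF X(1)] S(2)[OF X(1)] Uc Us SU[OF X(1)]] norm_minus_commute)
        have "(\<lambda>n. norm (z n - ?y)) \<longlonglongrightarrow> 0" using z(2) by (simp add: LIM_zero_iff tendsto_norm_zero_iff)
        then have "(\<lambda>n. norm (?w n - ?y)) \<longlonglongrightarrow> 0"
          by (rule tendsto_sandwich[OF _ _ tendsto_const, rotated 2]) (simp_all add: near)
        then have "?w \<longlonglongrightarrow> ?y" by (simp add: LIM_zero_iff tendsto_norm_zero_iff)
        then have "(\<lambda>n. (norm (?w n))\<^sup>2) \<longlonglongrightarrow> (norm ?y)\<^sup>2" by (rule tendsto_power[OF tendsto_norm])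
        moreover have "(norm (?w n))\<^sup>2 \<le> x \<bullet> B x" for n
        proof -
          have "psd (B - orth_proj (X n))" using B X(1) by (simp add: op_le_def positive_op_iff)
          then show ?thesis using psd_nonneg[of "B - orth_proj (X n)" x]
            by (simp add: blinfun.diff_left inner_diff_right orth_proj_inner S X(1))
        qed
        ultimately have "(norm ?y)\<^sup>2 \<le> x \<bullet> B x" by (intro LIMSEQ_le_const2) auto
        then show ?thesis by (simp add: orth_proj_inner[OF Uc Us])
      qed
      then show "op_le (orth_proj U) B"
        unfolding op_le_def positive_op_iff psd_def
        using vn_BH[OF vN vn_diff[OF vN BM PU(1)]] sym_op_arith(2)[OF Bs projection_op_sym[OF PU(2)]]
        by (simp add: blinfun.diff_left inner_diff_right)
    qed (rule PU)
  qed
  then show "Re (\<tau> (orth_proj U)) = (SUP S\<in>\<C>. Re (\<tau> (orth_proj S)))" by (simp add: image_comp)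
qed

text \<open>A maximal invariant subspace of the range of \<open>R\<close> with trace at most
  \<open>t\<close> must attain \<open>t\<close>: otherwise the rest of \<open>R\<close> contains a
  nonzero projection smaller than the deficit, and adding it contradicts maximality.\<close>

lemma subprojection_of_trace:
  assumes R: "R \<in> M" "projection_op R" and t: "0 \<le> t" "t \<le> Re (\<tau> R)"
  obtains Q where "Q \<in> M" "projection_op Q" "R o\<^sub>L Q = Q" "Re (\<tau> Q) = t"
proof -
  note vN = II1_vN
  define \<A> where "\<A> = {S. closed S \<and> subspace S \<and> (\<forall>T\<in>commutant M. \<forall>x\<in>S. T x \<in> S) \<and>
    S \<subseteq> {x. R x = x} \<and> Re (\<tau> (orth_proj S)) \<le> t}"
  have ran: "closed {x. B x = x}" "subspace {x. B x = x}" for B :: "'h op"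
    by (auto intro!: closed_Collect_eq linear_continuous_on blinfun.bounded_linear_right continuous_on_id
      simp: subspace_def blinfun.bilinear_simps)
  have inv: "\<forall>T\<in>commutant M. \<forall>x\<in>{x. B x = x}. T x \<in> {x. B x = x}" if "B \<in> M" for B
  proof (intro ballI)
    fix T x assume T: "T \<in> commutant M" and x: "x \<in> {x. B x = x}"
    show "T x \<in> {x. B x = x}"
      using arg_cong[OF commutant_commute[OF T that], of "\<lambda>S. blinfun_apply S x"] x by simp
  qed
  have t00: "\<tau> 0 = 0" using trace_diff[OF vN tau tau_id vn_id[OF vN] vn_id[OF vN]] by simp
  have zero: "{0} \<in> \<A>"
  proof -
    have "orth_proj {0} = (0 :: 'h op)"
      by (rule blinfun_eqI) (rule orth_proj_eqI, auto simp: subspace_def)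
    then show ?thesis using t(1) by (auto simp: \<A>_def subspace_def t00)
  qed
  have "\<exists>S\<in>\<A>. \<forall>X\<in>\<A>. S \<subseteq> X \<longrightarrow> X = S"
  proof (rule subset_Zorn)
    fix \<C> assume chain: "subset.chain \<A> \<C>"
    show "\<exists>U\<in>\<A>. \<forall>X\<in>\<C>. X \<subseteq> U"
    proof (cases "\<C> = {}")
      case True then show ?thesis using zero by blast
    next
      case False
      have sub: "S \<in> \<A>" if "S \<in> \<C>" for S using chain that by (auto simp: subset.chain_def)
      have ch: "S \<subseteq> S' \<or> S' \<subseteq> S" if "S \<in> \<C>" "S' \<in> \<C>" for S S'
        using chain that by (auto simp: subset.chain_def)
      have A: "closed S" "subspace S" "T \<in> commutant M \<Longrightarrow> x \<in> S \<Longrightarrow> T x \<in> S"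
        "S \<subseteq> {x. R x = x}" "Re (\<tau> (orth_proj S)) \<le> t" if "S \<in> \<C>" for S T x
        using sub[OF that] by (auto simp: \<A>_def)
      let ?U = "closure (\<Union>\<C>)"
      have cl: "subspace ?U" "\<And>T x. T \<in> commutant M \<Longrightarrow> x \<in> ?U \<Longrightarrow> T x \<in> ?U"
        "Re (\<tau> (orth_proj ?U)) = (SUP S\<in>\<C>. Re (\<tau> (orth_proj S)))"
        by (rule chain_closure_trace[OF False ch A(1-3)]; assumption)+
      have "Re (\<tau> (orth_proj ?U)) \<le> t" unfolding cl(3) by (rule cSUP_least[OF False A(5)])
      moreover have "?U \<subseteq> {x. R x = x}" by (rule closure_minimal[OF _ ran(1)]) (use A(4) in blast)
      ultimately have "?U \<in> \<A>" unfolding \<A>_def using cl(1,2) by simp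
      moreover have "\<forall>X\<in>\<C>. X \<subseteq> ?U" by (intro ballI order_trans[OF Union_upper closure_subset])
      ultimately show ?thesis by blast
    qed
  qed
  then obtain S where S: "S \<in> \<A>" and max: "\<And>X. X \<in> \<A> \<Longrightarrow> S \<subseteq> X \<Longrightarrow> X = S" by blast
  have Sc: "closed S" "subspace S" "\<And>T x. T \<in> commutant M \<Longrightarrow> x \<in> S \<Longrightarrow> T x \<in> S"
    "S \<subseteq> {x. R x = x}" "Re (\<tau> (orth_proj S)) \<le> t" using S by (auto simp: \<A>_def)
  define Q where "Q = orth_proj S"
  have Q: "Q \<in> M" "projection_op Q" unfolding Q_def using vn_orth_proj[OF vN Sc(1,2)] Sc(3) by blast+
  have RQ: "R o\<^sub>L Q = Q"
    by (rule blinfun_eqI) (use orth_proj_mem[OF Sc(1,2)] Sc(4) in \<open>auto simp: Q_def\<close>)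
  have "Re (\<tau> Q) = t"
  proof (rule ccontr)
    assume "Re (\<tau> Q) \<noteq> t"
    then have lt: "Re (\<tau> Q) < t" using Sc(5) by (simp add: Q_def)
    note c = subprojection_compl[OF R Q RQ]
    have "R - Q \<noteq> 0" using lt t(2) by auto
    then obtain Q' where Q': "Q' \<in> M" "projection_op Q'" "(R - Q) o\<^sub>L Q' = Q'" "Q' \<noteq> 0" "Re (\<tau> Q') \<le> t - Re (\<tau> Q)"
      using small_subprojection[OF c(1,2), of "t - Re (\<tau> Q)"] lt by auto
    have RQ'': "R (Q' x) - Q (Q' x) = Q' x" for x
      using arg_cong[OF Q'(3), of "\<lambda>T. blinfun_apply T x"] by (simp add: blinfun.diff_left)
    have QQ: "Q (Q x) = Q x" "Q' (Q' x) = Q' x" "R (R x) = R x" "R (Q x) = Q x" "Q (R x) = Q x" for x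
      using Q(2) Q'(2) R(2) RQ c(4) by (auto simp: projection_op_idem_apply dest: arg_cong[where f = "\<lambda>T. blinfun_apply T x"])
    have QQ': "Q (Q' x) = 0" for x
    proof -
      have "Q (R (Q' x) - Q (Q' x)) = 0" by (simp add: blinfun.diff_right QQ)
      then show ?thesis by (simp only: RQ'')
    qed
    have RQ': "R (Q' x) = Q' x" for x using RQ''[of x] by (simp add: QQ')
    have Q'Q: "Q' (Q x) = 0" for x
    proof -
      have "Q' (Q x) \<bullet> y = 0 \<bullet> y" for y
        using Q(2) Q'(2) by (simp add: sym_opD[OF projection_op_sym] QQ')
      then show ?thesis by (rule inner_eqI)
    qed
    \<comment> \<open>\<open>Q'\<close> lies below \<open>R - Q\<close>, hence is orthogonal to
      \<open>Q\<close>; the sum is a projection whose trace is still at most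
      \<open>t\<close>.\<close>
    let ?B = "Q + Q'"
    have BM: "?B \<in> M" by (rule vn_add[OF vN Q(1) Q'(1)])
    have Bp: "sym_op ?B" "?B o\<^sub>L ?B = ?B"
      using Q(2) Q'(2) by (simp_all add: sym_op_arith projection_op_sym blinfun_eq_iff blinfun.bilinear_simps QQ QQ' Q'Q)
    have "{x. ?B x = x} \<in> \<A>" unfolding \<A>_def
    proof (intro CollectI conjI ran inv BM)
      show "{x. ?B x = x} \<subseteq> {x. R x = x}"
      proof
        fix x assume "x \<in> {x. ?B x = x}"
        then have "x = Q x + Q' x" by (simp add: blinfun.add_left)
        then have "R x = R (Q x) + R (Q' x)" by (metis blinfun.add_right)
        then show "x \<in> {x. R x = x}" using \<open>x = Q x + Q' x\<close> by (simp add: QQ RQ')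
      qed
      show "Re (\<tau> (orth_proj {x. ?B x = x})) \<le> t"
        unfolding orth_proj_range_eq[OF Bp] using Q'(5) by (simp add: trace_add[OF vN tau tau_id Q(1) Q'(1)])
    qed
    moreover have "S \<subseteq> {x. ?B x = x}"
    proof
      fix x assume "x \<in> S"
      then have "Q x = x" unfolding Q_def by (simp add: orth_proj_fixed_iff[OF Sc(1,2)])
      moreover from this have "Q' x = 0" using Q'Q[of x] by simp
      ultimately show "x \<in> {x. ?B x = x}" by (simp add: blinfun.add_left)
    qed
    ultimately have eq: "{x. ?B x = x} = S" by (rule max)
    have "Q' x = 0" for x
    proof -
      have "?B (Q' x) = Q' x" by (simp add: blinfun.add_left QQ QQ')
      then have "Q' x \<in> S" using eq by blast
      then have "Q (Q' x) = Q' x" unfolding Q_def by (simp add: orth_proj_fixed_iff[OF Sc(1,2)])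
      then show ?thesis by (simp add: QQ')
    qed
    then have "Q' = 0" by (intro blinfun_eqI) simp
    then show False using Q'(4) by simp
  qed
  then show thesis using that Q RQ by blast
qed

end

end

section \<open>Distribution functions and Choquet integrals\<close>

text \<open>The function d of the overview, written through growth subspaces so that no spectral
  measure has to be chosen. It is meaningful for \<open>0 \<le> s\<close>.\<close>

definition distribution :: "('h::complex_hilbert op \<Rightarrow> complex) \<Rightarrow> 'h op \<Rightarrow> real \<Rightarrow> real" where
  "distribution \<tau> a s = Re (\<tau> (id_blinfun - orth_proj (spec_space (op_abs a) s)))"

lemma spec_space_scaleR:
  assumes r: "0 < r"
  shows "spec_space (r *\<^sub>R A) s = spec_space A (s / r)"
proof -
  have pow: "(blinfun_apply (r *\<^sub>R A) ^^ n) x = r ^ n *\<^sub>R (blinfun_apply A ^^ n) x" for n x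
    by (induction n) (simp_all add: blinfun.bilinear_simps)
  have "norm (r ^ n *\<^sub>R (blinfun_apply A ^^ n) x) \<le> C * s ^ n \<longleftrightarrow> norm ((blinfun_apply A ^^ n) x) \<le> C * (s / r) ^ n" for C n x
    using r by (simp add: power_divide field_simps)
  then show ?thesis unfolding spec_space_def pow by simp
qed

lemma op_abs_projection:
  assumes P: "projection_op P"
  shows "op_abs P = P"
proof (rule op_abs_eqI[OF projection_op_BH[OF P]])
  show "positive_op P" by (simp add: positive_op_iff projection_op_psd[OF P] projection_op_BH[OF P])
  show "P o\<^sub>L P = adj P o\<^sub>L P"
    using sym_op_iff_adj[OF projection_op_BH[OF P]] projection_op_sym[OF P] by simp
qed

lemma op_abs_scaleC:
  assumes a: "a \<in> BH"
  shows "op_abs (op_scaleC c a) = cmod c *\<^sub>R op_abs a"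
proof (rule op_abs_eqI[OF BH_op_scaleC[OF a]])
  show "positive_op (cmod c *\<^sub>R op_abs a)"
    using op_abs_psd[OF a] op_abs_BH[OF a]
    by (auto simp: positive_op_iff psd_def sym_op_scaleR blinfun.scaleR_left)
  show "cmod c *\<^sub>R op_abs a o\<^sub>L cmod c *\<^sub>R op_abs a = adj (op_scaleC c a) o\<^sub>L op_scaleC c a"
  proof (rule blinfun_eqI)
    fix x
    have sq: "op_abs a (op_abs a x) = adj a (a x)" for x
      using arg_cong[OF op_abs_square[OF a], of "\<lambda>T. blinfun_apply T x"] by simp
    have "cnj c *\<^sub>C c *\<^sub>C y = (cmod c * cmod c) *\<^sub>R y" for y :: 'a
      unfolding scaleC_scaleC scaleC_of_real[symmetric]
      by (simp add: mult.commute[of "cnj c"] complex_norm_square[symmetric] power2_eq_square)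
    then show "(cmod c *\<^sub>R op_abs a o\<^sub>L cmod c *\<^sub>R op_abs a) x = (adj (op_scaleC c a) o\<^sub>L op_scaleC c a) x"
      by (simp add: adj_op_scaleC[OF a] op_scaleC.rep_eq blinfun.bilinear_simps sq BH_scaleC[OF adj_BH[OF a]])
  qed
qed

context
  fixes M :: "'h::complex_hilbert op set" and \<tau> :: "'h op \<Rightarrow> complex"
  assumes vN: "von_neumann_algebra M"
    and tau: "faithful_normal_finite_trace M \<tau>" and tau_id: "\<tau> id_blinfun = 1"
begin

lemma spec_abs_closed: "a \<in> M \<Longrightarrow> 0 \<le> s \<Longrightarrow> closed (spec_space (op_abs a) s)"
  by (rule closed_spec_space[OF psd_sym[OF op_abs_psd[OF vn_BH[OF vN]]]])

lemma spec_abs_proj: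
  assumes "a \<in> M" "0 \<le> s"
  shows "orth_proj (spec_space (op_abs a) s) \<in> M" "projection_op (orth_proj (spec_space (op_abs a) s))"
  using vn_spec_proj[OF vN vn_op_abs[OF vN assms(1)] psd_sym[OF op_abs_psd[OF vn_BH[OF vN assms(1)]]] assms(2)]
  by auto

lemma distribution_bounds:
  assumes "a \<in> M" "0 \<le> s"
  shows "0 \<le> distribution \<tau> a s" "distribution \<tau> a s \<le> 1"
  unfolding distribution_def
  by (rule trace_projection_bounds[OF vN tau tau_id];
      intro vn_diff[OF vN] vn_id[OF vN] projection_op_diff_id spec_abs_proj assms)+

lemma distribution_eq: "a \<in> M \<Longrightarrow> 0 \<le> s \<Longrightarrow> distribution \<tau> a s = 1 - Re (\<tau> (orth_proj (spec_space (op_abs a) s)))"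
  by (simp add: distribution_def trace_diff[OF vN tau tau_id vn_id[OF vN] spec_abs_proj(1)] tau_id)

lemma distribution_antimono:
  assumes a: "a \<in> M" and s: "0 \<le> s" "s \<le> t"
  shows "distribution \<tau> a t \<le> distribution \<tau> a s"
proof -
  have t: "0 \<le> t" using s by simp
  have "psd (orth_proj (spec_space (op_abs a) t) - orth_proj (spec_space (op_abs a) s))"
    by (intro orth_proj_mono spec_abs_closed a s t subspace_spec_space spec_space_mono)
  then have "Re (\<tau> (orth_proj (spec_space (op_abs a) s))) \<le> Re (\<tau> (orth_proj (spec_space (op_abs a) t)))"
    by (intro trace_mono[OF vN tau tau_id] spec_abs_proj a s t)
  then show ?thesis using a s t by (simp add: distribution_eq)
qed

lemma distribution_eq_0:
  assumes a: "a \<in> M" and s: "norm (op_abs a) \<le> s"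
  shows "distribution \<tau> a s = 0"
proof -
  have s0: "0 \<le> s" using s norm_ge_zero[of "op_abs a"] by linarith
  note A = op_abs_BH[OF vn_BH[OF vN a]] op_abs_psd[OF vn_BH[OF vN a]]
  have "orth_proj (spec_space (op_abs a) s) = id_blinfun"
    using spec_family_top[OF A s] s0 by (simp add: spec_family_def)
  then show ?thesis by (simp add: distribution_eq[OF a s0] tau_id)
qed

lemma distribution_projection:
  assumes P: "P \<in> M" "projection_op P" and s: "0 \<le> s"
  shows "distribution \<tau> P s = (if s < 1 then Re (\<tau> P) else 0)"
proof (cases "s < 1")
  case True
  let ?Q = "id_blinfun - P"
  have Q: "projection_op ?Q" by (rule projection_op_diff_id[OF P(2)])
  have "spec_space P s = {x. ?Q x = x}"
  proof (rule spec_space_eq_range[OF projection_op_psd[OF P(2)] s])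
    show "sym_op ?Q" "?Q o\<^sub>L ?Q = ?Q" by (rule projection_op_sym[OF Q] projection_op_idem[OF Q])+
    show "?Q o\<^sub>L P = P o\<^sub>L ?Q" by (rule blinfun_eqI) (simp add: blinfun.bilinear_simps)
    show "x \<bullet> P x \<le> s * (x \<bullet> x)" if "?Q x = x" for x using that s by (simp add: blinfun.bilinear_simps)
    show "s * (x \<bullet> x) < x \<bullet> P x" if "?Q x = 0" "x \<noteq> 0" for x
    proof -
      have "P x = x" using that(1) by (simp add: blinfun.bilinear_simps)
      then show ?thesis using that(2) True mult_strict_right_mono[OF True, of "x \<bullet> x"] by simp
    qed
  qed
  then have "orth_proj (spec_space P s) = ?Q"
    using orth_proj_range_eq[OF projection_op_sym[OF Q] projection_op_idem[OF Q]] by simp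
  then show ?thesis using True by (simp add: distribution_def op_abs_projection[OF P(2)])
next
  case False
  have "norm P \<le> 1" by (rule norm_blinfun_bound) (simp_all add: projection_op_inner(3)[OF P(2)])
  then show ?thesis using False by (simp add: distribution_eq_0[OF P(1)] op_abs_projection[OF P(2)])
qed

lemma distribution_scaleC:
  assumes a: "a \<in> M" and c: "c \<noteq> 0"
  shows "distribution \<tau> (op_scaleC c a) s = distribution \<tau> a (s / cmod c)"
  using c by (simp add: distribution_def op_abs_scaleC[OF vn_BH[OF vN a]] spec_space_scaleR)

text \<open>The spectral projections of \<open>\<bar>a\<bar>\<close> for \<open>[0,s]\<close>, of \<open>\<bar>b\<bar>\<close> for \<open>[0,t]\<close> and of \<open>\<bar>a + b\<bar>\<close> for
  \<open>(s + t, \<infinity>)\<close> have no common nonzero vector in their ranges.\<close>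
lemma distribution_add_le:
  assumes a: "a \<in> M" and b: "b \<in> M" and s: "0 \<le> s" and t: "0 \<le> t"
  shows "distribution \<tau> (a + b) (s + t) \<le> distribution \<tau> a s + distribution \<tau> b t"
proof -
  have ab: "a + b \<in> M" by (rule vn_add[OF vN a b])
  have st: "0 \<le> s + t" using s t by simp
  let ?S = "spec_space (op_abs a) s" and ?T = "spec_space (op_abs b) t" and ?U = "spec_space (op_abs (a + b)) (s + t)"
  let ?P = "orth_proj ?S" and ?Q = "orth_proj ?T" and ?R = "id_blinfun - orth_proj ?U"
  note S = spec_abs_closed[OF a s] subspace_spec_space[of "op_abs a" s]
  note T = spec_abs_closed[OF b t] subspace_spec_space[of "op_abs b" t]
  note U = spec_abs_closed[OF ab st] subspace_spec_space[of "op_abs (a + b)" "s + t"]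
  have P: "?P \<in> M" "projection_op ?P" by (rule spec_abs_proj[OF a s])+
  have Q: "?Q \<in> M" "projection_op ?Q" by (rule spec_abs_proj[OF b t])+
  have R: "?R \<in> M" "projection_op ?R"
    by (intro vn_diff[OF vN] vn_id[OF vN] projection_op_diff_id spec_abs_proj[OF ab st])+
  define G where "G = orth_proj ({x. ?P x = x} \<inter> {x. ?Q x = x})"
  have G: "G \<in> M" "projection_op G" "Re (\<tau> ?P) + Re (\<tau> ?Q) \<le> 1 + Re (\<tau> G)"
    unfolding G_def by (rule trace_proj_Int[OF vN tau tau_id P Q])+
  have PQ: "{x. ?P x = x} \<inter> {x. ?Q x = x} = ?S \<inter> ?T"
    by (simp add: orth_proj_fixed_iff[OF S] orth_proj_fixed_iff[OF T])
  have "{x. ?R x = x} \<inter> {x. G x = x} = {0}"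
  proof (intro equalityI subsetI)
    fix x assume x: "x \<in> {x. ?R x = x} \<inter> {x. G x = x}"
    have "x \<in> ?S \<inter> ?T"
      using x unfolding G_def PQ
      by (subst (asm) orth_proj_fixed_iff) (auto intro!: closed_Int subspace_inter S T)
    \<comment> \<open>Bounds for the moduli are bounds for \<open>a\<close> and \<open>b\<close>, to
      which the triangle inequality applies; the moduli themselves are not subadditive.\<close>
    then have "norm (op_abs a x) \<le> s * norm x" "norm (op_abs b x) \<le> t * norm x"
      using spec_space_norm_le[OF psd_sym[OF op_abs_psd[OF vn_BH[OF vN a]]] s]
        spec_space_norm_le[OF psd_sym[OF op_abs_psd[OF vn_BH[OF vN b]]] t] by auto
    then have "norm ((a + b) x) \<le> (s + t) * norm x"
      using norm_triangle_ineq[of "a x" "b x"]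
      by (simp add: norm_op_abs[OF vn_BH[OF vN a]] norm_op_abs[OF vn_BH[OF vN b]] blinfun.add_left algebra_simps)
    then have le: "norm (op_abs (a + b) x) \<le> (s + t) * norm x" by (simp add: norm_op_abs[OF vn_BH[OF vN ab]])
    have "orth_proj ?U x = 0" using x by (simp add: blinfun.diff_left)
    then have orth: "\<And>z. z \<in> ?U \<Longrightarrow> x \<bullet> z = 0" using orth_proj_eq_0_iff[OF U] by blast
    show "x \<in> {0}"
    proof (rule ccontr)
      assume "x \<notin> {0}"
      then have "(s + t) * (x \<bullet> x) < x \<bullet> op_abs (a + b) x"
        using spec_space_complement[OF op_abs_psd[OF vn_BH[OF vN ab]] st orth] by simp
      also have "\<dots> \<le> norm x * norm (op_abs (a + b) x)" by (rule norm_cauchy_schwarz)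
      also have "\<dots> \<le> norm x * ((s + t) * norm x)" by (intro mult_left_mono le norm_ge_zero)
      finally show False by (simp add: dot_square_norm power2_eq_square mult_ac)
    qed
  qed (simp add: blinfun.zero_right)
  moreover have "orth_proj {0} = (0 :: 'h op)"
    by (rule blinfun_eqI) (rule orth_proj_eqI, auto simp: subspace_def)
  moreover have "\<tau> 0 = 0" using trace_diff[OF vN tau tau_id vn_id[OF vN] vn_id[OF vN]] by simp
  \<comment> \<open>A second use of the meet inequality, now for two projections whose meet is
    0.\<close>
  ultimately have "Re (\<tau> ?R) + Re (\<tau> G) \<le> 1"
    using trace_proj_Int(3)[OF vN tau tau_id R G(1,2)] by simp
  then show ?thesis
    using G(3) distribution_eq[OF a s] distribution_eq[OF b t] by (simp add: distribution_def)
qed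

lemma choquet_trace_abs:
  assumes a: "a \<in> M"
  shows "choquet_trace \<tau> \<alpha> (op_abs a) = (\<integral>\<^sup>+ s\<in>{0..}. ennreal (\<alpha> (distribution \<tau> a s)) \<partial>lborel)"
  unfolding choquet_trace_def distribution_def
  by (intro nn_integral_cong)
     (simp add: indicator_def spectral_measure_greaterThan[OF op_abs_BH[OF vn_BH[OF vN a]] op_abs_psd[OF vn_BH[OF vN a]]])

lemma choquet_trace_powr:
  assumes a: "a \<in> M" and p: "0 < p"
  shows "choquet_trace \<tau> \<alpha> (op_powr (op_abs a) p)
    = (\<integral>\<^sup>+ s\<in>{0..}. ennreal (\<alpha> (distribution \<tau> a (s powr (1 / p)))) \<partial>lborel)"
proof -
  note A = op_abs_BH[OF vn_BH[OF vN a]] op_abs_psd[OF vn_BH[OF vN a]]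
  show ?thesis
    unfolding choquet_trace_def distribution_def
    by (intro nn_integral_cong)
       (simp add: indicator_def op_powr_greaterThan[OF A p] spectral_measure_greaterThan[OF A])
qed

section \<open>Choquet integrals of a monotone weight\<close>

context
  fixes \<alpha> :: "real \<Rightarrow> real"
  assumes alpha_nonneg: "\<forall>s\<in>{0..1}. 0 \<le> \<alpha> s"
    and alpha_mono: "mono_on {0..1} \<alpha>"
    and alpha_0: "\<alpha> 0 = 0"
    and alpha_ext: "\<forall>s>1. \<alpha> s = \<alpha> 1"
begin

text \<open>Monotonicity is needed beyond 1, since a sum of two values of the distribution functions
  can reach 2.\<close>

lemma alpha_mono': "0 \<le> u \<Longrightarrow> u \<le> v \<Longrightarrow> \<alpha> u \<le> \<alpha> v"
  using mono_onD[OF alpha_mono, of u v] mono_onD[OF alpha_mono, of u 1]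
    alpha_ext[rule_format, of u] alpha_ext[rule_format, of v]
  by (cases "u \<le> 1"; cases "v \<le> 1") simp_all

lemma alpha_nonneg': "0 \<le> u \<Longrightarrow> 0 \<le> \<alpha> u"
  using alpha_mono'[of 0 u] alpha_0 by simp

lemma alpha_add_le:
  assumes C: "0 \<le> C" "\<And>s. s \<in> {0..1} \<Longrightarrow> \<alpha> (2 * s) \<le> C * \<alpha> s" and u: "u \<in> {0..1}" and v: "v \<in> {0..1}"
  shows "\<alpha> (u + v) \<le> C * (\<alpha> u + \<alpha> v)"
proof -
  have "\<alpha> (u + v) \<le> \<alpha> (2 * max u v)" using u v by (intro alpha_mono') auto
  also have "\<dots> \<le> C * \<alpha> (max u v)" using u v by (intro C(2)) auto
  also have "\<dots> \<le> C * (\<alpha> u + \<alpha> v)"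
    using u v alpha_nonneg by (intro mult_left_mono C(1)) (auto simp: max_def)
  finally show ?thesis .
qed

text \<open>The Choquet trace of the p-th power of the modulus, in terms of the level sets of the
  modulus itself; \<open>p = 1\<close> covers condition (1).\<close>

definition choquet_int :: "real \<Rightarrow> 'h op \<Rightarrow> ennreal" where
  "choquet_int p a = (\<integral>\<^sup>+ s\<in>{0..}. ennreal (\<alpha> (distribution \<tau> a (s powr (1 / p)))) \<partial>lborel)"

lemma choquet_trace_powr_int: "a \<in> M \<Longrightarrow> 0 < p \<Longrightarrow> choquet_trace \<tau> \<alpha> (op_powr (op_abs a) p) = choquet_int p a"
  by (simp add: choquet_trace_powr choquet_int_def)

lemma choquet_trace_abs_int: "a \<in> M \<Longrightarrow> choquet_trace \<tau> \<alpha> (op_abs a) = choquet_int 1 a"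
  unfolding choquet_trace_abs choquet_int_def by (intro nn_integral_cong) (simp add: indicator_def)

lemma choquet_measurable:
  assumes a: "a \<in> M"
  shows "(\<lambda>s. ennreal (\<alpha> (distribution \<tau> a (s powr r))) * indicator {0..} s) \<in> borel_measurable borel"
proof -
  \<comment> \<open>Truncation at 0 makes the function monotone on the whole line, hence
    Borel.\<close>
  let ?h = "\<lambda>s. \<alpha> (distribution \<tau> a (max 0 s))"
  have "mono (\<lambda>s. - ?h s)"
    by (intro monoI le_imp_neg_le alpha_mono' distribution_bounds distribution_antimono a) auto
  then have "(\<lambda>s. - (- ?h s)) \<in> borel_measurable borel"
    by (intro borel_measurable_uminus borel_measurable_mono)
  then have [measurable]: "?h \<in> borel_measurable borel" by simp
  have "(\<lambda>s. ennreal (?h (s powr r)) * indicator {0..} s) \<in> borel_measurable borel" by measurable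
  then show ?thesis by simp
qed

lemma choquet_int_finite:
  assumes a: "a \<in> M" and p: "0 < p"
  shows "choquet_int p a < \<infinity>"
proof -
  let ?K = "norm (op_abs a)"
  \<comment> \<open>The integrand vanishes above the p-th power of the norm and never exceeds
    \<open>\<alpha> 1\<close>.\<close>
  have "choquet_int p a \<le> (\<integral>\<^sup>+ s. ennreal (\<alpha> 1) * indicator {0..?K powr p} s \<partial>lborel)"
    unfolding choquet_int_def
  proof (intro nn_integral_mono)
    fix s :: real
    show "ennreal (\<alpha> (distribution \<tau> a (s powr (1 / p)))) * indicator {0..} s \<le> ennreal (\<alpha> 1) * indicator {0..?K powr p} s"
    proof (cases "0 \<le> s \<and> ?K powr p < s")
      case True
      then have "(?K powr p) powr (1 / p) \<le> s powr (1 / p)" using p by (intro powr_mono2) auto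
      then have "?K \<le> s powr (1 / p)" using p by (simp add: powr_powr)
      then show ?thesis by (simp add: distribution_eq_0[OF a] alpha_0)
    next
      case False
      have "\<alpha> (distribution \<tau> a (s powr (1 / p))) \<le> \<alpha> 1"
        by (intro alpha_mono' distribution_bounds a) auto
      then show ?thesis using False by (auto simp: indicator_def intro: ennreal_leI)
    qed
  qed
  also have "\<dots> < \<infinity>" by (simp add: nn_integral_cmult ennreal_mult_less_top)
  finally show ?thesis .
qed

text \<open>The substitution s -> cs, used with \<open>cmod \<gamma> powr p\<close> for homogeneity
  and with \<open>2 powr p\<close> for the quasi-triangle inequality.\<close>

lemma choquet_int_scale:
  assumes a: "a \<in> M" and c: "0 < c"
  shows "choquet_int p a = ennreal c * (\<integral>\<^sup>+ s\<in>{0..}. ennreal (\<alpha> (distribution \<tau> a ((c * s) powr (1 / p)))) \<partial>lborel)"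
proof -
  have "indicator {0..} (c * s) = (indicator {0..} s :: ennreal)" for s :: real
    using c by (simp add: indicator_def zero_le_mult_iff)
  then show ?thesis
    unfolding choquet_int_def
    using nn_integral_real_affine[OF choquet_measurable[OF a], of c "1 / p" 0] c by simp
qed

lemma choquet_int_scaleC:
  assumes a: "a \<in> M" and p: "0 < p" and \<gamma>: "\<gamma> \<noteq> 0"
  shows "choquet_int p (op_scaleC \<gamma> a) = ennreal (cmod \<gamma> powr p) * choquet_int p a"
proof -
  let ?c = "cmod \<gamma> powr p"
  have c: "0 < ?c" using \<gamma> by simp
  have e: "(?c * s) powr (1 / p) / cmod \<gamma> = s powr (1 / p)" if "0 \<le> s" for s
    using that \<gamma> p by (simp add: powr_mult powr_powr)
  show ?thesis
    unfolding choquet_int_scale[OF vn_op_scaleC[OF vN a] c] unfolding choquet_int_def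
    by (rule arg_cong2[where f = "(*)", OF refl nn_integral_cong])
       (simp add: e distribution_scaleC[OF a \<gamma>] split: split_indicator)
qed

lemma choquet_int_projection:
  assumes P: "P \<in> M" "projection_op P" and p: "0 < p"
  shows "choquet_int p P = ennreal (\<alpha> (Re (\<tau> P)))"
proof -
  have "choquet_int p P = (\<integral>\<^sup>+ s. ennreal (\<alpha> (Re (\<tau> P))) * indicator {0..<1::real} s \<partial>lborel)"
    unfolding choquet_int_def
  proof (intro nn_integral_cong)
    fix s :: real
    have "s powr (1 / p) < 1 \<longleftrightarrow> s < 1" if "0 \<le> s"
      using that p powr_less_mono2[of "1 / p" s 1] powr_mono2[of "1 / p" 1 s] by fastforce
    then show "ennreal (\<alpha> (distribution \<tau> P (s powr (1 / p)))) * indicator {0..} s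
      = ennreal (\<alpha> (Re (\<tau> P))) * indicator {0..<1} s"
      by (auto simp: indicator_def distribution_projection[OF P] alpha_0)
  qed
  also have "\<dots> = ennreal (\<alpha> (Re (\<tau> P)))" by (simp add: nn_integral_cmult)
  finally show ?thesis .
qed

text \<open>The factor \<open>2 powr p\<close> rescales the level so that its p-th root becomes r +
  r, one share for each of \<open>a\<close> and \<open>b\<close>; the factor \<open>C\<close> is the
  doubling constant.\<close>

lemma choquet_int_add_le:
  assumes C: "0 \<le> C" "\<And>s. s \<in> {0..1} \<Longrightarrow> \<alpha> (2 * s) \<le> C * \<alpha> s"
    and a: "a \<in> M" and b: "b \<in> M" and p: "0 < p"
  shows "choquet_int p (a + b) \<le> ennreal (2 powr p * C) * (choquet_int p a + choquet_int p b)"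
proof -
  have ab: "a + b \<in> M" by (rule vn_add[OF vN a b])
  let ?f = "\<lambda>a s. ennreal (\<alpha> (distribution \<tau> a (s powr (1 / p)))) * indicator {0..} s"
  have f: "?f c \<in> borel_measurable lborel" if "c \<in> M" for c using choquet_measurable[OF that] by simp
  have "choquet_int p (a + b)
      = ennreal (2 powr p) * (\<integral>\<^sup>+ s\<in>{0..}. ennreal (\<alpha> (distribution \<tau> (a + b) ((2 powr p * s) powr (1 / p)))) \<partial>lborel)"
    by (rule choquet_int_scale[OF ab]) simp
  also have "\<dots> \<le> ennreal (2 powr p) * (\<integral>\<^sup>+ s. ennreal C * (?f a s + ?f b s) \<partial>lborel)"
  proof (intro mult_left_mono nn_integral_mono zero_le)
    fix s :: real
    show "ennreal (\<alpha> (distribution \<tau> (a + b) ((2 powr p * s) powr (1 / p)))) * indicator {0..} s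
        \<le> ennreal C * (?f a s + ?f b s)"
    proof (cases "0 \<le> s")
      case True
      let ?r = "s powr (1 / p)"
      have "(2 powr p * s) powr (1 / p) = ?r + ?r" using True p by (simp add: powr_mult powr_powr)
      moreover have "\<alpha> (distribution \<tau> (a + b) (?r + ?r)) \<le> \<alpha> (distribution \<tau> a ?r + distribution \<tau> b ?r)"
        by (intro alpha_mono' distribution_bounds distribution_add_le ab a b) auto
      moreover have "\<dots> \<le> C * (\<alpha> (distribution \<tau> a ?r) + \<alpha> (distribution \<tau> b ?r))"
        by (rule alpha_add_le[OF C]) (simp_all add: distribution_bounds a b)
      moreover have "0 \<le> \<alpha> (distribution \<tau> a ?r)" "0 \<le> \<alpha> (distribution \<tau> b ?r)"
        by (intro alpha_nonneg' distribution_bounds a b; simp)+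
      ultimately show ?thesis
        using True C(1) by (simp add: ennreal_leI flip: ennreal_mult ennreal_plus)
    qed simp
  qed
  also have "\<dots> = ennreal (2 powr p) * (ennreal C * (choquet_int p a + choquet_int p b))"
    unfolding choquet_int_def using f[OF a] f[OF b]
    by (subst nn_integral_cmult) (auto simp: nn_integral_add)
  also have "\<dots> = ennreal (2 powr p * C) * (choquet_int p a + choquet_int p b)"
    using C(1) by (simp add: ennreal_mult mult.assoc)
  finally show ?thesis .
qed

lemma choquet_norm_eq:
  assumes a: "a \<in> M" and p: "0 < p"
  shows "choquet_norm \<tau> \<alpha> p a = ennreal (enn2real (choquet_int p a) powr (1 / p))"
  using choquet_int_finite[OF a p] by (simp add: choquet_norm_def ennreal_powr_def choquet_trace_powr_int[OF a p])

lemma choquet_int_real: "a \<in> M \<Longrightarrow> 0 < p \<Longrightarrow> choquet_int p a = ennreal (enn2real (choquet_int p a))"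
  using choquet_int_finite by (simp add: less_top)

lemma quasi_norm_choquet:
  assumes C: "0 \<le> C" "\<And>s. s \<in> {0..1} \<Longrightarrow> \<alpha> (2 * s) \<le> C * \<alpha> s" and p: "0 < p"
  shows "quasi_norm_on M op_scaleC (choquet_norm \<tau> \<alpha> p)"
proof -
  define D where "D = 2 powr p * C"
  have D: "0 \<le> D" using C(1) by (simp add: D_def)
  \<comment> \<open>The 2 inside comes from bounding a sum by twice a maximum, which passes through
    the power 1/p for every p > 0; the added 2 ensures \<open>1 < c\<close>.\<close>
  define c where "c = (2 * D) powr (1 / p) + 2"
  let ?i = "\<lambda>a. enn2real (choquet_int p a)"
  have c: "1 < c" unfolding c_def using powr_ge_zero[of "2 * D" "1 / p"] by linarith
  have hom: "choquet_norm \<tau> \<alpha> p (op_scaleC \<gamma> a) = ennreal (cmod \<gamma>) * choquet_norm \<tau> \<alpha> p a" if a: "a \<in> M" for a \<gamma>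
  \<comment> \<open>The scaling law of the distribution function divides by
    \<open>cmod \<gamma>\<close>, so the zero scalar is treated separately.\<close>
  proof (cases "\<gamma> = 0")
    case True
    have "op_scaleC 0 a = 0"
      using scaleC_of_real[of 0] by (intro blinfun_eqI) (simp add: op_scaleC.rep_eq)
    moreover have "choquet_int p 0 = 0"
      using choquet_int_projection[OF vn_0[OF vN] _ p] trace_diff[OF vN tau tau_id vn_id[OF vN] vn_id[OF vN]]
      by (simp add: projection_op_iff alpha_0 blinfun_eq_iff)
    ultimately show ?thesis using True by (simp add: choquet_norm_eq[OF vn_0[OF vN] p])
  next
    case False
    have "?i (op_scaleC \<gamma> a) = cmod \<gamma> powr p * ?i a"
      by (simp add: choquet_int_scaleC[OF a p False] enn2real_mult)
    then have "?i (op_scaleC \<gamma> a) powr (1 / p) = cmod \<gamma> * ?i a powr (1 / p)"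
      using p by (simp add: powr_mult powr_powr)
    then show ?thesis by (simp add: choquet_norm_eq[OF vn_op_scaleC[OF vN a] p] choquet_norm_eq[OF a p] ennreal_mult)
  qed
  have tri: "choquet_norm \<tau> \<alpha> p (a + b) \<le> ennreal c * (choquet_norm \<tau> \<alpha> p a + choquet_norm \<tau> \<alpha> p b)"
    if a: "a \<in> M" and b: "b \<in> M" for a b
  proof -
    have ab: "a + b \<in> M" by (rule vn_add[OF vN a b])
    let ?x = "?i a" and ?y = "?i b"
    have "ennreal (?i (a + b)) \<le> ennreal D * (ennreal ?x + ennreal ?y)"
      using choquet_int_add_le[OF C a b p] choquet_int_real[OF ab p] choquet_int_real[OF a p] choquet_int_real[OF b p]
      by (simp add: D_def)
    also have "\<dots> = ennreal (D * (?x + ?y))" using D by (simp add: ennreal_mult)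
    finally have "?i (a + b) \<le> D * (?x + ?y)" using D by (simp add: ennreal_le_iff)
    also have "\<dots> \<le> D * (2 * max ?x ?y)" using D by (intro mult_left_mono) auto
    finally have "?i (a + b) powr (1 / p) \<le> ((2 * D) * max ?x ?y) powr (1 / p)"
      using p by (intro powr_mono2) (simp_all add: mult_ac)
    also have "\<dots> = (2 * D) powr (1 / p) * max ?x ?y powr (1 / p)" by (rule powr_mult)
    also have "\<dots> \<le> c * (?x powr (1 / p) + ?y powr (1 / p))"
      by (rule mult_mono) (auto simp: c_def max_def add_nonneg_nonneg)
    finally show ?thesis
      using c by (simp add: choquet_norm_eq a b ab p ennreal_leI flip: ennreal_plus ennreal_mult)
  qed
  show ?thesis unfolding quasi_norm_on_def
    using c hom tri by (intro exI[of _ c]) (simp add: choquet_norm_eq p)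
qed

end

end

section \<open>Doubling from projections and the equivalences\<close>

text \<open>Two orthogonal projections of trace s exist only for s at most 1/2. Beyond that,
  doubling reaches the constant part of \<alpha>, and the inequality at 1/2 suffices.\<close>

lemma doubling_from_half:
  fixes \<alpha> :: "real \<Rightarrow> real"
  assumes mono: "mono_on {0..1} \<alpha>" and ext: "\<forall>s>1. \<alpha> s = \<alpha> 1"
    and K: "0 \<le> K" "\<And>s. 0 \<le> s \<Longrightarrow> s \<le> 1 / 2 \<Longrightarrow> \<alpha> (2 * s) \<le> K * \<alpha> s"
  shows "\<forall>s\<in>{0..1}. \<alpha> (2 * s) \<le> K * \<alpha> s"
proof
  fix s :: real assume s: "s \<in> {0..1}"
  show "\<alpha> (2 * s) \<le> K * \<alpha> s"
  proof (cases "s \<le> 1 / 2")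
    case True then show ?thesis using s K(2) by simp
  next
    case False
    then have "\<alpha> (2 * s) = \<alpha> 1" using ext by simp
    also have "\<dots> \<le> K * \<alpha> (1 / 2)" using K(2)[of "1 / 2"] by simp
    also have "\<dots> \<le> K * \<alpha> s" using s False by (intro mult_left_mono K(1) mono_onD[OF mono]) auto
    finally show ?thesis .
  qed
qed

text \<open>A projection of trace 2s is chosen, then a subprojection of trace s and its complement
  in the first. Since the sum is again a projection, all three Choquet integrals reduce to values of
  \<alpha>.\<close>

lemma II1_equal_trace_projections:
  fixes M :: "'h::complex_hilbert op set"
  assumes M: "factor_type_II1 M" and tau: "faithful_normal_finite_trace M \<tau>" "\<tau> id_blinfun = 1"
    and s: "0 \<le> s" "s \<le> 1 / 2"
  obtains P Q where "P \<in> M" "Q \<in> M" "projection_op P" "projection_op Q" "projection_op (P + Q)"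
    "Re (\<tau> P) = s" "Re (\<tau> Q) = s" "Re (\<tau> (P + Q)) = 2 * s"
proof -
  note vN = II1_vN[OF M]
  have id: "projection_op (id_blinfun :: 'h op)" by (simp add: projection_op_iff blinfun_eq_iff)
  obtain R where R: "R \<in> M" "projection_op R" "Re (\<tau> R) = 2 * s"
    using subprojection_of_trace[OF M tau vn_id[OF vN] id, of "2 * s"] s tau(2) by auto
  obtain P where P: "P \<in> M" "projection_op P" "R o\<^sub>L P = P" "Re (\<tau> P) = s"
    using subprojection_of_trace[OF M tau R(1,2), of s] s R(3) by auto
  note c = subprojection_compl[OF M tau R(1,2) P(1-3)]
  show thesis
    by (rule that[of P "R - P"])
       (use P R c in \<open>simp_all add: trace_diff[OF vN tau R(1) P(1)]\<close>)
qed

theorem theorem2p31: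
  fixes M :: "('h::complex_hilbert) op set"
    and \<tau> :: "'h op \<Rightarrow> complex"
    and \<alpha> :: "real \<Rightarrow> real"
  assumes M: "factor_type_II1 M"
    and tau: "faithful_normal_finite_trace M \<tau>" "\<tau> id_blinfun = 1"
    and alpha_nonneg: "\<forall>s\<in>{0..1}. 0 \<le> \<alpha> s"
    and alpha_mono: "mono_on {0..1} \<alpha>"
    and alpha_cont: "continuous_on {0..1} \<alpha>"
    and alpha_0: "\<alpha> 0 = 0"
    and alpha_ext: "\<forall>s>1. \<alpha> s = \<alpha> 1"
  shows
    "((\<exists>\<beta>::real. \<beta> > 0 \<and> (\<forall>a\<in>M. \<forall>b\<in>M.
         choquet_trace \<tau> \<alpha> (op_abs (a + b))
           \<le> ennreal \<beta> * (choquet_trace \<tau> \<alpha> (op_abs a) + choquet_trace \<tau> \<alpha> (op_abs b))))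
      \<longleftrightarrow> (\<exists>C::real. \<forall>s\<in>{0..1}. \<alpha> (2 * s) \<le> C * \<alpha> s)) \<and>
     ((\<exists>C::real. \<forall>s\<in>{0..1}. \<alpha> (2 * s) \<le> C * \<alpha> s)
      \<longleftrightarrow> (\<forall>p>0. quasi_norm_on M op_scaleC (choquet_norm \<tau> \<alpha> p))) \<and>
     ((\<forall>p>0. quasi_norm_on M op_scaleC (choquet_norm \<tau> \<alpha> p))
      \<longleftrightarrow> (\<exists>p>0. quasi_norm_on M op_scaleC (choquet_norm \<tau> \<alpha> p)))"
    (is "(?one \<longleftrightarrow> ?two) \<and> (_ \<longleftrightarrow> ?three) \<and> (_ \<longleftrightarrow> ?four)")
proof -
  note vN = II1_vN[OF M]
  note ctx = vN tau alpha_nonneg alpha_mono alpha_0 alpha_ext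
  have nn: "0 \<le> \<alpha> u" if "0 \<le> u" for u by (rule alpha_nonneg'[OF ctx that])
  have two: "\<exists>C>0. \<forall>s\<in>{0..1}. \<alpha> (2 * s) \<le> C * \<alpha> s" if h: ?two
  proof -
    obtain C where C: "\<forall>s\<in>{0..1}. \<alpha> (2 * s) \<le> C * \<alpha> s" using h by blast
    \<comment> \<open>Condition (2) leaves the sign of the constant open; enlarging it is allowed
      because \<alpha> is nonnegative.\<close>
    have "\<alpha> (2 * s) \<le> max C 1 * \<alpha> s" if "s \<in> {0..1}" for s
      using C that mult_right_mono[of C "max C 1" "\<alpha> s"] nn[of s] by fastforce
    then show ?thesis by (intro exI[of _ "max C 1"]) auto
  qed
  have "?two \<Longrightarrow> ?one"
  proof -
    assume ?two
    then obtain C where C: "0 < C" "\<And>s. s \<in> {0..1} \<Longrightarrow> \<alpha> (2 * s) \<le> C * \<alpha> s" using two by blast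
    show ?one
    proof (intro exI[of _ "2 powr 1 * C"] conjI ballI)
      fix a b assume ab: "a \<in> M" "b \<in> M"
      show "choquet_trace \<tau> \<alpha> (op_abs (a + b)) \<le> ennreal (2 powr 1 * C) * (choquet_trace \<tau> \<alpha> (op_abs a) + choquet_trace \<tau> \<alpha> (op_abs b))"
        unfolding choquet_trace_abs_int[OF ctx ab(1)] choquet_trace_abs_int[OF ctx ab(2)] choquet_trace_abs_int[OF ctx vn_add[OF vN ab]]
        by (rule choquet_int_add_le[OF ctx _ C(2) ab]) (use C(1) in auto)
    qed (use C(1) in simp)
  qed
  moreover have "?one \<Longrightarrow> ?two"
  proof -
    assume ?one
    then obtain \<beta> where \<beta>: "0 < \<beta>" and le: "\<And>a b. a \<in> M \<Longrightarrow> b \<in> M \<Longrightarrow> choquet_trace \<tau> \<alpha> (op_abs (a + b))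
      \<le> ennreal \<beta> * (choquet_trace \<tau> \<alpha> (op_abs a) + choquet_trace \<tau> \<alpha> (op_abs b))" by blast
    have "\<alpha> (2 * s) \<le> (2 * \<beta>) * \<alpha> s" if s: "0 \<le> s" "s \<le> 1 / 2" for s
    proof -
      obtain P Q where PQ: "P \<in> M" "Q \<in> M" "projection_op P" "projection_op Q" "projection_op (P + Q)"
        "Re (\<tau> P) = s" "Re (\<tau> Q) = s" "Re (\<tau> (P + Q)) = 2 * s"
        by (rule II1_equal_trace_projections[OF M tau s])
      have "ennreal (\<alpha> (2 * s)) \<le> ennreal \<beta> * (ennreal (\<alpha> s) + ennreal (\<alpha> s))"
        using le[OF PQ(1,2)] vn_add[OF vN PQ(1,2)] PQ
        by (simp add: choquet_trace_abs_int[OF ctx] choquet_int_projection[OF ctx])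
      also have "\<dots> = ennreal ((2 * \<beta>) * \<alpha> s)"
        using \<beta> nn[OF s(1)] by (simp add: field_simps flip: ennreal_plus ennreal_mult)
      finally show ?thesis using \<beta> nn[OF s(1)] by (simp add: ennreal_le_iff)
    qed
    then show ?two using doubling_from_half[OF alpha_mono alpha_ext, of "2 * \<beta>"] \<beta> by auto
  qed
  moreover have "?two \<Longrightarrow> ?three"
  proof -
    assume ?two
    then obtain C where C: "0 < C" "\<And>s. s \<in> {0..1} \<Longrightarrow> \<alpha> (2 * s) \<le> C * \<alpha> s" using two by blast
    show ?three using quasi_norm_choquet[OF ctx less_imp_le[OF C(1)] C(2)] by blast
  qed
  moreover have "?three \<Longrightarrow> ?four" using zero_less_one by blast
  moreover have "?four \<Longrightarrow> ?two"
  proof -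
    assume ?four
    then obtain p where p: "0 < p" and "quasi_norm_on M op_scaleC (choquet_norm \<tau> \<alpha> p)" by blast
    then obtain c :: real where c: "1 < c"
      and le: "\<And>a b. a \<in> M \<Longrightarrow> b \<in> M \<Longrightarrow> choquet_norm \<tau> \<alpha> p (a + b) \<le> ennreal c * (choquet_norm \<tau> \<alpha> p a + choquet_norm \<tau> \<alpha> p b)"
      unfolding quasi_norm_on_def by blast
    \<comment> \<open>At two projections the quasi-norm inequality relates p-th roots with factor
      2c; taking p-th powers gives this constant.\<close>
    have "\<alpha> (2 * s) \<le> (2 * c) powr p * \<alpha> s" if s: "0 \<le> s" "s \<le> 1 / 2" for s
    proof -
      obtain P Q where PQ: "P \<in> M" "Q \<in> M" "projection_op P" "projection_op Q" "projection_op (P + Q)"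
        "Re (\<tau> P) = s" "Re (\<tau> Q) = s" "Re (\<tau> (P + Q)) = 2 * s"
        by (rule II1_equal_trace_projections[OF M tau s])
      let ?x = "\<alpha> s powr (1 / p)"
      have s2: "0 \<le> \<alpha> (2 * s)" and s1: "0 \<le> \<alpha> s" using nn s by auto
      have "ennreal (\<alpha> (2 * s) powr (1 / p)) \<le> ennreal c * (ennreal ?x + ennreal ?x)"
        using le[OF PQ(1,2)] vn_add[OF vN PQ(1,2)] PQ p s1 s2
        by (simp add: choquet_norm_eq[OF ctx] choquet_int_projection[OF ctx])
      also have "\<dots> = ennreal ((2 * c) * ?x)"
        using c by (simp add: field_simps flip: ennreal_plus ennreal_mult)
      finally have "\<alpha> (2 * s) powr (1 / p) \<le> (2 * c) * ?x" using c by (simp add: ennreal_le_iff)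
      then have "(\<alpha> (2 * s) powr (1 / p)) powr p \<le> ((2 * c) * ?x) powr p" using p by (intro powr_mono2) auto
      then show ?thesis using p c s1 s2 by (simp add: powr_powr powr_mult)
    qed
    then show ?two using doubling_from_half[OF alpha_mono alpha_ext, of "(2 * c) powr p"] by auto
  qed
  ultimately show ?thesis by blast
qed

end
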